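(* Let $A$ be a unital separable simple infinite dimensional C*-algebra which has uniform property $\Gamma$. Let $G$ be a second-countable compact group and let $\alpha\colon G\to\mathrm{Aut}(A)$ be an action which has the tracial Rokhlin property with comparison. Then the fixed point algebra $A^\alpha=\{a\in A:\alpha_g(a)=a\ \forall g\in G\}$ has uniform property $\Gamma$.
   Context: Uniform property $\Gamma$: Let $\omega$ be a fixed free ultrafilter on $\mathbb{N}$. For a C*-algebra $A$, $A_\omega=\ell^\infty(\mathbb{N},A)/\{(a_n):\lim_{n\to\omega}\|a_n\|=0\}$, with $A$ embedded as constant sequences. A limit trace is a tracial state on $A_\omega$ of the form $(a_n)\mapsto\lim_{n\to\omega}\tau_n(a_n)$ for tracial states $\tau_n$ on $A$; their set is $\mathrm{T}_\omega(A)$. Let $J_A=\{x\in A_\omega:\tau(x^*x)=0\ \forall\tau\in\mathrm{T}_\omega(A)\}$ and $A^\omega=A_\omega/J_A$ (limit traces descend to $A^\omega$), and $A^\omega\cap A'$ the relative commutant of the image of $A$. A separable C*-algebra $A$ with tracial state space $\mathrm{T}(A)$ nonempty and compact has uniform property $\Gamma$ if for all $n\in\mathbb{N}$ there exist projections $p_1,\dots,p_n\in A^\omega\cap A'$ summing to $1$ with $\tau(ap_i)=\frac1n\tau(a)$ for all $a\in A$, $\tau\in\mathrm{T}_\omega(A)$, $i=1,\dots,n$. Cuntz subequivalence: for positive $a,b$ in a C*-algebra $D$, $a\precsim_D b$ means there is a sequence $(r_n)$ in $D$ with $\|r_n^*br_n-a\|\to0$. Tracial Rokhlin property with comparison: Let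 $G$ act on $C(G)$ by left translation, $(\mathrm{Lt}_g f)(h)=f(g^{-1}h)$. An action $\alpha$ of a second-countable compact group $G$ on a unital simple infinite dimensional C*-algebra $A$ has the tracial Rokhlin property with comparison if for every $\varepsilon>0$, every finite $F\subseteq A$, every finite $S\subseteq C(G)$, every positive $x\in A$ with $\|x\|=1$ and every nonzero positive $y\in A^\alpha$, there exist a projection $p\in A^\alpha$ and a unital completely positive map $\psi\colon C(G)\to pAp$ such that: (i) $\|\psi(f_1f_2)-\psi(f_1)\psi(f_2)\|<\varepsilon$ for all $f_1,f_2\in S$, $\|\psi(f)a-a\psi(f)\|<\varepsilon$ for all $f\in S$, $a\in F$, and $\sup_{g\in G}\|\psi(\mathrm{Lt}_g f)-\alpha_g(\psi(f))\|<\varepsilon$ for all $f\in S$; (ii) $1-p\precsim_A x$; (iii) $1-p\precsim_{A^\alpha} y$; (iv) $1-p\precsim_{A^\alpha} p$; (v) $\|pxp\|>1-\varepsilon$. *)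

theory Defs
  imports "HOL-Analysis.Analysis"
begin

text \<open>A unital C*-algebra is modelled as a type 'a of class real_normed_algebra_1 and banach
  (a real unital Banach algebra with norm 1 = 1), together with a complex scalar
  multiplication sc extending the real one and an involution st satisfying the C*-identity.
  The whole type is the algebra A.\<close>

definition cstar_alg :: "(complex \<Rightarrow> 'a::{real_normed_algebra_1,banach} \<Rightarrow> 'a) \<Rightarrow> ('a \<Rightarrow> 'a) \<Rightarrow> bool" where
  "cstar_alg sc st \<longleftrightarrow>
     (\<forall>r x. sc (complex_of_real r) x = r *\<^sub>R x) \<and>
     (\<forall>c x y. sc c (x + y) = sc c x + sc c y) \<and>
     (\<forall>c d x. sc (c + d) x = sc c x + sc d x) \<and>
     (\<forall>c d x. sc (c * d) x = sc c (sc d x)) \<and>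
     (\<forall>c x y. sc c (x * y) = sc c x * y \<and> sc c (x * y) = x * sc c y) \<and>
     (\<forall>c x. norm (sc c x) = cmod c * norm x) \<and>
     (\<forall>x y. st (x + y) = st x + st y) \<and>
     (\<forall>c x. st (sc c x) = sc (cnj c) (st x)) \<and>
     (\<forall>x y. st (x * y) = st y * st x) \<and>
     (\<forall>x. st (st x) = x) \<and>
     (\<forall>x. norm (st x * x) = (norm x)\<^sup>2)"

definition positive_in :: "('a::ring \<Rightarrow> 'a) \<Rightarrow> 'a set \<Rightarrow> 'a \<Rightarrow> bool" where
  "positive_in st D a \<longleftrightarrow> (\<exists>b\<in>D. a = st b * b)"

definition projection_in :: "('a::ring \<Rightarrow> 'a) \<Rightarrow> 'a set \<Rightarrow> 'a \<Rightarrow> bool" where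
  "projection_in st D p \<longleftrightarrow> p \<in> D \<and> st p = p \<and> p * p = p"

definition cuntz_below :: "('a::real_normed_algebra \<Rightarrow> 'a) \<Rightarrow> 'a set \<Rightarrow> 'a \<Rightarrow> 'a \<Rightarrow> bool" where
  "cuntz_below st D a b \<longleftrightarrow>
     (\<exists>r::nat \<Rightarrow> 'a. (\<forall>n. r n \<in> D) \<and> (\<lambda>n. norm (st (r n) * b * r n - a)) \<longlonglongrightarrow> 0)"

definition separable_alg :: "'a::topological_space set \<Rightarrow> bool" where
  "separable_alg B \<longleftrightarrow> (\<exists>D. countable D \<and> D \<subseteq> B \<and> B \<subseteq> closure D)"

definition closed_ideal :: "(complex \<Rightarrow> 'a::real_normed_algebra \<Rightarrow> 'a) \<Rightarrow> 'a set \<Rightarrow> bool" where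
  "closed_ideal sc I \<longleftrightarrow> 0 \<in> I \<and> closed I \<and>
     (\<forall>x\<in>I. \<forall>y\<in>I. x + y \<in> I) \<and> (\<forall>c. \<forall>x\<in>I. sc c x \<in> I) \<and>
     (\<forall>x\<in>I. \<forall>a. a * x \<in> I \<and> x * a \<in> I)"

definition simple_alg :: "(complex \<Rightarrow> 'a::real_normed_algebra \<Rightarrow> 'a) \<Rightarrow> bool" where
  "simple_alg sc \<longleftrightarrow> (\<forall>I. closed_ideal sc I \<longrightarrow> I = {0} \<or> I = UNIV)"

definition infinite_dim :: "(complex \<Rightarrow> 'a::real_normed_algebra \<Rightarrow> 'a) \<Rightarrow> bool" where
  "infinite_dim sc \<longleftrightarrow> \<not> (\<exists>F. finite F \<and> (\<forall>x. \<exists>c. x = (\<Sum>f\<in>F. sc (c f) f)))"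

text \<open>Tracial states on a unital C*-subalgebra B (only their values on B matter).\<close>
definition tracial_states ::
  "(complex \<Rightarrow> 'a::real_normed_algebra_1 \<Rightarrow> 'a) \<Rightarrow> ('a \<Rightarrow> 'a) \<Rightarrow> 'a set \<Rightarrow> ('a \<Rightarrow> complex) set" where
  "tracial_states sc st B = {\<tau>.
     (\<forall>x\<in>B. \<forall>y\<in>B. \<tau> (x + y) = \<tau> x + \<tau> y) \<and>
     (\<forall>c. \<forall>x\<in>B. \<tau> (sc c x) = c * \<tau> x) \<and>
     (\<forall>x\<in>B. Im (\<tau> (st x * x)) = 0 \<and> Re (\<tau> (st x * x)) \<ge> 0) \<and>
     \<tau> 1 = 1 \<and>
     (\<forall>x\<in>B. \<forall>y\<in>B. \<tau> (x * y) = \<tau> (y * x))}"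

text \<open>T(B) as a subset of the space of functionals on B with the weak* (pointwise) topology,
  i.e. the product topology on functions, after restricting to B.\<close>
definition trace_space ::
  "(complex \<Rightarrow> 'a::real_normed_algebra_1 \<Rightarrow> 'a) \<Rightarrow> ('a \<Rightarrow> 'a) \<Rightarrow> 'a set \<Rightarrow> ('a \<Rightarrow> complex) set" where
  "trace_space sc st B = (\<lambda>\<tau> x. if x \<in> B then \<tau> x else 0) ` tracial_states sc st B"

definition free_ultrafilter :: "nat filter \<Rightarrow> bool" where
  "free_ultrafilter \<omega> \<longleftrightarrow> \<omega> \<noteq> bot \<and> (\<forall>P. eventually P \<omega> \<or> eventually (\<lambda>n. \<not> P n) \<omega>) \<and> \<omega> \<le> cofinite"

text \<open>Representatives of elements of B_\<omega>: bounded sequences in B.\<close>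
definition bseq_in :: "'a::real_normed_vector set \<Rightarrow> (nat \<Rightarrow> 'a) \<Rightarrow> bool" where
  "bseq_in B x \<longleftrightarrow> (\<forall>n. x n \<in> B) \<and> bounded (range x)"

definition lim_trace :: "nat filter \<Rightarrow> (nat \<Rightarrow> 'a \<Rightarrow> complex) \<Rightarrow> (nat \<Rightarrow> 'a) \<Rightarrow> complex" where
  "lim_trace \<omega> \<tau>s x = Lim \<omega> (\<lambda>n. \<tau>s n (x n))"

definition trace_kernel ::
  "nat filter \<Rightarrow> (complex \<Rightarrow> 'a::{real_normed_algebra_1} \<Rightarrow> 'a) \<Rightarrow> ('a \<Rightarrow> 'a) \<Rightarrow> 'a set \<Rightarrow> (nat \<Rightarrow> 'a) set" where
  "trace_kernel \<omega> sc st B = {x. bseq_in B x \<and>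
     (\<forall>\<tau>s. (\<forall>n. \<tau>s n \<in> tracial_states sc st B) \<longrightarrow> lim_trace \<omega> \<tau>s (\<lambda>n. st (x n) * x n) = 0)}"

text \<open>Equality of the images of two representatives in B^\<omega> = B_\<omega>/J_B.\<close>
definition eq_tu :: "nat filter \<Rightarrow> (complex \<Rightarrow> 'a::{real_normed_algebra_1} \<Rightarrow> 'a) \<Rightarrow> ('a \<Rightarrow> 'a) \<Rightarrow> 'a set
    \<Rightarrow> (nat \<Rightarrow> 'a) \<Rightarrow> (nat \<Rightarrow> 'a) \<Rightarrow> bool" where
  "eq_tu \<omega> sc st B x y \<longleftrightarrow> (\<lambda>n. x n - y n) \<in> trace_kernel \<omega> sc st B"

text \<open>Uniform property Gamma for a unital C*-(sub)algebra B, relative to the ultrafilter \<omega>.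
  Projections p_0..p_{m-1} in B^\<omega> \<inter> B' are given by representatives p i in B_\<omega>.\<close>
definition uniform_gamma ::
  "nat filter \<Rightarrow> (complex \<Rightarrow> 'a::{real_normed_algebra_1} \<Rightarrow> 'a) \<Rightarrow> ('a \<Rightarrow> 'a) \<Rightarrow> 'a set \<Rightarrow> bool" where
  "uniform_gamma \<omega> sc st B \<longleftrightarrow>
     trace_space sc st B \<noteq> {} \<and> compact (trace_space sc st B) \<and>
     (\<forall>m::nat. m \<ge> 1 \<longrightarrow> (\<exists>p :: nat \<Rightarrow> nat \<Rightarrow> 'a.
        (\<forall>i<m. bseq_in B (p i)) \<and>
        (\<forall>i<m. eq_tu \<omega> sc st B (\<lambda>k. st (p i k)) (p i)) \<and>
        (\<forall>i<m. eq_tu \<omega> sc st B (\<lambda>k. p i k * p i k) (p i)) \<and>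
        (\<forall>i<m. \<forall>a\<in>B. eq_tu \<omega> sc st B (\<lambda>k. p i k * a) (\<lambda>k. a * p i k)) \<and>
        eq_tu \<omega> sc st B (\<lambda>k. \<Sum>i<m. p i k) (\<lambda>k. 1) \<and>
        (\<forall>i<m. \<forall>a\<in>B. \<forall>\<tau>s. (\<forall>n. \<tau>s n \<in> tracial_states sc st B) \<longrightarrow>
            lim_trace \<omega> \<tau>s (\<lambda>k. a * p i k) = lim_trace \<omega> \<tau>s (\<lambda>k. a) / of_nat m)))"

definition top_group :: "('g::topological_space \<Rightarrow> 'g \<Rightarrow> 'g) \<Rightarrow> ('g \<Rightarrow> 'g) \<Rightarrow> 'g \<Rightarrow> bool" where
  "top_group mul iv e \<longleftrightarrow>
     (\<forall>x y z. mul (mul x y) z = mul x (mul y z)) \<and>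
     (\<forall>x. mul e x = x \<and> mul x e = x) \<and>
     (\<forall>x. mul (iv x) x = e \<and> mul x (iv x) = e) \<and>
     continuous_on UNIV (\<lambda>(x, y). mul x y) \<and> continuous_on UNIV iv"

definition fixed_points :: "('g \<Rightarrow> 'a \<Rightarrow> 'a) \<Rightarrow> 'a set" where
  "fixed_points \<alpha> = {a. \<forall>g. \<alpha> g a = a}"

definition cstar_action ::
  "(complex \<Rightarrow> 'a::{real_normed_algebra_1} \<Rightarrow> 'a) \<Rightarrow> ('a \<Rightarrow> 'a) \<Rightarrow>
   ('g::topological_space \<Rightarrow> 'g \<Rightarrow> 'g) \<Rightarrow> 'g \<Rightarrow> ('g \<Rightarrow> 'a \<Rightarrow> 'a) \<Rightarrow> bool" where
  "cstar_action sc st mul e \<alpha> \<longleftrightarrow>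
     (\<forall>g. bij (\<alpha> g) \<and> (\<forall>x y. \<alpha> g (x + y) = \<alpha> g x + \<alpha> g y \<and> \<alpha> g (x * y) = \<alpha> g x * \<alpha> g y) \<and>
          (\<forall>c x. \<alpha> g (sc c x) = sc c (\<alpha> g x)) \<and> (\<forall>x. \<alpha> g (st x) = st (\<alpha> g x)) \<and> \<alpha> g 1 = 1) \<and>
     \<alpha> e = id \<and> (\<forall>g h. \<alpha> (mul g h) = \<alpha> g \<circ> \<alpha> h) \<and>
     (\<forall>a. continuous_on UNIV (\<lambda>g. \<alpha> g a))"

definition CG :: "('g::topological_space \<Rightarrow> complex) set" where
  "CG = {f. continuous_on UNIV f}"

definition Lt :: "('g \<Rightarrow> 'g \<Rightarrow> 'g) \<Rightarrow> ('g \<Rightarrow> 'g) \<Rightarrow> 'g \<Rightarrow> ('g \<Rightarrow> complex) \<Rightarrow> 'g \<Rightarrow> complex" where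
  "Lt mul iv g f = (\<lambda>h. f (mul (iv g) h))"

definition CG_matpos :: "nat \<Rightarrow> (nat \<Rightarrow> nat \<Rightarrow> 'g::topological_space \<Rightarrow> complex) \<Rightarrow> bool" where
  "CG_matpos n M \<longleftrightarrow> (\<exists>B. (\<forall>k i. B k i \<in> CG) \<and>
      (\<forall>i<n. \<forall>j<n. M i j = (\<lambda>g. \<Sum>k<n. cnj (B k i g) * B k j g)))"

definition A_matpos :: "('a::ring \<Rightarrow> 'a) \<Rightarrow> nat \<Rightarrow> (nat \<Rightarrow> nat \<Rightarrow> 'a) \<Rightarrow> bool" where
  "A_matpos st n M \<longleftrightarrow> (\<exists>B. \<forall>i<n. \<forall>j<n. M i j = (\<Sum>k<n. st (B k i) * B k j))"

definition ucp_corner ::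
  "(complex \<Rightarrow> 'a::{real_normed_algebra_1} \<Rightarrow> 'a) \<Rightarrow> ('a \<Rightarrow> 'a) \<Rightarrow> 'a \<Rightarrow> (('g::topological_space \<Rightarrow> complex) \<Rightarrow> 'a) \<Rightarrow> bool" where
  "ucp_corner sc st p \<psi> \<longleftrightarrow>
     (\<forall>f\<in>CG. \<psi> f \<in> {p * a * p | a. True}) \<and>
     \<psi> (\<lambda>_. 1) = p \<and>
     (\<forall>f\<in>CG. \<forall>h\<in>CG. \<psi> (\<lambda>g. f g + h g) = \<psi> f + \<psi> h) \<and>
     (\<forall>c. \<forall>f\<in>CG. \<psi> (\<lambda>g. c * f g) = sc c (\<psi> f)) \<and>
     (\<forall>n M. (\<forall>i j. M i j \<in> CG) \<longrightarrow> CG_matpos n M \<longrightarrow> A_matpos st n (\<lambda>i j. \<psi> (M i j)))"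

definition tracial_rokhlin_comparison ::
  "(complex \<Rightarrow> 'a::{real_normed_algebra_1} \<Rightarrow> 'a) \<Rightarrow> ('a \<Rightarrow> 'a) \<Rightarrow>
   ('g::topological_space \<Rightarrow> 'g \<Rightarrow> 'g) \<Rightarrow> ('g \<Rightarrow> 'g) \<Rightarrow> ('g \<Rightarrow> 'a \<Rightarrow> 'a) \<Rightarrow> bool" where
  "tracial_rokhlin_comparison sc st mul iv \<alpha> \<longleftrightarrow>
     (\<forall>\<epsilon>>0. \<forall>F S x y. finite F \<longrightarrow> finite S \<longrightarrow> S \<subseteq> CG \<longrightarrow>
        positive_in st UNIV x \<longrightarrow> norm x = 1 \<longrightarrow>
        positive_in st (fixed_points \<alpha>) y \<longrightarrow> y \<noteq> 0 \<longrightarrow>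
        (\<exists>p \<psi>. projection_in st (fixed_points \<alpha>) p \<and> ucp_corner sc st p \<psi> \<and>
           (\<forall>f1\<in>S. \<forall>f2\<in>S. norm (\<psi> (\<lambda>g. f1 g * f2 g) - \<psi> f1 * \<psi> f2) < \<epsilon>) \<and>
           (\<forall>f\<in>S. \<forall>a\<in>F. norm (\<psi> f * a - a * \<psi> f) < \<epsilon>) \<and>
           (\<forall>f\<in>S. \<exists>\<delta><\<epsilon>. \<forall>g. norm (\<psi> (Lt mul iv g f) - \<alpha> g (\<psi> f)) \<le> \<delta>) \<and>
           cuntz_below st UNIV (1 - p) x \<and>
           cuntz_below st (fixed_points \<alpha>) (1 - p) y \<and>
           cuntz_below st (fixed_points \<alpha>) (1 - p) p \<and>
           norm (p * x * p) > 1 - \<epsilon>))"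

end

theory Submission
  imports Defs
begin

text \<open>The tracial Rokhlin property yields approximate homomorphisms \<open>\<phi>\<close> from \<open>A\<close> to \<open>p A\<^sup>\<alpha> p\<close> with
  \<open>\<phi>(a) \<approx> a p\<close> for \<open>a\<close> in \<open>A\<^sup>\<alpha>\<close>: for \<open>u\<^sub>i\<^sup>2\<close> a fine partition of unity on \<open>G\<close> and
  \<open>x\<^sub>i = \<psi>(u\<^sub>i)\<close>, the sum \<open>\<Sum>x\<^sub>i \<alpha>\<^sub>i(a) x\<^sub>i\<close> is almost multiplicative and almost invariant, hence close to a
  fixed point. If \<open>\<sigma>\<close> is a trace on \<open>A\<^sup>\<alpha>\<close>, then \<open>\<sigma> \<circ> \<phi> / \<sigma>(p)\<close> is almost a trace on \<open>A\<close>, so by compactness every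
  trace estimate that holds uniformly on \<open>A\<close> passes through \<open>\<phi>\<close> to one uniform on \<open>A\<^sup>\<alpha>\<close>. Applied to
  the projections of property \<open>\<Gamma>\<close> for \<open>A\<close> this gives the required elements of \<open>A\<^sup>\<alpha>\<close>, up to the
  defect \<open>1 - p\<close>. Comparison makes \<open>\<sigma>(1 - p)\<close> small once \<open>A\<^sup>\<alpha>\<close> contains a nonzero positive element
  supported on a set of small trace, and pushing one projection of trace \<open>1 / m\<close> forward by a first \<open>\<phi>\<close>,
  for which comparison only provides \<open>\<sigma>(p) \<ge> 1 / 2\<close>, produces such an element.\<close>

section \<open>Positivity in unital C*-algebras\<close>

text \<open>Composing a trace of the fixed point algebra with averaging over \<open>G\<close> gives
  a state on \<open>A\<close> that need not be tracial, so trace estimates on \<open>A\<close>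
  cannot simply be restricted. The pull-backs \<sigma>(\<phi>(x)) / \<sigma>(p) become tracial in
  the limit because \<phi> becomes multiplicative. The division requires a lower bound for all
  \<sigma> at once, and \<open>1 - p\<close> below \<open>p\<close> supplies 1/2. This breaks a
  circle: making \<sigma>(1 - p) small requires a nonzero positive \<open>y\<close> that is small
  under every \<sigma>, while controlling every \<sigma> requires a \<phi> with \<sigma>(p) bounded
  below. Commutation with the fixed point algebra survives since \<phi>(a) is close to
  \<open>a p\<close> for fixed \<open>a\<close>: hence \<phi>(q) a and a \<phi>(q) are close to
  \<phi>(q a) and \<phi>(a q). The order structure is derived from the norm alone, with square roots
  obtained by iteration. That \<open>st b * b\<close> is positive comes from a faithful trace:
  property \<Gamma> provides a trace, and simplicity makes it faithful.\<close>

locale cstar_algebra =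
  fixes sc :: "complex \<Rightarrow> 'a::{real_normed_algebra_1,banach} \<Rightarrow> 'a" and st :: "'a \<Rightarrow> 'a"
  assumes cstar: "cstar_alg sc st"
begin

abbreviation "traces B \<equiv> tracial_states sc st B"

lemma sc_of_real: "sc (complex_of_real r) x = r *\<^sub>R x"
  and sc_add_right: "sc c (x + y) = sc c x + sc c y"
  and sc_add_left: "sc (c + d) x = sc c x + sc d x"
  and sc_sc: "sc c (sc d x) = sc (c * d) x"
  and sc_mult_left: "sc c x * y = sc c (x * y)"
  and sc_mult_right: "x * sc c y = sc c (x * y)"
  and norm_sc: "norm (sc c x) = cmod c * norm x"
  and st_add: "st (x + y) = st x + st y"
  and st_sc: "st (sc c x) = sc (cnj c) (st x)"
  and st_mult: "st (x * y) = st y * st x"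
  and st_st [simp]: "st (st x) = x"
  and norm_st_mult: "norm (st x * x) = (norm x)\<^sup>2"
  using cstar unfolding cstar_alg_def by metis+

lemma sc_one [simp]: "sc 1 x = x"
  using sc_of_real[of 1 x] by simp

lemma sc_zero_left [simp]: "sc 0 x = 0"
  using sc_of_real[of 0 x] by simp

lemma sc_zero_right [simp]: "sc c 0 = 0"
  using sc_add_right[of c 0 0] by simp

lemma sc_minus_one: "sc (- 1) x = - x"
  using sc_of_real[of "-1" x] by simp

lemma sc_minus_right: "sc c (- x) = - sc c x"
  using sc_add_right[of c x "- x"] by (simp add: eq_neg_iff_add_eq_0 add.commute)

lemma sc_diff_right: "sc c (x - y) = sc c x - sc c y"
  using sc_add_right[of c x "- y"] sc_minus_right by simp

lemma st_zero [simp]: "st 0 = 0"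
  using st_add[of 0 0] by simp

lemma st_minus: "st (- x) = - st x"
  using st_add[of x "- x"] by (simp add: eq_neg_iff_add_eq_0 add.commute)

lemma st_diff: "st (x - y) = st x - st y"
  using st_add[of x "- y"] st_minus by simp

lemma st_scaleR: "st (r *\<^sub>R x) = r *\<^sub>R st x"
  using st_sc[of "complex_of_real r" x] by (simp add: sc_of_real)

lemma st_one [simp]: "st 1 = 1"
  by (metis mult.left_neutral mult.right_neutral st_mult st_st)

lemma st_sum: "st (\<Sum>i\<in>I. f i) = (\<Sum>i\<in>I. st (f i))"
  by (induction I rule: infinite_finite_induct) (auto simp: st_add)

lemma norm_st [simp]: "norm (st x) = norm x"
proof -
  have *: "norm y \<le> norm (st y)" for y
  proof (cases "norm y = 0")
    case False
    have "(norm y)\<^sup>2 \<le> norm (st y) * norm y"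
      using norm_st_mult[of y] norm_mult_ineq[of "st y" y] by simp
    with False show ?thesis by (simp add: power2_eq_square)
  qed simp
  show ?thesis using *[of x] *[of "st x"] by simp
qed

lemma bounded_linear_st: "bounded_linear st"
  by (rule bounded_linear_intro[where K = 1]) (auto simp: st_add st_scaleR)

lemma norm_sa_square: "st h = h \<Longrightarrow> norm (h * h) = (norm h)\<^sup>2"
  using norm_st_mult[of h] by simp

text \<open>The cases of interest are \<open>UNIV\<close> and the fixed point algebra, so that each
  positivity and trace lemma serves both. Closedness keeps square roots, which are limits of
  polynomials, inside \<open>B\<close>.\<close>

definition csub :: "'a set \<Rightarrow> bool" where
  "csub B \<longleftrightarrow> 1 \<in> B \<and> (\<forall>x\<in>B. \<forall>y\<in>B. x + y \<in> B \<and> x * y \<in> B) \<and> (\<forall>c. \<forall>x\<in>B. sc c x \<in> B)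
     \<and> (\<forall>x\<in>B. st x \<in> B) \<and> closed B"

lemma csub_UNIV: "csub UNIV"
  by (simp add: csub_def)

context
  fixes B assumes B: "csub B"
begin

lemma csub_one: "1 \<in> B"
  and csub_add: "x \<in> B \<Longrightarrow> y \<in> B \<Longrightarrow> x + y \<in> B"
  and csub_mult: "x \<in> B \<Longrightarrow> y \<in> B \<Longrightarrow> x * y \<in> B"
  and csub_sc: "x \<in> B \<Longrightarrow> sc c x \<in> B"
  and csub_st: "x \<in> B \<Longrightarrow> st x \<in> B"
  and csub_closed: "closed B"
  using B by (auto simp: csub_def)

lemma csub_scaleR: "x \<in> B \<Longrightarrow> r *\<^sub>R x \<in> B"
  using csub_sc[of x "complex_of_real r"] by (simp add: sc_of_real)

lemma csub_minus: "x \<in> B \<Longrightarrow> - x \<in> B"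
  using csub_scaleR[of x "-1"] by simp

lemma csub_diff: "x \<in> B \<Longrightarrow> y \<in> B \<Longrightarrow> x - y \<in> B"
  using csub_add[of x "- y"] csub_minus by simp

lemma csub_zero: "0 \<in> B"
  using csub_diff[OF csub_one csub_one] by simp

lemma csub_sum: "(\<And>i. i \<in> I \<Longrightarrow> f i \<in> B) \<Longrightarrow> (\<Sum>i\<in>I. f i) \<in> B"
  by (induction I rule: infinite_finite_induct) (auto intro: csub_zero csub_add)

lemmas csub_intros = csub_one csub_zero csub_add csub_diff csub_minus csub_mult csub_sc csub_scaleR
  csub_st csub_sum

text \<open>The iteration \<open>y \<mapsto> (h + y\<^sup>2) / 2\<close> is dominated in norm by the scalar iteration
  \<open>t \<mapsto> (1 + t\<^sup>2) / 2\<close>, which increases to 1; so it converges even when \<open>norm h = 1\<close>.\<close>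

lemma sqrt_one_minus:
  assumes h: "h \<in> B" "st h = h" "norm h \<le> 1"
  obtains y where "y \<in> B" "st y = y" "norm y \<le> 1" "(1 - y) * (1 - y) = 1 - h"
    "\<And>z. z * h = h * z \<Longrightarrow> z * y = y * z"
proof -
  define Y where "Y n = ((\<lambda>y. (1/2) *\<^sub>R (h + y * y)) ^^ n) 0" for n
  define t where "t n = ((\<lambda>s::real. (1 + s * s) / 2) ^^ n) 0" for n
  have Y0: "Y 0 = 0" and YS: "Y (Suc n) = (1/2) *\<^sub>R (h + Y n * Y n)" for n
    by (simp_all add: Y_def)
  have t0: "t 0 = 0" and tS: "t (Suc n) = (1 + t n * t n) / 2" for n
    by (simp_all add: t_def)
  have t_bd: "0 \<le> t n \<and> t n \<le> 1" for n
  proof (induction n)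
    case (Suc n)
    then have "t n * t n \<le> 1" by (simp add: mult_le_one)
    then show ?case using Suc by (simp add: tS)
  qed (simp add: t0)
  have t_mono: "t n \<le> t (Suc n)" for n
    using zero_le_square[of "t n - 1"] by (simp add: tS algebra_simps)
  have Y_le: "norm (Y n) \<le> t n" for n
  proof (induction n)
    case (Suc n)
    have "norm (h + Y n * Y n) \<le> 1 + t n * t n"
      by (intro norm_triangle_le add_mono h(3) order_trans[OF norm_mult_ineq] mult_mono Suc)
        (use t_bd[of n] in auto)
    then show ?case by (simp add: YS tS)
  qed (simp add: Y0 t0)
  have step: "norm (Y (Suc n) - Y n) \<le> t (Suc n) - t n" for n
  proof (induction n)
    case 0
    then show ?case using h(3) by (simp add: Y0 YS t0 tS)
  next
    case (Suc n)
    have "Y (Suc (Suc n)) - Y (Suc n)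
        = (1/2) *\<^sub>R ((Y (Suc n) - Y n) * Y (Suc n) + Y n * (Y (Suc n) - Y n))"
      by (simp add: YS[of "Suc n"] YS[of n] algebra_simps)
    also have "norm \<dots> \<le> (1/2) * ((t (Suc n) - t n) * t (Suc n) + t n * (t (Suc n) - t n))"
      unfolding norm_scaleR abs_of_pos[of "1/2::real", simplified]
      by (intro mult_left_mono norm_triangle_le add_mono order_trans[OF norm_mult_ineq] mult_mono Suc Y_le)
        (use t_bd t_mono in auto)
    also have "\<dots> = t (Suc (Suc n)) - t (Suc n)"
      by (simp add: tS[of "Suc n"] tS[of n] field_simps)
    finally show ?case .
  qed
  have diff: "norm (Y (m + k) - Y m) \<le> t (m + k) - t m" for m k
  proof (induction k)
    case (Suc k)
    have "Y (m + Suc k) - Y m = (Y (Suc (m + k)) - Y (m + k)) + (Y (m + k) - Y m)" by simp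
    then show ?case using norm_triangle_le[OF add_mono[OF step[of "m+k"] Suc]]
      by simp
  qed simp
  have "incseq t" using t_mono by (simp add: incseq_SucI)
  then have "convergent t"
    using t_bd by (intro Bseq_mono_convergent BseqI'[where K = 1]) (auto simp: incseq_def)
  then have Ct: "Cauchy t" by (rule convergent_Cauchy)
  have "Cauchy Y"
  proof (rule CauchyI')
    fix e :: real assume "e > 0"
    then obtain M where M: "\<And>m n. m \<ge> M \<Longrightarrow> n \<ge> M \<Longrightarrow> norm (t m - t n) < e"
      using CauchyD[OF Ct] by blast
    show "\<exists>M. \<forall>m\<ge>M. \<forall>n>m. dist (Y m) (Y n) < e"
    proof (intro exI allI impI)
      fix m n assume "M \<le> m" "m < n"
      then have "norm (Y n - Y m) \<le> t n - t m" using diff[of m "n - m"] by simp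
      also have "\<dots> < e" using M[of n m] \<open>M \<le> m\<close> \<open>m < n\<close> by simp
      finally show "dist (Y m) (Y n) < e" by (simp add: dist_norm norm_minus_commute)
    qed
  qed
  then obtain y where lim: "Y \<longlonglongrightarrow> y" using Cauchy_convergent convergent_def by blast
  have "Y n \<in> B \<and> st (Y n) = Y n" for n
    by (induction n) (auto simp: Y0 YS st_add st_mult st_scaleR h intro!: csub_intros)
  then have "y \<in> B" "st y = y"
    using closed_sequentially[OF csub_closed _ lim]
      LIMSEQ_unique[OF bounded_linear.tendsto[OF bounded_linear_st lim]] lim by auto
  moreover have "norm y \<le> 1"
    by (rule Lim_bounded[OF tendsto_norm[OF lim], of 0]) (use Y_le t_bd order_trans in blast)
  moreover have "(1 - y) * (1 - y) = 1 - h"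
  proof -
    have "(\<lambda>n. Y (Suc n)) \<longlonglongrightarrow> (1/2) *\<^sub>R (h + y * y)"
      unfolding YS by (intro tendsto_intros lim)
    then have "y = (1/2) *\<^sub>R (h + y * y)"
      using LIMSEQ_unique LIMSEQ_Suc[OF lim] by blast
    then have "2 *\<^sub>R y = h + y * y" by (metis scaleR_half_double scaleR_2 scaleR_right_distrib)
    then show ?thesis by (simp add: algebra_simps scaleR_2)
  qed
  moreover have "z * y = y * z" if "z * h = h * z" for z
  proof -
    have comm: "z * Y n = Y n * z" for n
    proof (induction n)
      case (Suc n)
      have "z * (Y n * Y n) = (Y n * Y n) * z" by (metis Suc mult.assoc)
      then show ?case by (simp add: YS algebra_simps that)
    qed (simp add: Y0)
    have "(\<lambda>n. z * Y n) \<longlonglongrightarrow> z * y" "(\<lambda>n. Y n * z) \<longlonglongrightarrow> y * z" by (intro tendsto_intros lim)+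
    then show ?thesis using LIMSEQ_unique unfolding comm by blast
  qed
  ultimately show ?thesis using that by blast
qed

end

text \<open>Squares of self-adjoint elements instead of elements \<open>st b * b\<close>: this form
  is accessible from the norm, and agreement of the two notions is only reached in
  \<open>pos_st_mult\<close>.\<close>

definition pos :: "'a \<Rightarrow> bool" where
  "pos a \<longleftrightarrow> (\<exists>u. st u = u \<and> a = u * u)"

text \<open>The norm hypothesis is positivity without a spectrum: after scaling, \<open>a\<close> is
  \<open>1 - h\<close> with \<open>h\<close> a self-adjoint contraction. The last conclusion is the
  same condition for \<open>u\<close>, with radius \<open>2 * sqrt r\<close>, so the root is itself
  positive. The commutation clause replaces functional calculus.\<close>

lemma sqrt_in:
  assumes B: "csub B" and a: "a \<in> B" "st a = a" "norm (r *\<^sub>R 1 - a) \<le> r"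
  obtains u where "u \<in> B" "st u = u" "u * u = a" "norm (u * u) \<le> 2 * r"
    "\<And>z. z * a = a * z \<Longrightarrow> z * u = u * z"
    "norm ((2 * sqrt r) *\<^sub>R 1 - u) \<le> 2 * sqrt r"
proof (cases "r = 0")
  case True
  with a show ?thesis by (intro that[of 0]) (auto intro: csub_intros[OF B])
next
  case False
  then have r: "r > 0" using order_trans[OF norm_ge_zero a(3)] by simp
  define h where "h = 1 - (1/r) *\<^sub>R a"
  have "h = (1/r) *\<^sub>R (r *\<^sub>R 1 - a)" using r by (simp add: h_def algebra_simps)
  then have "norm h = (1/r) * norm (r *\<^sub>R 1 - a)" using r by simp
  then have n: "norm h \<le> 1" using a(3) r by (simp add: divide_le_eq_1)
  have "h \<in> B" "st h = h" using a by (auto simp: h_def st_diff st_scaleR intro!: csub_intros[OF B])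
  then obtain y where y: "y \<in> B" "st y = y" "norm y \<le> 1" "(1 - y) * (1 - y) = 1 - h"
    "\<And>z. z * h = h * z \<Longrightarrow> z * y = y * z" using sqrt_one_minus[OF B _ _ n] by blast
  define u where "u = sqrt r *\<^sub>R (1 - y)"
  show ?thesis
  proof (rule that[of u])
    show "u \<in> B" "st u = u" using y by (auto simp: u_def st_diff st_scaleR intro!: csub_intros[OF B])
    show uu: "u * u = a" using y(4) r by (simp add: u_def h_def)
    show "norm (u * u) \<le> 2 * r"
      unfolding uu using norm_triangle_ineq2[of a "r *\<^sub>R 1"] a(3) r by (simp add: norm_minus_commute)
    show "z * u = u * z" if "z * a = a * z" for z
      using y(5)[of z] that by (simp add: u_def h_def algebra_simps)
    have "(2 * sqrt r) *\<^sub>R 1 = sqrt r *\<^sub>R 1 + sqrt r *\<^sub>R (1::'a)" by (simp flip: scaleR_left.add)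
    then have "(2 * sqrt r) *\<^sub>R 1 - u = sqrt r *\<^sub>R (1 + y)" by (simp add: u_def algebra_simps)
    then have "norm ((2 * sqrt r) *\<^sub>R 1 - u) = sqrt r * norm (1 + y)" using r by simp
    also have "\<dots> \<le> sqrt r * 2"
      using norm_triangle_ineq[of 1 y] y(3) r by (intro mult_left_mono) auto
    finally show "norm ((2 * sqrt r) *\<^sub>R 1 - u) \<le> 2 * sqrt r" by simp
  qed
qed


lemma posI: "st a = a \<Longrightarrow> norm (r *\<^sub>R 1 - a) \<le> r \<Longrightarrow> pos a"
  unfolding pos_def by (metis sqrt_in[OF csub_UNIV] UNIV_I)

lemma pos_square: "st u = u \<Longrightarrow> pos (u * u)"
  unfolding pos_def by blast

text \<open>The element \<open>z = u + sc \<i> v\<close> is normal with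
  \<open>st z * z = r *\<^sub>R 1\<close>, so its norm is \<open>sqrt r\<close>, and
  \<open>u\<close> is its real part.\<close>

lemma norm_le_of_square_sum:
  assumes "st u = u" "st v = v" "u * v = v * u" "u * u + v * v = r *\<^sub>R 1" "r \<ge> 0"
  shows "norm u \<le> sqrt r"
proof -
  define z where "z = u + sc \<i> v"
  have "st z * z = u * u + v * v"
    by (simp add: z_def st_add st_sc assms(1-3) algebra_simps sc_mult_left sc_mult_right sc_add_right sc_sc)
       (simp flip: sc_add_left add: assms(3) add.assoc[symmetric])
  then have "(norm z)\<^sup>2 = r" using norm_st_mult[of z] assms(4,5) by simp
  then have nz: "norm z = sqrt r" by (metis norm_ge_zero real_sqrt_unique)
  have "sc (-\<i>) v + sc \<i> v = 0" by (simp flip: sc_add_left)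
  then have "2 *\<^sub>R u = z + st z"
    by (simp add: z_def st_add st_sc assms algebra_simps scaleR_2)
  then have "2 * norm u = norm (z + st z)"
    by (metis norm_scaleR abs_numeral)
  then show ?thesis using norm_triangle_ineq[of z "st z"] nz by simp
qed

text \<open>If \<open>1 - y\<close> is a square root of \<open>1 - h * h\<close> commuting with
  \<open>h\<close>, the squares of \<open>h\<close> and \<open>1 - y\<close> add up to 1, which
  bounds the norm of \<open>1 - y\<close> by 1.\<close>

lemma norm_one_minus_square:
  assumes "st h = h" "norm h \<le> 1"
  shows "norm (1 - h * h) \<le> 1"
proof -
  have "norm (h * h) \<le> 1" using assms by (simp add: norm_sa_square power_le_one)
  then obtain y where y: "st y = y" "(1 - y) * (1 - y) = 1 - h * h" "\<And>z. z * (h * h) = (h * h) * z \<Longrightarrow> z * y = y * z"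
    using sqrt_one_minus[OF csub_UNIV, of "h * h"] assms by (metis UNIV_I st_mult)
  have "h * y = y * h" using y(3)[of h] by (simp add: mult.assoc)
  then have "norm (1 - y) \<le> sqrt 1"
    using y assms by (intro norm_le_of_square_sum[of _ h]) (auto simp: st_diff algebra_simps)
  then show ?thesis using norm_sa_square[of "1 - y"] y by (simp add: st_diff power_le_one)
qed

text \<open>Converse of \<open>posI\<close>. Being within \<open>r\<close> of
  \<open>r *\<^sub>R 1\<close> adds up by the triangle inequality, which is how a sum of squares is
  seen to be a square in \<open>pos_add\<close>.\<close>

lemma posD:
  assumes "pos a" "norm a \<le> r"
  shows "st a = a" "norm (r *\<^sub>R 1 - a) \<le> r"
proof -
  obtain u where u: "st u = u" "a = u * u" using assms by (auto simp: pos_def)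
  then show "st a = a" by (simp add: st_mult)
  show "norm (r *\<^sub>R 1 - a) \<le> r"
  proof (cases "r = 0")
    case False
    then have r: "r > 0" using order_trans[OF norm_ge_zero assms(2)] by simp
    define h where "h = (1 / sqrt r) *\<^sub>R u"
    have "(norm u)\<^sup>2 \<le> r" using assms u norm_sa_square by simp
    then have "norm u \<le> sqrt r" by (simp add: real_le_rsqrt)
    then have "norm (1 - h * h) \<le> 1" using u r
      by (intro norm_one_minus_square) (simp_all add: h_def st_scaleR divide_simps)
    moreover have "r *\<^sub>R 1 - a = r *\<^sub>R (1 - h * h)" using r u by (simp add: h_def algebra_simps)
    ultimately show ?thesis using r by simp
  qed (use assms in simp)
qed

lemma pos_add: assumes "pos a" "pos b" shows "pos (a + b)"
proof (rule posI)
  show "st (a + b) = a + b" using assms posD(1) by (metis order_refl st_add)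
  have "(norm a + norm b) *\<^sub>R 1 - (a + b) = (norm a *\<^sub>R 1 - a) + (norm b *\<^sub>R 1 - b)"
    by (simp add: algebra_simps)
  also have "norm \<dots> \<le> norm a + norm b"
    by (intro norm_triangle_le add_mono posD assms order_refl)
  finally show "norm ((norm a + norm b) *\<^sub>R 1 - (a + b)) \<le> norm a + norm b" .
qed

lemma pos_zero [simp]: "pos 0"
  using pos_square[of 0] by simp

lemma pos_sum: "(\<And>i. i \<in> I \<Longrightarrow> pos (f i)) \<Longrightarrow> pos (\<Sum>i\<in>I. f i)"
  by (induction I rule: infinite_finite_induct) (auto intro: pos_add)

lemma pos_scaleR: assumes "pos a" "r \<ge> 0" shows "pos (r *\<^sub>R a)"
proof -
  obtain u where "st u = u" "a = u * u" using assms by (auto simp: pos_def)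
  then show ?thesis using pos_square[of "sqrt r *\<^sub>R u"] assms by (simp add: st_scaleR)
qed

lemma pos_sqrt:
  assumes "pos a" "csub B" "a \<in> B"
  obtains u where "u \<in> B" "st u = u" "u * u = a" "pos u" "\<And>z. z * a = a * z \<Longrightarrow> z * u = u * z"
  using sqrt_in[OF assms(2,3) posD[OF assms(1) order_refl]] posI by metis

text \<open>The roots \<open>v\<close> and \<open>u\<close> of \<open>M - s\<close> and
  \<open>M + s\<close> commute with each other and with \<open>s\<close>, so \<open>u * v\<close>
  squares to \<open>M * M - s * s\<close> and \<open>norm_le_of_square_sum\<close> applies.\<close>

lemma norm_le_of_pos:
  assumes s: "st s = s" and "pos (M *\<^sub>R 1 - s)" "pos (M *\<^sub>R 1 + s)" "M \<ge> 0"
  shows "norm s \<le> M"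
proof -
  obtain v where v: "st v = v" "v * v = M *\<^sub>R 1 - s" "\<And>z. z * (M *\<^sub>R 1 - s) = (M *\<^sub>R 1 - s) * z \<Longrightarrow> z * v = v * z"
    using pos_sqrt[OF assms(2) csub_UNIV UNIV_I] by metis
  obtain u where u: "st u = u" "u * u = M *\<^sub>R 1 + s" "\<And>z. z * (M *\<^sub>R 1 + s) = (M *\<^sub>R 1 + s) * z \<Longrightarrow> z * u = u * z"
    using pos_sqrt[OF assms(3) csub_UNIV UNIV_I] by metis
  have sv: "s * v = v * s" by (rule v(3)) (simp add: algebra_simps)
  have su: "s * u = u * s" by (rule u(3)) (simp add: algebra_simps)
  have vu: "v * u = u * v" by (rule u(3)) (use sv in \<open>simp add: algebra_simps\<close>)
  have "(u * v) * (u * v) = (u * u) * (v * v)" by (metis mult.assoc vu)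
  also have "\<dots> = (M * M) *\<^sub>R 1 - s * s" by (simp add: u v algebra_simps)
  finally have "s * s + (u * v) * (u * v) = (M * M) *\<^sub>R 1" by simp
  moreover have "s * (u * v) = (u * v) * s" by (metis mult.assoc su sv)
  ultimately have "norm s \<le> sqrt (M * M)"
    using s u(1) v(1) vu by (intro norm_le_of_square_sum[of s "u * v"]) (simp_all only: st_mult zero_le_square)
  then show ?thesis using assms(4) by simp
qed

lemma pos_norm_minus_sa:
  assumes "st c = c" "norm c \<le> M"
  shows "pos (M *\<^sub>R 1 - c)" "pos (M *\<^sub>R 1 + c)"
  using assms by (auto intro!: posI[of _ M] simp: st_diff st_add st_scaleR)

text \<open>Here \<open>u\<close> is the absolute value of \<open>h\<close> and \<open>k\<close> its
  square root. A root of \<open>p + n\<close> makes compressions such as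
  \<open>n * n * n = n * (p + n) * n\<close> visibly of the form \<open>st b * b\<close>.\<close>

lemma pos_neg_parts:
  assumes B: "csub B" and h: "h \<in> B" "st h = h"
  obtains p n k where "p \<in> B" "n \<in> B" "k \<in> B" "st p = p" "st n = n" "st k = k"
    "h = p - n" "p * n = 0" "n * p = 0" "p + n = k * k"
    "\<And>z. z * h = h * z \<Longrightarrow> z * p = p * z \<and> z * n = n * z \<and> z * k = k * z"
proof -
  have hh: "h * h \<in> B" by (intro csub_intros[OF B] h)
  obtain u where u: "u \<in> B" "st u = u" "u * u = h * h" "pos u" "\<And>z. z * (h * h) = (h * h) * z \<Longrightarrow> z * u = u * z"
    using pos_sqrt[OF pos_square[OF h(2)] B hh] by metis
  obtain k where k: "k \<in> B" "st k = k" "k * k = u" "\<And>z. z * u = u * z \<Longrightarrow> z * k = k * z"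
    using pos_sqrt[OF u(4) B u(1)] by metis
  have uc: "z * u = u * z" if "z * h = h * z" for z
    using u(5)[of z] that by (metis mult.assoc)
  have hu: "h * u = u * h" by (rule uc) simp
  show ?thesis
  proof (rule that[of "(1/2) *\<^sub>R (u + h)" "(1/2) *\<^sub>R (u - h)" k])
    show "h = (1/2) *\<^sub>R (u + h) - (1/2) *\<^sub>R (u - h)"
      by (simp add: algebra_simps flip: scaleR_left.add)
    show "(1/2) *\<^sub>R (u + h) + (1/2) *\<^sub>R (u - h) = k * k"
      by (simp add: algebra_simps k(3) flip: scaleR_left.add)
    show "z * ((1/2) *\<^sub>R (u + h)) = ((1/2) *\<^sub>R (u + h)) * z \<and>
        z * ((1/2) *\<^sub>R (u - h)) = ((1/2) *\<^sub>R (u - h)) * z \<and> z * k = k * z" if "z * h = h * z" for z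
      using uc[OF that] k(4)[of z] that by (simp add: algebra_simps)
  qed (use h u(1-3) k(1,2) hu in \<open>auto simp: st_scaleR st_add st_diff algebra_simps intro!: csub_intros[OF B]\<close>)
qed

text \<open>The distance of this element from \<open>(M * M) *\<^sub>R 1\<close> is the norm of
  \<open>st x * x\<close>, so the norm criterion gives its root before positivity of
  \<open>st x * x\<close> is available.\<close>

lemma contraction_complement:
  assumes B: "csub B" and x: "x \<in> B" "norm x \<le> M"
  obtains s where "s \<in> B" "st s = s" "(M * M) *\<^sub>R 1 - st x * x = s * s"
proof -
  have n: "norm (st x * x) \<le> M * M" using x(2) by (simp add: norm_st_mult power2_eq_square mult_mono')
  have "st x * x \<in> B" by (intro csub_intros[OF B] x)
  have a: "(M * M) *\<^sub>R 1 - st x * x \<in> B" by (intro csub_intros[OF B] x)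
  have "st ((M * M) *\<^sub>R 1 - st x * x) = (M * M) *\<^sub>R 1 - st x * x" by (simp add: st_diff st_scaleR st_mult)
  moreover have "norm ((M * M) *\<^sub>R 1 - ((M * M) *\<^sub>R 1 - st x * x)) \<le> M * M" using n by simp
  ultimately show ?thesis using sqrt_in[OF B a] that by metis
qed

lemma projection_norm_le:
  assumes "st p = p" "p * p = p"
  shows "norm p \<le> 1"
proof -
  have "norm p * norm p = norm p" using norm_sa_square[of p] assms by (simp add: power2_eq_square)
  then show ?thesis by (cases "norm p = 0") auto
qed

lemma sa_cube_zero:
  assumes "st n = n" "n * n * n = 0"
  shows "n = 0"
proof -
  have "norm ((n * n) * (n * n)) = ((norm n)\<^sup>2)\<^sup>2" using assms by (simp add: norm_sa_square st_mult)
  moreover have "(n * n) * (n * n) = 0" using assms(2) by (metis mult.assoc mult_zero_left)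
  ultimately show ?thesis by simp
qed

text \<open>A unital homomorphism preserves squares of self-adjoint elements, hence the order bounds
  of \<open>st x * x\<close> by its norm; \<open>norm_le_of_pos\<close> turns them back into a norm
  bound.\<close>

lemma star_hom_contractive:
  assumes f: "\<And>x y. f (x + y) = f x + f y" "\<And>x y. f (x * y) = f x * f y" "\<And>c x. f (sc c x) = sc c (f x)"
    "\<And>x. f (st x) = st (f x)" "f 1 = 1"
  shows "norm (f x) \<le> norm x"
proof -
  have fr: "f (r *\<^sub>R x) = r *\<^sub>R f x" for r x using f(3)[of "complex_of_real r" x] by (simp add: sc_of_real)
  then have fm: "f (- x) = - f x" for x using fr[of "-1"] by simp
  have fd: "f (x - y) = f x - f y" for x y using f(1)[of x "- y"] fm by simp
  have fp: "pos (f a)" if "pos a" for a using that f unfolding pos_def by metis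
  define s M where "s = st x * x" and "M = norm s"
  have "st s = s" by (simp add: s_def st_mult)
  then have "pos (f (M *\<^sub>R 1 - s))" "pos (f (M *\<^sub>R 1 + s))" "st (f s) = f s"
    using pos_norm_minus_sa[of s M] fp f(4)[of s] by (auto simp: M_def)
  then have "norm (f s) \<le> M" by (intro norm_le_of_pos) (simp_all add: fd fr f M_def)
  then have "(norm (f x))\<^sup>2 \<le> (norm x)\<^sup>2"
    by (simp add: M_def s_def f norm_st_mult)
  then show ?thesis using power2_le_imp_le norm_ge_zero by blast
qed

end

section \<open>Tracial states\<close>

text \<open>For \<open>A > 0\<close> the choice \<open>r = s / A\<close> makes the first summand
  equal to \<open>s\<close>. For \<open>A = 0\<close> a large \<open>r\<close> makes the right-hand
  side smaller than \<open>s\<close>.\<close>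

lemma prod_le_of_weighted_am:
  fixes s A B :: real
  assumes "\<And>r. r > 0 \<Longrightarrow> 2 * s \<le> r * A + B / r" "s \<ge> 0" "A \<ge> 0" "B \<ge> 0"
  shows "s\<^sup>2 \<le> A * B"
proof (cases "s = 0")
  case True
  then show ?thesis using assms by simp
next
  case False
  then have s: "s > 0" using assms by simp
  show ?thesis
  proof (cases "A = 0")
    case True
    have "2 * s \<le> B / ((B + 1) / s)" using assms(1)[of "(B + 1) / s"] s assms True by simp
    also have "\<dots> = s * (B / (B + 1))" by simp
    also have "\<dots> \<le> s * 1" using s assms by (intro mult_left_mono) auto
    finally show ?thesis using s by simp
  next
    case False
    then have "A > 0" using assms by simp
    then have "2 * s \<le> s + B * A / s" using assms(1)[of "s / A"] s by (simp add: field_simps)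
    then show ?thesis using s by (simp add: field_simps power2_eq_square)
  qed
qed

context cstar_algebra
begin

context
  fixes B \<tau> assumes B: "csub B" and \<tau>: "\<tau> \<in> traces B"
begin

lemma tr_add: "x \<in> B \<Longrightarrow> y \<in> B \<Longrightarrow> \<tau> (x + y) = \<tau> x + \<tau> y"
  and tr_sc: "x \<in> B \<Longrightarrow> \<tau> (sc c x) = c * \<tau> x"
  and tr_Im: "x \<in> B \<Longrightarrow> Im (\<tau> (st x * x)) = 0"
  and tr_Re: "x \<in> B \<Longrightarrow> Re (\<tau> (st x * x)) \<ge> 0"
  and tr_one: "\<tau> 1 = 1"
  and tr_comm: "x \<in> B \<Longrightarrow> y \<in> B \<Longrightarrow> \<tau> (x * y) = \<tau> (y * x)"
  using \<tau> by (auto simp: tracial_states_def)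

lemma tr_zero: "\<tau> 0 = 0"
  using tr_sc[OF csub_zero[OF B], of 0] by simp

lemma tr_scaleR: "x \<in> B \<Longrightarrow> \<tau> (r *\<^sub>R x) = of_real r * \<tau> x"
  using tr_sc[of x "of_real r"] by (simp add: sc_of_real)

lemma tr_minus: "x \<in> B \<Longrightarrow> \<tau> (- x) = - \<tau> x"
  using tr_scaleR[of x "-1"] by simp

lemma tr_diff: "x \<in> B \<Longrightarrow> y \<in> B \<Longrightarrow> \<tau> (x - y) = \<tau> x - \<tau> y"
  using tr_add[of x "- y"] tr_minus csub_minus[OF B] by simp

text \<open>Only the values at \<open>st x * x\<close> are assumed real; polarising at
  \<open>1 + z\<close> for \<open>z = x\<close> and for \<open>z = sc \<i> x\<close> gives the
  imaginary and the real part.\<close>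

lemma tr_st: assumes x: "x \<in> B" shows "\<tau> (st x) = cnj (\<tau> x)"
proof -
  have *: "Im (\<tau> z + \<tau> (st z)) = 0" if z: "z \<in> B" for z
  proof -
    have "st (1 + z) * (1 + z) = 1 + z + (st z + st z * z)" by (simp add: st_add algebra_simps)
    moreover have "\<tau> (1 + z + (st z + st z * z)) = 1 + \<tau> z + (\<tau> (st z) + \<tau> (st z * z))"
      using z by (simp add: tr_add tr_one csub_intros[OF B])
    ultimately show ?thesis
      using tr_Im[of "1 + z"] tr_Im[of z] z by (simp add: csub_intros[OF B])
  qed
  show ?thesis
    using *[OF x] *[OF csub_sc[OF B x, of \<i>]] x
    by (simp add: complex_eq_iff st_sc tr_sc csub_intros[OF B])
qed

lemma tr_weak_Cauchy_Schwarz: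
  assumes x: "x \<in> B" and y: "y \<in> B"
  shows "2 * cmod (\<tau> (st y * x)) \<le> Re (\<tau> (st x * x)) + Re (\<tau> (st y * y))"
proof -
  define s where "s = \<tau> (st y * x)"
  \<comment> \<open>The phase that turns \<open>s\<close> into its modulus; the value 1 at
    \<open>s = 0\<close> keeps it unimodular.\<close>
  define c where "c = (if s = 0 then 1 else cnj s / cmod s)"
  have c: "c * s = of_real (cmod s)" "cnj c * c = 1"
    by (auto simp: c_def complex_mult_cnj cmod_def power2_eq_square divide_simps
        simp flip: complex_norm_square of_real_mult)
       (auto simp: complex_eq_iff cmod_def power2_eq_square sum_nonneg_eq_0_iff)
  have s': "\<tau> (st x * y) = cnj s"
    using tr_st[of "st y * x"] x y by (simp add: s_def st_mult csub_intros[OF B])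
  have "st (sc c x - y) * (sc c x - y)
      = sc (cnj c * c) (st x * x) - sc (cnj c) (st x * y) - (sc c (st y * x) - st y * y)"
    by (simp add: st_diff st_sc algebra_simps sc_mult_left sc_mult_right sc_sc sc_diff_right)
  also have "\<tau> \<dots> = \<tau> (st x * x) - cnj c * cnj s - (c * s - \<tau> (st y * y))"
    using x y by (simp add: c tr_diff tr_sc csub_intros[OF B] s' flip: s_def)
  finally have "0 \<le> Re (\<tau> (st x * x) - cnj (c * s) - (c * s - \<tau> (st y * y)))"
    using tr_Re[of "sc c x - y"] x y by (simp add: csub_intros[OF B])
  then show ?thesis by (simp add: c(1) flip: s_def)
qed

lemma tr_Cauchy_Schwarz:
  assumes x: "x \<in> B" and y: "y \<in> B"
  shows "(cmod (\<tau> (st y * x)))\<^sup>2 \<le> Re (\<tau> (st x * x)) * Re (\<tau> (st y * y))"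
proof (rule prod_le_of_weighted_am)
  fix r :: real assume r: "r > 0"
  have "st ((1 / sqrt r) *\<^sub>R y) * (sqrt r *\<^sub>R x) = st y * x"
    "st (sqrt r *\<^sub>R x) * (sqrt r *\<^sub>R x) = r *\<^sub>R (st x * x)"
    "st ((1 / sqrt r) *\<^sub>R y) * ((1 / sqrt r) *\<^sub>R y) = (1 / r) *\<^sub>R (st y * y)"
    using r by (simp_all add: st_scaleR)
  then show "2 * cmod (\<tau> (st y * x)) \<le> r * Re (\<tau> (st x * x)) + Re (\<tau> (st y * y)) / r"
    using tr_weak_Cauchy_Schwarz[of "sqrt r *\<^sub>R x" "(1 / sqrt r) *\<^sub>R y"] x y
    by (simp add: csub_intros[OF B] tr_scaleR)
qed (auto simp: tr_Re x y)

text \<open>Compressing \<open>M\<^sup>2 - st x * x = s * s\<close> by \<open>y\<close> gives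
  \<open>st (s * y) * (s * y)\<close>, whose trace is nonnegative.\<close>

lemma tr_contraction:
  assumes x: "x \<in> B" "norm x \<le> M" and y: "y \<in> B"
  shows "Re (\<tau> (st y * (st x * x) * y)) \<le> M\<^sup>2 * Re (\<tau> (st y * y))"
proof -
  obtain s where s: "s \<in> B" "st s = s" "(M * M) *\<^sub>R 1 - st x * x = s * s"
    using contraction_complement[OF B x] .
  have "st (s * y) * (s * y) = st y * ((M * M) *\<^sub>R 1 - st x * x) * y"
    by (simp add: st_mult s mult.assoc)
  also have "\<dots> = (M * M) *\<^sub>R (st y * y) - st y * (st x * x) * y"
    by (simp add: algebra_simps)
  finally have "\<tau> (st (s * y) * (s * y)) = of_real (M * M) * \<tau> (st y * y) - \<tau> (st y * (st x * x) * y)"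
    using x y by (simp only: tr_diff tr_scaleR csub_intros[OF B])
  then show ?thesis using tr_Re[of "s * y"] s y by (simp add: csub_intros[OF B] power2_eq_square)
qed

lemma tr_st_mult_le: "x \<in> B \<Longrightarrow> norm x \<le> M \<Longrightarrow> Re (\<tau> (st x * x)) \<le> M\<^sup>2"
  using tr_contraction[of x M 1] by (simp add: csub_one[OF B] tr_one)

lemma tr_norm_le: assumes x: "x \<in> B" shows "cmod (\<tau> x) \<le> norm x"
proof -
  have "(cmod (\<tau> x))\<^sup>2 \<le> Re (\<tau> (st x * x))"
    using tr_Cauchy_Schwarz[OF x csub_one[OF B]] by (simp add: tr_one)
  also have "\<dots> \<le> (norm x)\<^sup>2" using tr_st_mult_le[OF x order_refl] .
  finally show ?thesis by (rule power2_le_imp_le) simp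
qed

text \<open>The parallelogram identity with the nonnegative term for \<open>x - y\<close>
  dropped.\<close>

lemma tr_st_add_le:
  assumes x: "x \<in> B" and y: "y \<in> B"
  shows "Re (\<tau> (st (x + y) * (x + y))) \<le> 2 * Re (\<tau> (st x * x)) + 2 * Re (\<tau> (st y * y))"
proof -
  have "st (x + y) * (x + y) = 2 *\<^sub>R (st x * x) + 2 *\<^sub>R (st y * y) - st (x - y) * (x - y)"
    by (simp add: st_add st_diff algebra_simps scaleR_2)
  also have "\<tau> \<dots> = 2 * \<tau> (st x * x) + 2 * \<tau> (st y * y) - \<tau> (st (x - y) * (x - y))"
    using x y by (simp add: tr_diff tr_add tr_scaleR csub_intros[OF B])
  finally show ?thesis using tr_Re[of "x - y"] x y by (simp add: csub_intros[OF B])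
qed

end

lemma bounded_linear_tr:
  assumes "\<tau> \<in> traces UNIV"
  shows "bounded_linear \<tau>"
  by (rule bounded_linear_intro[where K = 1])
    (use tr_add[OF csub_UNIV assms] tr_scaleR[OF csub_UNIV assms] tr_norm_le[OF csub_UNIV assms] in
      \<open>auto simp: scaleR_conv_of_real\<close>)

text \<open>The null space of the trace 2-norm is closed, a left ideal by
  \<open>tr_contraction\<close>, and self-adjoint by the trace property, hence two-sided. It misses
  1, so simplicity makes it zero.\<close>

lemma trace_faithful:
  assumes simple: "simple_alg sc" and \<tau>: "\<tau> \<in> traces UNIV" and x: "\<tau> (st x * x) = 0"
  shows "x = 0"
proof -
  note U = csub_UNIV \<tau>
  define I where "I = {x. \<tau> (st x * x) = 0}"
  have I_iff: "x \<in> I \<longleftrightarrow> Re (\<tau> (st x * x)) \<le> 0" for x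
    using tr_Re[OF U, of x] tr_Im[OF U, of x] by (auto simp: I_def complex_eq_iff)
  have "I = (\<lambda>x. \<tau> (st x * x)) -` {0}" by (auto simp: I_def)
  moreover have "closed ((\<lambda>x. \<tau> (st x * x)) -` {0})"
    by (intro closed_vimage closed_singleton bounded_linear.continuous_on[OF bounded_linear_tr[OF \<tau>]]
        continuous_intros bounded_linear.continuous_on[OF bounded_linear_st])
  ultimately have cl: "closed I" by simp
  have left: "a * y \<in> I" if "y \<in> I" for a y
  proof -
    have "st (a * y) * (a * y) = st y * (st a * a) * y" by (simp add: st_mult mult.assoc)
    moreover have "Re (\<tau> (st y * y)) = 0" using that by (simp add: I_def)
    ultimately show ?thesis using tr_contraction[OF U UNIV_I order_refl UNIV_I, of y a]
      by (simp add: I_iff)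
  qed
  have adj: "st y \<in> I" if "y \<in> I" for y
    using that tr_comm[OF U, of y "st y"] by (simp add: I_def)
  have right: "y * a \<in> I" if "y \<in> I" for a y
    using adj[OF left[OF adj[OF that], of "st a"]] by (simp add: st_mult)
  have "closed_ideal sc I"
    unfolding closed_ideal_def
  proof (intro conjI ballI allI)
    show "x + y \<in> I" if "x \<in> I" "y \<in> I" for x y
      using tr_st_add_le[OF U, of x y] that by (auto simp: I_iff) 
    show "sc c x \<in> I" if "x \<in> I" for c x
      using left[OF that, of "sc c 1"] by (simp add: sc_mult_left)
  qed (auto simp: left right cl, simp add: I_def tr_zero[OF U])
  moreover have "1 \<notin> I" by (simp add: I_def tr_one[OF U])
  ultimately have "I = {0}" using simple unfolding simple_alg_def by blast
  then show ?thesis using x by (auto simp: I_def)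
qed

text \<open>A faithful trace gives a short proof that elements \<open>b\<^sup>* b\<close> are positive: with \<open>n\<close> the negative
  part, \<open>(b n)\<^sup>* (b n) = - n\<^sup>3\<close> has nonnegative and nonpositive trace.\<close>

lemma pos_st_mult:
  assumes simple: "simple_alg sc" and \<tau>: "\<tau> \<in> traces UNIV"
  shows "pos (st b * b)"
proof -
  note U = csub_UNIV \<tau>
  have "st (st b * b) = st b * b" by (simp add: st_mult)
  then obtain p n k where pn: "st p = p" "st n = n" "st k = k" "st b * b = p - n" "p * n = 0" "n * p = 0"
    "p + n = k * k"
    "\<And>z. z * (st b * b) = (st b * b) * z \<Longrightarrow> z * p = p * z \<and> z * n = n * z \<and> z * k = k * z"
    by (rule pos_neg_parts[OF csub_UNIV UNIV_I]) (rule that; assumption)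
  have "k * (st b * b) = (st b * b) * k" using pn(8)[OF refl] by metis
  then have kn: "k * n = n * k" using pn(8) by blast
  have "n * (st b * b) * n = - (n * n * n)" unfolding pn(4) by (simp add: pn(1-3,5,6) algebra_simps)
  moreover have "st (b * n) * (b * n) = n * (st b * b) * n" by (simp add: st_mult pn(2) mult.assoc)
  ultimately have 1: "st (b * n) * (b * n) = - (n * n * n)" by simp
  have "n * n * n = n * (p + n) * n" by (simp add: pn(1-7) algebra_simps)
  also have "\<dots> = st (k * n) * (k * n)" by (simp add: pn(1-7) st_mult mult.assoc)
  finally have 2: "n * n * n = st (k * n) * (k * n)" .
  have "\<tau> (st (b * n) * (b * n)) = - \<tau> (st (k * n) * (k * n))"
    unfolding 1 using tr_minus[OF U, of "n * n * n"] 2 by simp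
  then have "\<tau> (st (k * n) * (k * n)) = 0"
    using tr_Re[OF U, of "k * n"] tr_Re[OF U, of "b * n"] tr_Im[OF U, of "k * n"]
    by (simp add: complex_eq_iff)
  then have "k * n = 0" using trace_faithful[OF simple \<tau>] by blast
  then have "n = 0" using sa_cube_zero 2 pn(1-7) by simp
  then have "st b * b = k * k" using pn(1-7) by simp
  then show ?thesis using pos_square pn(3) by simp
qed

end

section \<open>Compactness, and fixed points of compact groups\<close>

lemma compact_product:
  fixes K :: "'a \<Rightarrow> 'b::topological_space set"
  assumes "\<And>x. compact (K x)"
  shows "compact (Pi UNIV K)"
proof -
  have "compactin (product_topology (\<lambda>_. euclidean) UNIV) (PiE UNIV K)"
    using assms by (subst compactin_PiE) auto
  then show ?thesis by (simp add: euclidean_product_topology PiE_def)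
qed

text \<open>The filter form of choosing a pointwise convergent subnet: Tychonoff gives a cluster
  point in the product of the discs \<open>cball 0 (K x)\<close>.\<close>

lemma bounded_net_cluster:
  fixes \<rho> :: "'i \<Rightarrow> 'a \<Rightarrow> complex"
  assumes F: "F \<noteq> bot" and bounded_fun: "\<And>i x. cmod (\<rho> i x) \<le> K x"
  obtains G \<rho>' where "G \<le> F" "G \<noteq> bot" "\<And>x. ((\<lambda>i. \<rho> i x) \<longlongrightarrow> \<rho>' x) G"
proof -
  define U where "U = Pi UNIV (\<lambda>x. cball 0 (K x) :: complex set)"
  have "compact U" unfolding U_def by (intro compact_product compact_cball)
  moreover have "filtermap \<rho> F \<noteq> bot" using F by (simp add: filtermap_bot_iff)
  moreover have "eventually (\<lambda>f. f \<in> U) (filtermap \<rho> F)"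
    using bounded_fun by (simp add: eventually_filtermap U_def)
  ultimately obtain r where r: "inf (nhds r) (filtermap \<rho> F) \<noteq> bot"
    unfolding compact_filter by blast
  \<comment> \<open>The coarsest refinement of \<open>F\<close> along which \<open>\<rho>\<close>
    converges to \<open>r\<close>; it is proper exactly because \<open>r\<close> is a cluster
    point.\<close>
  define G where "G = inf F (filtercomap \<rho> (nhds r))"
  show ?thesis
  proof (rule that[of G r])
    show "G \<le> F" by (simp add: G_def)
    show "G \<noteq> bot"
    proof
      assume "G = bot"
      then have "eventually (\<lambda>_. False) (inf F (filtercomap \<rho> (nhds r)))" by (simp add: G_def)
      then obtain P Q where PQ: "eventually P F" "eventually Q (filtercomap \<rho> (nhds r))"
        "\<And>x. P x \<Longrightarrow> Q x \<Longrightarrow> False" by (auto simp: eventually_inf)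
      then obtain R where R: "eventually R (nhds r)" "\<And>x. R (\<rho> x) \<Longrightarrow> Q x"
        by (auto simp: eventually_filtercomap)
      have "eventually (\<lambda>f. \<not> R f) (filtermap \<rho> F)"
        unfolding eventually_filtermap using PQ(1) by eventually_elim (use PQ(3) R(2) in blast)
      then have "eventually (\<lambda>_. False) (inf (nhds r) (filtermap \<rho> F))"
        using R(1) unfolding eventually_inf by blast
      then show False using r by (simp add: trivial_limit_def)
    qed
    show "((\<lambda>i. \<rho> i x) \<longlongrightarrow> r x) G" for x
    proof -
      have "filterlim \<rho> (nhds r) G"
        by (simp add: G_def filterlim_def filtermap_le_iff_le_filtercomap)
      moreover have "eventually (\<lambda>f. f x \<in> S) (nhds r)" if "open S" "r x \<in> S" for S
        using open_vimage[OF that(1) continuous_on_product_coordinates[of x]] that(2)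
        unfolding eventually_nhds by (intro exI[of _ "(\<lambda>f. f x) -` S"]) auto
      ultimately show ?thesis
        by (intro topological_tendstoI) (auto simp: filterlim_iff)
    qed
  qed
qed

text \<open>A cluster point exists by \<open>bounded_net_cluster\<close>, with the one-point type as
  index set of the product. An ultrafilter decides every neighbourhood, so a cluster point is a
  limit.\<close>

lemma ultrafilter_bounded_convergent:
  fixes f :: "nat \<Rightarrow> complex"
  assumes \<omega>: "free_ultrafilter \<omega>" and bounded_fun: "\<And>n. cmod (f n) \<le> K"
  shows "(f \<longlongrightarrow> Lim \<omega> f) \<omega>"
proof -
  have nb: "\<omega> \<noteq> bot" using \<omega> by (simp add: free_ultrafilter_def)
  obtain G l where G: "G \<le> \<omega>" "G \<noteq> bot" "\<And>x::unit. ((\<lambda>i. f i) \<longlongrightarrow> l x) G"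
    using bounded_net_cluster[OF nb, of "\<lambda>n _. f n" "\<lambda>_. K"] bounded_fun by metis
  have "(f \<longlongrightarrow> l ()) \<omega>"
  proof (rule topological_tendstoI)
    fix S assume "open S" "l () \<in> S"
    then have 1: "eventually (\<lambda>n. f n \<in> S) G" using G(3) topological_tendstoD by blast
    show "eventually (\<lambda>n. f n \<in> S) \<omega>"
    proof (rule ccontr)
      assume "\<not> ?thesis"
      then have "eventually (\<lambda>n. f n \<notin> S) \<omega>" using \<omega> by (auto simp: free_ultrafilter_def)
      then have "eventually (\<lambda>n. f n \<notin> S) G" using G(1) filter_leD by blast
      with 1 have "eventually (\<lambda>_. False) G" by eventually_elim auto
      with G(2) show False by (simp add: trivial_limit_def)
    qed
  qed
  with nb show ?thesis using tendsto_Lim by metis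
qed

text \<open>Mazur's theorem by total boundedness. One third of \<open>e\<close> is spent on a finite
  net \<open>k\<close> of \<open>S\<close>, one on a finite net of the compact hull of
  \<open>k\<close>, and one on the closure.\<close>

lemma compact_closed_convex_hull:
  fixes S :: "'a::banach set"
  assumes S: "compact S"
  shows "compact (closure (convex hull S))"
  unfolding compact_eq_totally_bounded
proof (intro conjI allI impI)
  show "complete (closure (convex hull S))" by (simp add: complete_eq_closed)
  fix e :: real assume e: "e > 0"
  then have e3: "e / 3 > 0" by simp
  obtain k where k: "finite k" "S \<subseteq> (\<Union>x\<in>k. ball x (e/3))"
    using S e3 unfolding compact_eq_totally_bounded by meson
  have "compact (convex hull k)" using k(1) by (rule finite_imp_compact_convex_hull)
  then obtain m where m: "finite m" "convex hull k \<subseteq> (\<Union>x\<in>m. ball x (e/3))"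
    using e3 unfolding compact_eq_totally_bounded by meson
  define T where "T = (\<Union>x\<in>convex hull k. \<Union>y\<in>ball 0 (e/3). {x + y})"
  have "convex T" unfolding T_def by (intro convex_sums convex_convex_hull convex_ball)
  moreover have "S \<subseteq> T"
  proof
    fix x assume "x \<in> S"
    then obtain y where "y \<in> k" "dist y x < e/3" using k by auto
    then have "y \<in> convex hull k" "x - y \<in> ball 0 (e/3)" "x = y + (x - y)"
      by (auto simp: hull_inc dist_norm norm_minus_commute)
    then show "x \<in> T" unfolding T_def by blast
  qed
  ultimately have hull: "convex hull S \<subseteq> T" by (simp add: hull_minimal)
  show "\<exists>k. finite k \<and> closure (convex hull S) \<subseteq> (\<Union>x\<in>k. ball x e)"
  proof (intro exI conjI subsetI)
    fix x assume "x \<in> closure (convex hull S)"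
    then obtain y where y: "y \<in> convex hull S" "dist y x < e/3" using e3 closure_approachable by blast
    then obtain a b where ab: "a \<in> convex hull k" "b \<in> ball 0 (e/3)" "y = a + b" using hull by (auto simp: T_def)
    then obtain c where c: "c \<in> m" "dist c a < e/3" using m by auto
    have "dist a y < e/3" using ab by (simp add: dist_norm)
    then have "dist c x < e" using y(2) c(2) dist_triangle[of c x a] dist_triangle[of a x y] by linarith
    then show "x \<in> (\<Union>x\<in>m. ball x e)" using c by auto
  qed (rule m(1))
qed

context cstar_algebra
begin

lemma trace_space_eq:
  assumes B: "csub B"
  shows "trace_space sc st B = {\<tau>. (\<forall>x. x \<notin> B \<longrightarrow> \<tau> x = 0) \<and> \<tau> \<in> traces B}"
proof -
  have *: "(\<lambda>x. if x \<in> B then \<tau> x else 0) \<in> traces B" if "\<tau> \<in> traces B" for \<tau>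
    using that by (auto simp: tracial_states_def csub_intros[OF B])
  show ?thesis
  proof (intro equalityI subsetI)
    fix \<tau> assume "\<tau> \<in> {\<tau>. (\<forall>x. x \<notin> B \<longrightarrow> \<tau> x = 0) \<and> \<tau> \<in> traces B}"
    then have "\<tau> = (\<lambda>x. if x \<in> B then \<tau> x else 0)" "\<tau> \<in> traces B" by auto
    then show "\<tau> \<in> trace_space sc st B" unfolding trace_space_def by blast
  qed (use * in \<open>auto simp: trace_space_def\<close>)
qed

text \<open>Banach-Alaoglu: the conditions on a trace are closed in the pointwise topology and the
  values at \<open>x\<close> lie in a disc of radius \<open>norm x\<close>. Setting traces to zero
  outside \<open>B\<close> is one more closed condition.\<close>

lemma compact_trace_space:
  assumes B: "csub B"
  shows "compact (trace_space sc st B)"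
proof -
  have sub: "trace_space sc st B \<subseteq> Pi UNIV (\<lambda>x. cball 0 (norm x))"
    using tr_norm_le[OF B] unfolding trace_space_eq[OF B] by auto (metis norm_ge_zero norm_zero)
  have c[continuous_intros]: "continuous_on UNIV (\<lambda>\<tau>::'a \<Rightarrow> complex. \<tau> x)" for x by simp
  have "trace_space sc st B = {\<tau>. (\<forall>x\<in>-B. \<tau> x = 0) \<and>
     (\<forall>x\<in>B. \<forall>y\<in>B. \<tau> (x + y) = \<tau> x + \<tau> y) \<and>
     (\<forall>c. \<forall>x\<in>B. \<tau> (sc c x) = c * \<tau> x) \<and>
     (\<forall>x\<in>B. Im (\<tau> (st x * x)) = 0 \<and> Re (\<tau> (st x * x)) \<ge> 0) \<and>
     \<tau> 1 = 1 \<and>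
     (\<forall>x\<in>B. \<forall>y\<in>B. \<tau> (x * y) = \<tau> (y * x))}"
    unfolding trace_space_eq[OF B] tracial_states_def by auto
  also have "closed \<dots>"
    unfolding Ball_def
    by (intro closed_Collect_conj closed_Collect_imp open_Collect_const closed_Collect_all closed_Collect_eq closed_Collect_le
        continuous_intros)
  finally have "closed (trace_space sc st B)" .
  then have "compact (Pi UNIV (\<lambda>x::'a. cball (0::complex) (norm x)) \<inter> trace_space sc st B)"
    by (intro compact_Int_closed compact_product compact_cball)
  then show ?thesis using sub by (simp add: Int_absorb1)
qed

end

section \<open>Actions of compact groups on C*-algebras\<close>

locale cstar_system = cstar_algebra sc st
  for sc :: "complex \<Rightarrow> 'a::{real_normed_algebra_1,banach} \<Rightarrow> 'a" and st :: "'a \<Rightarrow> 'a" +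
  fixes mul :: "'g::topological_space \<Rightarrow> 'g \<Rightarrow> 'g" and iv :: "'g \<Rightarrow> 'g" and e :: 'g
    and \<alpha> :: "'g \<Rightarrow> 'a \<Rightarrow> 'a"
  assumes group: "top_group mul iv e" and compact_group: "compact (UNIV :: 'g set)"
    and action: "cstar_action sc st mul e \<alpha>"
begin

lemma act_add: "\<alpha> g (x + y) = \<alpha> g x + \<alpha> g y"
  and act_mult: "\<alpha> g (x * y) = \<alpha> g x * \<alpha> g y"
  and act_sc: "\<alpha> g (sc c x) = sc c (\<alpha> g x)"
  and act_st: "\<alpha> g (st x) = st (\<alpha> g x)"
  and act_one: "\<alpha> g 1 = 1"
  and act_e: "\<alpha> e x = x"
  and act_mul: "\<alpha> (mul g h) x = \<alpha> g (\<alpha> h x)"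
  and act_cont: "continuous_on UNIV (\<lambda>g. \<alpha> g x)"
  using action by (auto simp: cstar_action_def)

lemma act_scaleR: "\<alpha> g (r *\<^sub>R x) = r *\<^sub>R \<alpha> g x"
  using act_sc[of g "complex_of_real r"] by (simp add: sc_of_real)

lemma act_minus: "\<alpha> g (- x) = - \<alpha> g x"
  using act_scaleR[of g "-1"] by simp

lemma act_diff: "\<alpha> g (x - y) = \<alpha> g x - \<alpha> g y"
  using act_add[of g x "- y"] act_minus by simp

lemma act_zero: "\<alpha> g 0 = 0"
  using act_diff[of g 0 0] by simp

lemma act_sum: "\<alpha> g (\<Sum>i\<in>I. f i) = (\<Sum>i\<in>I. \<alpha> g (f i))"
  by (induction I rule: infinite_finite_induct) (auto simp: act_add act_zero)

lemma act_iv: "\<alpha> (iv g) (\<alpha> g x) = x" "\<alpha> g (\<alpha> (iv g) x) = x"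
  using group act_e by (simp_all add: top_group_def flip: act_mul)

lemma norm_act [simp]: "norm (\<alpha> g x) = norm x"
proof -
  have *: "norm (\<alpha> g x) \<le> norm x" for g x
    by (rule star_hom_contractive) (rule act_add act_mult act_sc act_st act_one)+
  from *[of g x] *[of "iv g" "\<alpha> g x"] show ?thesis by (simp add: act_iv)
qed

lemma bounded_linear_act: "bounded_linear (\<alpha> g)"
  by (rule bounded_linear_intro[where K = 1]) (auto simp: act_add act_scaleR)

lemma csub_fixed_points: "csub (fixed_points \<alpha>)"
proof -
  have "fixed_points \<alpha> = {x. \<forall>g. \<alpha> g x = x}" by (simp add: fixed_points_def)
  also have "closed \<dots>"
    by (intro closed_Collect_all closed_Collect_eq bounded_linear.continuous_on[OF bounded_linear_act]
        continuous_on_id)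
  finally have cl: "closed (fixed_points \<alpha>)" .
  then show ?thesis
    unfolding csub_def by (auto simp: fixed_points_def act_add act_mult act_sc act_st act_one)
qed

text \<open>The orbit of an almost invariant element spans a compact convex invariant set, on which the
  strictly convex invariant function \<open>x \<mapsto> sup\<^sub>g \<tau>((\<alpha>\<^sub>g x)\<^sup>* \<alpha>\<^sub>g x)\<close> has a unique minimiser. This replaces
  averaging over Haar measure.\<close>

lemma fixed_point_near:
  assumes simple: "simple_alg sc" and \<tau>: "\<tau> \<in> traces UNIV"
    and z: "\<And>g. norm (\<alpha> g z - z) \<le> \<eta>"
  shows "\<exists>z'\<in>fixed_points \<alpha>. norm (z' - z) \<le> \<eta>"
proof -
  note U = csub_UNIV \<tau>
  define S where "S = range (\<lambda>g. \<alpha> g z)"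
  define K where "K = closure (convex hull S)"
  have "compact S" unfolding S_def using compact_group act_cont compact_continuous_image by blast
  then have K: "compact K" unfolding K_def by (rule compact_closed_convex_hull)
  have "convex K" by (simp add: K_def)
  have "z \<in> S" unfolding S_def using act_e[of z] by (metis rangeI)
  then have "z \<in> K" unfolding K_def using closure_subset[THEN subsetD, OF hull_inc] by metis
  have "S \<subseteq> cball z \<eta>" using z by (auto simp: S_def dist_norm norm_minus_commute)
  then have Kz: "K \<subseteq> cball z \<eta>"
    unfolding K_def by (intro closure_minimal hull_minimal convex_cball closed_cball)
  have inv: "\<alpha> g x \<in> K" if "x \<in> K" for g x
  proof -
    have "\<alpha> g ` S \<subseteq> S" by (auto simp: S_def simp flip: act_mul)
    moreover have "\<alpha> g ` (convex hull S) = convex hull (\<alpha> g ` S)"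
      by (intro convex_hull_linear_image bounded_linear.linear bounded_linear_act)
    ultimately have "\<alpha> g ` (convex hull S) \<subseteq> convex hull S" using hull_mono by metis
    then have "\<alpha> g ` K \<subseteq> K"
      unfolding K_def
      by (intro image_closure_subset bounded_linear.continuous_on[OF bounded_linear_act] continuous_on_id closed_closure)
        (rule order_trans[OF _ closure_subset])
    then show ?thesis using that by blast
  qed
  define q where "q x = Re (\<tau> (st x * x))" for x
  have q_diff: "q x - q y \<le> norm (x - y) * (norm x + norm y)" for x y
  proof -
    have "q x - q y = Re (\<tau> (st x * x - st y * y))" by (simp add: q_def tr_diff[OF U])
    also have "\<dots> \<le> norm (st x * x - st y * y)"
      using tr_norm_le[OF U UNIV_I] complex_Re_le_cmod order_trans by blast
    also have "st x * x - st y * y = st x * (x - y) + st (x - y) * y"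
      by (simp add: st_diff algebra_simps)
    also have "norm \<dots> \<le> norm x * norm (x - y) + norm (x - y) * norm y"
      by (intro norm_triangle_le add_mono) (metis norm_mult_ineq norm_st)+
    finally show ?thesis by (simp add: algebra_simps)
  qed
  have q_mid: "q ((1/2) *\<^sub>R (x + y)) = q x / 2 + q y / 2 - q (x - y) / 4" for x y
    by (simp add: q_def st_scaleR st_add st_diff tr_scaleR[OF U] tr_add[OF U] tr_diff[OF U] algebra_simps)
      (simp add: field_simps)
  have q0: "q x \<le> 0 \<Longrightarrow> x = 0" for x
    using trace_faithful[OF simple \<tau>, of x] tr_Re[OF U, of x] tr_Im[OF U, of x]
    by (simp add: q_def complex_eq_iff)
  \<comment> \<open>\<open>\<tau>\<close> itself need not be invariant; the maximum of
    \<open>q\<close> over the orbit is, and compactness of the group attains it.\<close>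
  have "\<exists>g. \<forall>h. q (\<alpha> h x) \<le> q (\<alpha> g x)" for x
  proof -
    have "continuous_on UNIV (\<lambda>g. q (\<alpha> g x))"
      unfolding q_def
      by (intro continuous_intros bounded_linear.continuous_on[OF bounded_linear_tr[OF \<tau>]]
          bounded_linear.continuous_on[OF bounded_linear_st] act_cont)
    then show ?thesis using continuous_attains_sup[OF compact_group] by auto
  qed
  then obtain G where G: "\<And>x h. q (\<alpha> h x) \<le> q (\<alpha> (G x) x)" by metis
  define f where "f x = q (\<alpha> (G x) x)" for x
  obtain R where R: "\<And>x. x \<in> K \<Longrightarrow> norm x \<le> R" "R > 0"
    using compact_imp_bounded[OF K] bounded_pos by metis
  have f_le: "f x - f y \<le> (2 * R) * norm (x - y)" if "x \<in> K" "y \<in> K" for x y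
  proof -
    have "f x - f y \<le> q (\<alpha> (G x) x) - q (\<alpha> (G x) y)" using G[of "G x" y] by (simp add: f_def)
    also have "\<dots> \<le> norm (x - y) * (norm x + norm y)"
      using q_diff[of "\<alpha> (G x) x" "\<alpha> (G x) y"] by (simp flip: act_diff)
    also have "\<dots> \<le> norm (x - y) * (2 * R)"
      using R(1)[OF that(1)] R(1)[OF that(2)] by (intro mult_left_mono) auto
    finally show ?thesis by (simp add: mult.commute)
  qed
  have "(2 * R)-lipschitz_on K f"
    using f_le R(2) by (intro lipschitz_onI) (fastforce simp: dist_norm abs_le_iff norm_minus_commute)+
  then have "continuous_on K f" by (rule lipschitz_on_continuous_on)
  then obtain x0 where x0: "x0 \<in> K" "\<And>y. y \<in> K \<Longrightarrow> f x0 \<le> f y"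
    using continuous_attains_inf[OF K] \<open>z \<in> K\<close> by (metis empty_iff)
  have "\<alpha> g x0 = x0" for g
  proof -
    define m where "m = (1/2) *\<^sub>R (x0 + \<alpha> g x0)"
    have "m \<in> K"
      using convexD[OF \<open>convex K\<close> x0(1) inv[OF x0(1)], of "1/2" "1/2" g] by (simp add: m_def scaleR_add_right)
    \<comment> \<open>At the group element where \<open>f m\<close> is attained, both translates of
      \<open>x0\<close> have \<open>q\<close> at most \<open>f x0\<close>. Minimality of
      \<open>f x0\<close> then leaves no room for the parallelogram defect, so the two translates
      agree.\<close>
    have "f m = q ((1/2) *\<^sub>R (\<alpha> (G m) x0 + \<alpha> (mul (G m) g) x0))"
      by (simp add: f_def m_def act_scaleR act_add act_mul)
    also have "\<dots> \<le> f x0 - q (\<alpha> (G m) x0 - \<alpha> (mul (G m) g) x0) / 4"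
      unfolding q_mid using G[of _ x0] by (smt (verit, best) f_def field_sum_of_halves)
    finally have "q (\<alpha> (G m) x0 - \<alpha> (mul (G m) g) x0) \<le> 0" using x0(2)[OF \<open>m \<in> K\<close>] by simp
    from q0[OF this] have "\<alpha> (G m) (x0 - \<alpha> g x0) = 0" by (simp add: act_diff act_mul)
    then have "norm (x0 - \<alpha> g x0) = 0" by (metis norm_act norm_zero)
    then show ?thesis by simp
  qed
  then have "x0 \<in> fixed_points \<alpha>" by (simp add: fixed_points_def)
  moreover have "norm (x0 - z) \<le> \<eta>" using Kz x0(1) by (auto simp: dist_norm norm_minus_commute)
  ultimately show ?thesis by blast
qed

end

section \<open>Sums of conjugates along almost orthogonal families\<close>

text \<open>Equality modulo families that vanish along the filter. With \<open>bounded_fun\<close>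
  it is a congruence for products, so approximate commutation can be handled by equational
  reasoning, without tracking epsilons.\<close>

definition asym_eq :: "'i filter \<Rightarrow> ('i \<Rightarrow> 'a::real_normed_vector) \<Rightarrow> ('i \<Rightarrow> 'a) \<Rightarrow> bool" where
  "asym_eq \<F> X Y \<longleftrightarrow> ((\<lambda>n. X n - Y n) \<longlongrightarrow> 0) \<F>"

definition bounded_fun :: "('i \<Rightarrow> 'a::real_normed_vector) \<Rightarrow> bool" where
  "bounded_fun X \<longleftrightarrow> (\<exists>K. \<forall>n. norm (X n) \<le> K)"

lemma bounded_funI: "(\<And>n. norm (X n) \<le> K) \<Longrightarrow> bounded_fun X"
  by (auto simp: bounded_fun_def)

lemma bounded_fun_const [intro, simp]: "bounded_fun (\<lambda>_. c)"
  by (auto simp: bounded_fun_def)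

lemma bounded_fun_add [intro]: "bounded_fun X \<Longrightarrow> bounded_fun Y \<Longrightarrow> bounded_fun (\<lambda>n. X n + Y n)"
  unfolding bounded_fun_def by (meson norm_triangle_mono)

lemma bounded_fun_diff [intro]: "bounded_fun X \<Longrightarrow> bounded_fun Y \<Longrightarrow> bounded_fun (\<lambda>n. X n - Y n)"
  unfolding bounded_fun_def by (meson norm_diff_triangle_le norm_triangle_le_diff add_mono)

lemma bounded_fun_mult [intro]:
  fixes X :: "'i \<Rightarrow> 'a::real_normed_algebra"
  assumes "bounded_fun X" "bounded_fun Y" shows "bounded_fun (\<lambda>n. X n * Y n)"
proof -
  obtain K L where "\<And>n. norm (X n) \<le> K" "\<And>n. norm (Y n) \<le> L" using assms by (auto simp: bounded_fun_def)
  then have "norm (X n * Y n) \<le> K * L" for n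
    by (meson mult_mono norm_ge_zero norm_mult_ineq order_trans)
  then show ?thesis by (rule bounded_funI)
qed

lemma bounded_fun_sum [intro]: "(\<And>i. i \<in> I \<Longrightarrow> bounded_fun (X i)) \<Longrightarrow> bounded_fun (\<lambda>n. \<Sum>i\<in>I. X i n)"
  by (induction I rule: infinite_finite_induct) auto

lemma asym_eq_refl [simp]: "asym_eq \<F> X X"
  by (simp add: asym_eq_def)

lemma asym_eq_sym: "asym_eq \<F> X Y \<Longrightarrow> asym_eq \<F> Y X"
  using tendsto_minus[of "\<lambda>n. X n - Y n" 0 \<F>] by (simp add: asym_eq_def)

lemma asym_eq_trans [trans]: "asym_eq \<F> X Y \<Longrightarrow> asym_eq \<F> Y Z \<Longrightarrow> asym_eq \<F> X Z"
  using tendsto_add[of "\<lambda>n. X n - Y n" 0 \<F> "\<lambda>n. Y n - Z n" 0] by (simp add: asym_eq_def)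

lemma asym_eq_eq_trans [trans]: "X = Y \<Longrightarrow> asym_eq \<F> Y Z \<Longrightarrow> asym_eq \<F> X Z"
  and asym_eq_trans_eq [trans]: "asym_eq \<F> X Y \<Longrightarrow> Y = Z \<Longrightarrow> asym_eq \<F> X Z"
  by simp_all

lemma asym_eq_add: "asym_eq \<F> X X' \<Longrightarrow> asym_eq \<F> Y Y' \<Longrightarrow> asym_eq \<F> (\<lambda>n. X n + Y n) (\<lambda>n. X' n + Y' n)"
  using tendsto_add[of "\<lambda>n. X n - X' n" 0 \<F> "\<lambda>n. Y n - Y' n" 0] by (simp add: asym_eq_def algebra_simps)

lemma asym_eq_diff: "asym_eq \<F> X X' \<Longrightarrow> asym_eq \<F> Y Y' \<Longrightarrow> asym_eq \<F> (\<lambda>n. X n - Y n) (\<lambda>n. X' n - Y' n)"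
  using tendsto_diff[of "\<lambda>n. X n - X' n" 0 \<F> "\<lambda>n. Y n - Y' n" 0] by (simp add: asym_eq_def algebra_simps)

lemma asym_eq_sum: "(\<And>i. i \<in> I \<Longrightarrow> asym_eq \<F> (X i) (Y i)) \<Longrightarrow> asym_eq \<F> (\<lambda>n. \<Sum>i\<in>I. X i n) (\<lambda>n. \<Sum>i\<in>I. Y i n)"
  by (induction I rule: infinite_finite_induct) (auto intro: asym_eq_add)

lemma asym_eq_mult:
  fixes X :: "'i \<Rightarrow> 'a::real_normed_algebra"
  assumes "asym_eq \<F> X X'" "asym_eq \<F> Y Y'" "bounded_fun X" "bounded_fun Y'"
  shows "asym_eq \<F> (\<lambda>n. X n * Y n) (\<lambda>n. X' n * Y' n)"
proof -
  have bf: "Bfun Z \<F>" if "bounded_fun Z" for Z :: "'i \<Rightarrow> 'a"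
  proof -
    obtain K where "\<And>n. norm (Z n) \<le> K" using \<open>bounded_fun Z\<close> by (auto simp: bounded_fun_def)
    then show ?thesis by (intro BfunI[of _ K]) simp
  qed
  have "((\<lambda>n. X n * (Y n - Y' n) + (X n - X' n) * Y' n) \<longlongrightarrow> 0) \<F>"
    using assms(1,2) unfolding asym_eq_def tendsto_Zfun_iff diff_0_right
    by (intro Zfun_add bounded_bilinear.Bfun_prod_Zfun[OF bounded_bilinear_mult]
        bounded_bilinear.Zfun_prod_Bfun[OF bounded_bilinear_mult] bf assms(3,4))
  then show ?thesis by (simp add: asym_eq_def algebra_simps)
qed

lemma asym_eq_context:
  fixes X :: "'i \<Rightarrow> 'a::real_normed_algebra"
  assumes "asym_eq \<F> X X'" "bounded_fun X" "bounded_fun X'" "bounded_fun P" "bounded_fun Q"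
  shows "asym_eq \<F> (\<lambda>n. P n * X n * Q n) (\<lambda>n. P n * X' n * Q n)"
  using assms by (intro asym_eq_mult) auto

lemma asym_eq_norm_le:
  assumes "\<And>n. norm (X n - Y n) \<le> f n" "(f \<longlongrightarrow> 0) \<F>"
  shows "asym_eq \<F> X Y"
  unfolding asym_eq_def using assms by (intro Lim_null_comparison[OF _ assms(2)]) auto

lemma asym_eq_eventually:
  assumes "asym_eq \<F> X Y" "\<epsilon> > 0"
  shows "eventually (\<lambda>n. norm (X n - Y n) < \<epsilon>) \<F>"
  using assms tendstoD by (fastforce simp: asym_eq_def dist_norm)

lemma asym_eq_eventually_norm:
  assumes "asym_eq \<F> X Y" "\<epsilon> > 0" "eventually (\<lambda>n. norm (Y n) \<le> M) \<F>"
  shows "eventually (\<lambda>n. norm (X n) \<le> M + \<epsilon>) \<F>"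
  using asym_eq_eventually[OF assms(1,2)] assms(3)
  by eventually_elim (smt (verit) norm_triangle_sub)

section \<open>Norm estimates for sums of conjugates\<close>

context cstar_algebra
begin

text \<open>Conjugation preserves order, so the sum lies between -\<eta> V and \<eta> V. Unlike the
  triangle inequality, this bound does not grow with the number of summands, which matters because a
  finer partition of unity has more members.\<close>

lemma norm_sum_conjugates_sa:
  assumes pos: "\<And>b. pos (st b * b)" and c: "\<And>l. l \<in> L \<Longrightarrow> st (c l) = c l \<and> norm (c l) \<le> \<eta>" and \<eta>: "\<eta> \<ge> 0"
  shows "norm (\<Sum>l\<in>L. st (v l) * c l * v l) \<le> \<eta> * norm (\<Sum>l\<in>L. st (v l) * v l)"
proof -
  define V where "V = (\<Sum>l\<in>L. st (v l) * v l)"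
  define S where "S = (\<Sum>l\<in>L. st (v l) * c l * v l)"
  have conj: "pos (st w * a * w)" if a: "pos a" for a w
  proof -
    obtain u where "st u = u" "a = u * u" using a by (auto simp: pos_def)
    then show ?thesis using pos[of "u * w"] by (simp add: st_mult mult.assoc)
  qed
  have "pos V" unfolding V_def by (intro pos_sum pos)
  then have sV: "st V = V" using posD by blast
  have V: "pos (\<eta> *\<^sub>R (norm V *\<^sub>R 1 - V))" by (intro pos_scaleR pos_norm_minus_sa sV order_refl \<eta>)
  have "pos (\<eta> *\<^sub>R (norm V *\<^sub>R 1 - V) + (\<Sum>l\<in>L. st (v l) * (\<eta> *\<^sub>R 1 - c l) * v l))"
    using c by (intro pos_add V pos_sum conj pos_norm_minus_sa) auto
  also have "\<eta> *\<^sub>R (norm V *\<^sub>R 1 - V) + (\<Sum>l\<in>L. st (v l) * (\<eta> *\<^sub>R 1 - c l) * v l)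
      = (\<eta> * norm V) *\<^sub>R 1 - S"
    by (simp add: V_def S_def algebra_simps sum_subtractf scaleR_sum_right)
  finally have 1: "pos ((\<eta> * norm V) *\<^sub>R 1 - S)" .
  have "pos (\<eta> *\<^sub>R (norm V *\<^sub>R 1 - V) + (\<Sum>l\<in>L. st (v l) * (\<eta> *\<^sub>R 1 + c l) * v l))"
    using c by (intro pos_add V pos_sum conj pos_norm_minus_sa) auto
  also have "\<eta> *\<^sub>R (norm V *\<^sub>R 1 - V) + (\<Sum>l\<in>L. st (v l) * (\<eta> *\<^sub>R 1 + c l) * v l)
      = (\<eta> * norm V) *\<^sub>R 1 + S"
    by (simp add: V_def S_def algebra_simps sum.distrib scaleR_sum_right)
  finally have 2: "pos ((\<eta> * norm V) *\<^sub>R 1 + S)" .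
  have "st S = S" using c by (auto simp: S_def st_sum st_mult mult.assoc intro: sum.cong)
  then show ?thesis using norm_le_of_pos[OF _ 1 2] \<eta> by (simp add: S_def V_def)
qed

lemma norm_sum_conjugates:
  assumes pos: "\<And>b. pos (st b * b)" and c: "\<And>l. l \<in> L \<Longrightarrow> norm (c l) \<le> \<eta>" and \<eta>: "\<eta> \<ge> 0"
  shows "norm (\<Sum>l\<in>L. st (v l) * c l * v l) \<le> 2 * \<eta> * norm (\<Sum>l\<in>L. st (v l) * v l)"
proof -
  \<comment> \<open>Real and imaginary parts of the coefficients; using both costs the factor
    2.\<close>
  define re im where "re l = (1/2) *\<^sub>R (c l + st (c l))" and "im l = sc (-\<i>) ((1/2) *\<^sub>R (c l - st (c l)))" for l
  have re: "st (re l) = re l \<and> norm (re l) \<le> \<eta>" if "l \<in> L" for l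
    using c[OF that] norm_triangle_ineq[of "c l" "st (c l)"] by (simp add: re_def st_scaleR st_add add.commute)
  have im: "st (im l) = im l \<and> norm (im l) \<le> \<eta>" if "l \<in> L" for l
  proof
    have "st (im l) = sc \<i> ((1/2) *\<^sub>R (st (c l) - c l))" by (simp add: im_def st_sc st_scaleR st_diff)
    also have "\<dots> = sc \<i> (sc (-1) ((1/2) *\<^sub>R (c l - st (c l))))" by (simp add: sc_minus_one algebra_simps)
    finally show "st (im l) = im l" by (simp add: sc_sc im_def)
    show "norm (im l) \<le> \<eta>"
      using c[OF that] norm_triangle_ineq4[of "c l" "st (c l)"] by (simp add: im_def norm_sc)
  qed
  have "c l = re l + sc \<i> (im l)" for l
    by (simp add: re_def im_def sc_sc algebra_simps flip: scaleR_left.add)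
  then have "(\<Sum>l\<in>L. st (v l) * c l * v l) = (\<Sum>l\<in>L. st (v l) * re l * v l + sc \<i> (st (v l) * im l * v l))"
    by (intro sum.cong refl) (metis (no_types, lifting) distrib_left distrib_right sc_mult_left sc_mult_right)
  also have "\<dots> = (\<Sum>l\<in>L. st (v l) * re l * v l) + sc \<i> (\<Sum>l\<in>L. st (v l) * im l * v l)"
    by (induction L rule: infinite_finite_induct) (auto simp: sc_add_right)
  also have "norm \<dots> \<le> \<eta> * norm (\<Sum>l\<in>L. st (v l) * v l) + \<eta> * norm (\<Sum>l\<in>L. st (v l) * v l)"
    using norm_sum_conjugates_sa[OF pos re \<eta>] norm_sum_conjugates_sa[OF pos im \<eta>]
    by (intro norm_triangle_le add_mono) (simp_all add: norm_sc)
  finally show ?thesis by simp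
qed

lemma asym_eq_st: "asym_eq \<F> X Y \<Longrightarrow> asym_eq \<F> (\<lambda>n. st (X n)) (\<lambda>n. st (Y n))"
  using bounded_linear.tendsto_zero[OF bounded_linear_st] by (fastforce simp: asym_eq_def st_diff)

lemma asym_eq_sc: "asym_eq \<F> X Y \<Longrightarrow> asym_eq \<F> (\<lambda>n. sc c (X n)) (\<lambda>n. sc c (Y n))"
  unfolding asym_eq_def
  by (rule tendsto_norm_zero_cancel)
    (auto simp: norm_sc tendsto_norm_zero tendsto_mult_right_zero simp flip: sc_diff_right)

lemma bounded_fun_st: "bounded_fun X \<Longrightarrow> bounded_fun (\<lambda>n. st (X n))"
  by (auto simp: bounded_fun_def)

text \<open>Two families \<open>x\<close>, \<open>y\<close> behaving like partitions of unity \<open>\<Sum>x\<^sub>i\<^sup>2 = \<Sum>y\<^sub>j\<^sup>2 = p\<close>, asymptotically along a filter.\<close>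

lemma expand_conjugates:
  fixes X :: "'j \<Rightarrow> 'i \<Rightarrow> 'a" and Y :: "'k \<Rightarrow> 'i \<Rightarrow> 'a"
  assumes bX: "\<And>i. i \<in> I \<Longrightarrow> bounded_fun (X i)" and bY: "\<And>j. j \<in> J \<Longrightarrow> bounded_fun (Y j)" and bP: "bounded_fun P"
    and PX: "\<And>i n. i \<in> I \<Longrightarrow> P n * X i n = X i n"
    and sumY: "asym_eq \<F> (\<lambda>n. \<Sum>j\<in>J. Y j n * Y j n) P"
    and comm: "\<And>i j. i \<in> I \<Longrightarrow> j \<in> J \<Longrightarrow> asym_eq \<F> (\<lambda>n. c i * Y j n) (\<lambda>n. Y j n * c i)"
  shows "asym_eq \<F> (\<lambda>n. \<Sum>i\<in>I. X i n * c i * X i n)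
    (\<lambda>n. \<Sum>i\<in>I. \<Sum>j\<in>J. X i n * Y j n * c i * (Y j n * X i n))"
proof (rule asym_eq_sum)
  fix i assume i: "i \<in> I"
  \<comment> \<open>\<open>P\<close> acts as a unit on \<open>X i\<close>, so it may be inserted,
    replaced by the sum of the squares of the \<open>Y j\<close>, and one factor \<open>Y j\<close>
    moved past \<open>c i\<close>.\<close>
  have "(\<lambda>n. X i n * c i * X i n) = (\<lambda>n. (X i n * c i) * P n * X i n)"
    using PX[OF i] by (simp add: mult.assoc)
  also have "asym_eq \<F> \<dots> (\<lambda>n. (X i n * c i) * (\<Sum>j\<in>J. Y j n * Y j n) * X i n)"
    using bX[OF i] bY bP by (intro asym_eq_context asym_eq_sym[OF sumY] bounded_fun_sum bounded_fun_mult bounded_fun_const)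
  also have "\<dots> = (\<lambda>n. \<Sum>j\<in>J. X i n * (c i * Y j n) * (Y j n * X i n))"
    by (simp add: sum_distrib_left sum_distrib_right mult.assoc)
  also have "asym_eq \<F> \<dots> (\<lambda>n. \<Sum>j\<in>J. X i n * (Y j n * c i) * (Y j n * X i n))"
    using bX[OF i] bY comm[OF i] by (intro asym_eq_sum asym_eq_context) auto
  finally show "asym_eq \<F> (\<lambda>n. X i n * c i * X i n) (\<lambda>n. \<Sum>j\<in>J. X i n * Y j n * c i * (Y j n * X i n))"
    by (simp add: mult.assoc)
qed

text \<open>Coefficients above \<eta> in norm may be set to zero, since their conjugators vanish
  asymptotically. For the rest, the conjugators \<open>v = Y j * X i\<close> satisfy that the sum of
  \<open>st v * v\<close> tends to \<open>P\<close>, hence has norm at most 2 eventually. This gives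
  4 \<eta>, and the fifth \<eta> absorbs the asymptotic error.\<close>

lemma double_conjugates_small:
  fixes X :: "'j \<Rightarrow> 'i \<Rightarrow> 'a" and Y :: "'k \<Rightarrow> 'i \<Rightarrow> 'a"
  assumes pos: "\<And>b. pos (st b * b)"
    and bX: "\<And>i. i \<in> I \<Longrightarrow> bounded_fun (X i)" and bY: "\<And>j. j \<in> J \<Longrightarrow> bounded_fun (Y j)" and bP: "\<And>n. norm (P n) \<le> 1"
    and sX: "\<And>i n. i \<in> I \<Longrightarrow> st (X i n) = X i n" and sY: "\<And>j n. j \<in> J \<Longrightarrow> st (Y j n) = Y j n"
    and PX: "\<And>i n. i \<in> I \<Longrightarrow> P n * X i n = X i n"
    and sumX: "asym_eq \<F> (\<lambda>n. \<Sum>i\<in>I. X i n * X i n) P"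
    and sumY: "asym_eq \<F> (\<lambda>n. \<Sum>j\<in>J. Y j n * Y j n) P"
    and small: "\<And>i j. i \<in> I \<Longrightarrow> j \<in> J \<Longrightarrow> norm (d i j) \<le> \<eta> \<or> asym_eq \<F> (\<lambda>n. Y j n * X i n) (\<lambda>_. 0)"
    and fin: "finite I" "finite J" and \<eta>: "\<eta> > 0"
  shows "eventually (\<lambda>n. norm (\<Sum>i\<in>I. \<Sum>j\<in>J. X i n * Y j n * d i j * (Y j n * X i n)) \<le> 5 * \<eta>) \<F>"
proof -
  define d' where "d' i j = (if norm (d i j) \<le> \<eta> then d i j else 0)" for i j
  define v where "v n l = Y (snd l) n * X (fst l) n" for n l
  have bP': "bounded_fun P" using bP bounded_funI by blast
  have "asym_eq \<F> (\<lambda>n. \<Sum>i\<in>I. X i n * 1 * X i n) (\<lambda>n. \<Sum>i\<in>I. \<Sum>j\<in>J. X i n * Y j n * 1 * (Y j n * X i n))"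
    by (rule expand_conjugates[OF bX bY bP' PX sumY]) auto
  moreover have "(\<Sum>i\<in>I. \<Sum>j\<in>J. X i n * Y j n * 1 * (Y j n * X i n)) = (\<Sum>l\<in>I\<times>J. st (v n l) * v n l)" for n
    unfolding sum.cartesian_product by (intro sum.cong refl) (auto simp: v_def st_mult sX sY)
  ultimately have "asym_eq \<F> (\<lambda>n. \<Sum>l\<in>I\<times>J. st (v n l) * v n l) P"
    using asym_eq_trans[OF asym_eq_sym sumX] by simp
  then have V: "eventually (\<lambda>n. norm (\<Sum>l\<in>I\<times>J. st (v n l) * v n l) \<le> 1 + 1) \<F>"
    by (rule asym_eq_eventually_norm) (auto simp: bP)
  have "eventually (\<lambda>n. norm (\<Sum>i\<in>I. \<Sum>j\<in>J. X i n * Y j n * d' i j * (Y j n * X i n)) \<le> 4 * \<eta>) \<F>"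
    using V
  proof eventually_elim
    case (elim n)
    have "(\<Sum>i\<in>I. \<Sum>j\<in>J. X i n * Y j n * d' i j * (Y j n * X i n))
        = (\<Sum>l\<in>I\<times>J. st (v n l) * d' (fst l) (snd l) * v n l)"
      unfolding sum.cartesian_product by (intro sum.cong refl) (auto simp: v_def st_mult sX sY)
    also have "norm \<dots> \<le> 2 * \<eta> * norm (\<Sum>l\<in>I\<times>J. st (v n l) * v n l)"
      using \<eta> by (intro norm_sum_conjugates pos) (auto simp: d'_def)
    also have "\<dots> \<le> 2 * \<eta> * 2" using elim \<eta> by (intro mult_left_mono) auto
    finally show ?case by simp
  qed
  moreover have "asym_eq \<F> (\<lambda>n. \<Sum>i\<in>I. \<Sum>j\<in>J. X i n * Y j n * d i j * (Y j n * X i n))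
      (\<lambda>n. \<Sum>i\<in>I. \<Sum>j\<in>J. X i n * Y j n * d' i j * (Y j n * X i n))"
  proof (intro asym_eq_sum)
    fix i j assume ij: "i \<in> I" "j \<in> J"
    show "asym_eq \<F> (\<lambda>n. X i n * Y j n * d i j * (Y j n * X i n)) (\<lambda>n. X i n * Y j n * d' i j * (Y j n * X i n))"
    proof (cases "norm (d i j) \<le> \<eta>")
      case False
      then have "asym_eq \<F> (\<lambda>n. Y j n * X i n) (\<lambda>_. 0)" using small[OF ij] by blast
      then have "asym_eq \<F> (\<lambda>n. X i n * Y j n * d i j * (Y j n * X i n)) (\<lambda>n. X i n * Y j n * d i j * 0)"
        using bX[OF ij(1)] bY[OF ij(2)] by (intro asym_eq_mult asym_eq_refl) auto
      then show ?thesis using False by (simp add: d'_def)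
    qed (simp add: d'_def)
  qed
  ultimately have "eventually (\<lambda>n. norm (\<Sum>i\<in>I. \<Sum>j\<in>J. X i n * Y j n * d i j * (Y j n * X i n)) \<le> 4 * \<eta> + \<eta>) \<F>"
    by (intro asym_eq_eventually_norm[OF _ \<eta>])
  then show ?thesis by simp
qed

text \<open>Over the common refinement by the products of \<open>X i\<close> and \<open>Y j\<close>,
  both sums have the same conjugators, and only \<open>c i - d j\<close> for pairs that overlap
  matters. It is applied with \<open>Y\<close> a translate of \<open>X\<close> by a group element,
  which yields almost invariance.\<close>

lemma conjugates_compare:
  fixes X :: "'j \<Rightarrow> 'i \<Rightarrow> 'a" and Y :: "'k \<Rightarrow> 'i \<Rightarrow> 'a"
  assumes pos: "\<And>b. pos (st b * b)"
    and bX: "\<And>i. i \<in> I \<Longrightarrow> bounded_fun (X i)" and bY: "\<And>j. j \<in> J \<Longrightarrow> bounded_fun (Y j)" and bP: "\<And>n. norm (P n) \<le> 1"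
    and sX: "\<And>i n. i \<in> I \<Longrightarrow> st (X i n) = X i n" and sY: "\<And>j n. j \<in> J \<Longrightarrow> st (Y j n) = Y j n"
    and PX: "\<And>i n. i \<in> I \<Longrightarrow> P n * X i n = X i n" and PY: "\<And>j n. j \<in> J \<Longrightarrow> P n * Y j n = Y j n"
    and sumX: "asym_eq \<F> (\<lambda>n. \<Sum>i\<in>I. X i n * X i n) P"
    and sumY: "asym_eq \<F> (\<lambda>n. \<Sum>j\<in>J. Y j n * Y j n) P"
    and XY: "\<And>i j. i \<in> I \<Longrightarrow> j \<in> J \<Longrightarrow> asym_eq \<F> (\<lambda>n. X i n * Y j n) (\<lambda>n. Y j n * X i n)"
    and Yc: "\<And>i j. i \<in> I \<Longrightarrow> j \<in> J \<Longrightarrow> asym_eq \<F> (\<lambda>n. c i * Y j n) (\<lambda>n. Y j n * c i)"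
    and Xd: "\<And>i j. i \<in> I \<Longrightarrow> j \<in> J \<Longrightarrow> asym_eq \<F> (\<lambda>n. d j * X i n) (\<lambda>n. X i n * d j)"
    and small: "\<And>i j. i \<in> I \<Longrightarrow> j \<in> J \<Longrightarrow> norm (c i - d j) \<le> \<eta> \<or> asym_eq \<F> (\<lambda>n. Y j n * X i n) (\<lambda>_. 0)"
    and fin: "finite I" "finite J" and \<eta>: "\<eta> > 0"
  shows "eventually (\<lambda>n. norm ((\<Sum>i\<in>I. X i n * c i * X i n) - (\<Sum>j\<in>J. Y j n * d j * Y j n)) \<le> 6 * \<eta>) \<F>"
proof -
  have bP': "bounded_fun P" using bP bounded_funI by blast
  have "asym_eq \<F> (\<lambda>n. \<Sum>j\<in>J. Y j n * d j * Y j n) (\<lambda>n. \<Sum>j\<in>J. \<Sum>i\<in>I. Y j n * X i n * d j * (X i n * Y j n))"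
    by (rule expand_conjugates[OF bY bX bP' PY sumX Xd])
  also have "asym_eq \<F> \<dots> (\<lambda>n. \<Sum>j\<in>J. \<Sum>i\<in>I. X i n * Y j n * d j * (Y j n * X i n))"
    by (intro asym_eq_sum asym_eq_mult asym_eq_refl XY asym_eq_sym[OF XY] bounded_fun_mult bounded_fun_const bX bY)
  also have "\<dots> = (\<lambda>n. \<Sum>i\<in>I. \<Sum>j\<in>J. X i n * Y j n * d j * (Y j n * X i n))"
    by (rule ext) (rule sum.swap)
  finally have 1: "asym_eq \<F> (\<lambda>n. \<Sum>j\<in>J. Y j n * d j * Y j n)
    (\<lambda>n. \<Sum>i\<in>I. \<Sum>j\<in>J. X i n * Y j n * d j * (Y j n * X i n))" .
  have "asym_eq \<F> (\<lambda>n. (\<Sum>i\<in>I. X i n * c i * X i n) - (\<Sum>j\<in>J. Y j n * d j * Y j n))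
    (\<lambda>n. (\<Sum>i\<in>I. \<Sum>j\<in>J. X i n * Y j n * c i * (Y j n * X i n)) -
      (\<Sum>i\<in>I. \<Sum>j\<in>J. X i n * Y j n * d j * (Y j n * X i n)))"
    by (intro asym_eq_diff 1 expand_conjugates[OF bX bY bP' PX sumY Yc])
  also have "\<dots> = (\<lambda>n. \<Sum>i\<in>I. \<Sum>j\<in>J. X i n * Y j n * (c i - d j) * (Y j n * X i n))"
    by (simp add: algebra_simps sum_subtractf)
  finally have "eventually (\<lambda>n. norm ((\<Sum>i\<in>I. X i n * c i * X i n) - (\<Sum>j\<in>J. Y j n * d j * Y j n)) \<le> 5 * \<eta> + \<eta>) \<F>"
    by (rule asym_eq_eventually_norm[OF _ \<eta>])
      (rule double_conjugates_small[OF pos bX bY bP sX sY PX sumX sumY small fin \<eta>])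
  then show ?thesis by simp
qed

text \<open>The common refinement of \<open>X\<close> with itself turns the product into a double
  sum with coefficients \<open>a i * b j\<close>, to be compared with \<open>a i * b i\<close>; the
  two differ little wherever \<open>X j * X i\<close> survives.\<close>

lemma conjugates_multiplicative:
  fixes X :: "'j \<Rightarrow> 'i \<Rightarrow> 'a"
  assumes pos: "\<And>b. pos (st b * b)"
    and bX: "\<And>i. i \<in> I \<Longrightarrow> bounded_fun (X i)" and bP: "\<And>n. norm (P n) \<le> 1"
    and sX: "\<And>i n. i \<in> I \<Longrightarrow> st (X i n) = X i n"
    and PX: "\<And>i n. i \<in> I \<Longrightarrow> P n * X i n = X i n"
    and sumX: "asym_eq \<F> (\<lambda>n. \<Sum>i\<in>I. X i n * X i n) P"
    and XX: "\<And>i j. i \<in> I \<Longrightarrow> j \<in> I \<Longrightarrow> asym_eq \<F> (\<lambda>n. X i n * X j n) (\<lambda>n. X j n * X i n)"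
    and Xa: "\<And>i j. i \<in> I \<Longrightarrow> j \<in> I \<Longrightarrow> asym_eq \<F> (\<lambda>n. a i * X j n) (\<lambda>n. X j n * a i)"
    and Xb: "\<And>i j. i \<in> I \<Longrightarrow> j \<in> I \<Longrightarrow> asym_eq \<F> (\<lambda>n. b i * X j n) (\<lambda>n. X j n * b i)"
    and small: "\<And>i j. i \<in> I \<Longrightarrow> j \<in> I \<Longrightarrow> norm (a i * (b j - b i)) \<le> \<eta> \<or> asym_eq \<F> (\<lambda>n. X j n * X i n) (\<lambda>_. 0)"
    and fin: "finite I" and \<eta>: "\<eta> > 0"
  shows "eventually (\<lambda>n. norm ((\<Sum>i\<in>I. X i n * a i * X i n) * (\<Sum>i\<in>I. X i n * b i * X i n)
    - (\<Sum>i\<in>I. X i n * (a i * b i) * X i n)) \<le> 6 * \<eta>) \<F>"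
proof -
  have bP': "bounded_fun P" using bP bounded_funI by blast
  have Xab: "asym_eq \<F> (\<lambda>n. (a i * b i) * X j n) (\<lambda>n. X j n * (a i * b i))" if "i \<in> I" "j \<in> I" for i j
  proof -
    have "asym_eq \<F> (\<lambda>n. a i * (b i * X j n)) (\<lambda>n. a i * (X j n * b i))"
      using that bX by (intro asym_eq_mult asym_eq_refl Xb) auto
    also have "\<dots> = (\<lambda>n. a i * X j n * b i)" by (simp add: mult.assoc)
    also have "asym_eq \<F> \<dots> (\<lambda>n. X j n * a i * b i)"
      using that bX by (intro asym_eq_mult asym_eq_refl Xa) auto
    finally show ?thesis by (simp add: mult.assoc)
  qed
  have summand: "asym_eq \<F> (\<lambda>n. (X i n * a i * X i n) * (X j n * b j * X j n)) (\<lambda>n. X i n * X j n * (a i * b j) * (X j n * X i n))"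
    if ij: "i \<in> I" "j \<in> I" for i j
  proof -
    note b = bX[OF ij(1)] bX[OF ij(2)]
    have "(\<lambda>n. (X i n * a i * X i n) * (X j n * b j * X j n)) = (\<lambda>n. (X i n * a i) * (X i n * X j n) * (b j * X j n))"
      by (simp add: mult.assoc)
    also have "asym_eq \<F> \<dots> (\<lambda>n. (X i n * a i) * (X j n * X i n) * (b j * X j n))"
      by (intro asym_eq_context XX ij bounded_fun_mult bounded_fun_const b)
    also have "\<dots> = (\<lambda>n. X i n * (a i * X j n) * (X i n * b j * X j n))" by (simp add: mult.assoc)
    also have "asym_eq \<F> \<dots> (\<lambda>n. X i n * (X j n * a i) * (X i n * b j * X j n))"
      by (intro asym_eq_context Xa ij bounded_fun_mult bounded_fun_const b)
    also have "\<dots> = (\<lambda>n. (X i n * X j n * a i) * (X i n * b j) * X j n)" by (simp add: mult.assoc)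
    also have "asym_eq \<F> \<dots> (\<lambda>n. (X i n * X j n * a i) * (b j * X i n) * X j n)"
      by (intro asym_eq_context asym_eq_sym[OF Xb] ij bounded_fun_mult bounded_fun_const b)
    also have "\<dots> = (\<lambda>n. X i n * X j n * (a i * b j) * (X i n * X j n))" by (simp add: mult.assoc)
    also have "asym_eq \<F> \<dots> (\<lambda>n. X i n * X j n * (a i * b j) * (X j n * X i n))"
      by (intro asym_eq_mult asym_eq_refl XX ij bounded_fun_mult bounded_fun_const b)
    finally show ?thesis .
  qed
  have "(\<lambda>n. (\<Sum>i\<in>I. X i n * a i * X i n) * (\<Sum>i\<in>I. X i n * b i * X i n))
      = (\<lambda>n. \<Sum>i\<in>I. \<Sum>j\<in>I. (X i n * a i * X i n) * (X j n * b j * X j n))"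
    by (simp add: sum_product)
  also have "asym_eq \<F> \<dots> (\<lambda>n. \<Sum>i\<in>I. \<Sum>j\<in>I. X i n * X j n * (a i * b j) * (X j n * X i n))"
    by (intro asym_eq_sum summand)
  finally have 1: "asym_eq \<F> (\<lambda>n. (\<Sum>i\<in>I. X i n * a i * X i n) * (\<Sum>i\<in>I. X i n * b i * X i n))
    (\<lambda>n. \<Sum>i\<in>I. \<Sum>j\<in>I. X i n * X j n * (a i * b j) * (X j n * X i n))" .
  have "asym_eq \<F> (\<lambda>n. (\<Sum>i\<in>I. X i n * a i * X i n) * (\<Sum>i\<in>I. X i n * b i * X i n)
        - (\<Sum>i\<in>I. X i n * (a i * b i) * X i n))
    (\<lambda>n. (\<Sum>i\<in>I. \<Sum>j\<in>I. X i n * X j n * (a i * b j) * (X j n * X i n))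
        - (\<Sum>i\<in>I. \<Sum>j\<in>I. X i n * X j n * (a i * b i) * (X j n * X i n)))"
    by (intro asym_eq_diff 1 expand_conjugates[OF bX bX bP' PX sumX Xab])
  also have "\<dots> = (\<lambda>n. \<Sum>i\<in>I. \<Sum>j\<in>I. X i n * X j n * (a i * (b j - b i)) * (X j n * X i n))"
    by (simp add: algebra_simps sum_subtractf)
  finally have "eventually (\<lambda>n. norm ((\<Sum>i\<in>I. X i n * a i * X i n) * (\<Sum>i\<in>I. X i n * b i * X i n)
    - (\<Sum>i\<in>I. X i n * (a i * b i) * X i n)) \<le> 5 * \<eta> + \<eta>) \<F>"
    by (rule asym_eq_eventually_norm[OF _ \<eta>])
      (rule double_conjugates_small[OF pos bX bX bP sX sX PX sumX sumX small fin fin \<eta>])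
  then show ?thesis by simp
qed

end

section \<open>Ingredients from the tracial Rokhlin property\<close>

context cstar_system
begin

text \<open>The bump functions are built from the orbit maps themselves, so no appeal to Urysohn's lemma is needed.\<close>

lemma orbit_partition_of_unity:
  assumes F: "finite F" and \<eta>: "\<eta> > 0"
  obtains I u where "finite I" "\<And>i. continuous_on UNIV (u i)" "\<And>i g. 0 \<le> u i g" "\<And>i g. u i g \<le> 1"
    "\<And>g. (\<Sum>i\<in>I. (u i g)\<^sup>2) = (1::real)"
    "\<And>i g a. u i g \<noteq> 0 \<Longrightarrow> a \<in> F \<Longrightarrow> norm (\<alpha> g a - \<alpha> i a) < \<eta>"
proof -
  define h where "h i g = max 0 (\<eta> - (\<Sum>a\<in>F. norm (\<alpha> g a - \<alpha> i a)))" for i g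
  have h_cont: "continuous_on UNIV (h i)" for i
    unfolding h_def by (intro continuous_intros act_cont)
  have h_nonneg: "0 \<le> h i g" for i g by (simp add: h_def)
  have "open {g. h i g > 0}" for i
    by (intro open_Collect_less continuous_on_const h_cont)
  moreover have "UNIV \<subseteq> (\<Union>i\<in>UNIV. {g. h i g > 0})"
    using \<eta> by (auto simp: h_def intro!: exI[of _ "_::'g"])
  ultimately obtain I where I: "finite I" "UNIV \<subseteq> (\<Union>i\<in>I. {g. h i g > 0})"
    using compactE_image[OF compact_group] by (metis (no_types, lifting))
  define s where "s g = (\<Sum>i\<in>I. h i g)" for g
  have s_cont: "continuous_on UNIV s" unfolding s_def by (intro continuous_intros h_cont)
  have s_pos: "s g > 0" for g
  proof -
    obtain i where "i \<in> I" "h i g > 0" using I by auto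
    then show ?thesis unfolding s_def using I(1) h_nonneg by (intro sum_pos2)
  qed
  \<comment> \<open>For \<open>i\<close> outside \<open>I\<close> the quotient may exceed 1, so the
    minimum secures the bound for every index. The root is taken because the squares are to sum to
    1.\<close>
  define u where "u i g = sqrt (min 1 (h i g / s g))" for i g
  have le: "h i g / s g \<le> 1" if "i \<in> I" for i g
    using s_pos[of g] member_le_sum[OF that h_nonneg I(1)] by (simp add: s_def)
  show ?thesis
  proof (rule that[OF I(1), of u])
    show "continuous_on UNIV (u i)" for i
      unfolding u_def using s_pos by (intro continuous_intros h_cont s_cont) (auto simp: less_imp_neq[symmetric])
    show "0 \<le> u i g" "u i g \<le> 1" for i g
      using h_nonneg[of i g] s_pos[of g] by (auto simp: u_def)
    show "(\<Sum>i\<in>I. (u i g)\<^sup>2) = 1" for g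
    proof -
      have "(\<Sum>i\<in>I. (u i g)\<^sup>2) = (\<Sum>i\<in>I. h i g / s g)"
        using h_nonneg s_pos[of g] by (intro sum.cong) (auto simp: u_def min_absorb2[OF le])
      also have "\<dots> = 1" using s_pos[of g] by (simp add: s_def flip: sum_divide_distrib)
      finally show ?thesis .
    qed
    show "norm (\<alpha> g a - \<alpha> i a) < \<eta>" if "u i g \<noteq> 0" "a \<in> F" for i g a
    proof -
      have "h i g \<noteq> 0" using that by (auto simp: u_def)
      then have "(\<Sum>a\<in>F. norm (\<alpha> g a - \<alpha> i a)) < \<eta>" by (auto simp: h_def max_def split: if_splits)
      then show ?thesis using member_le_sum[OF that(2) _ F, of "\<lambda>a. norm (\<alpha> g a - \<alpha> i a)"] by simp
    qed
  qed
qed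

lemma Lt_cont:
  assumes "f \<in> CG" shows "continuous_on UNIV (\<lambda>(g, h). Lt mul iv g f h)"
proof -
  have mul: "continuous_on UNIV (\<lambda>(x, y). mul x y)" and iv: "continuous_on UNIV iv"
    using group by (auto simp: top_group_def)
  have "continuous_on UNIV (\<lambda>z::'g \<times> 'g. (iv (fst z), snd z))"
    by (intro continuous_on_Pair continuous_on_compose2[OF iv] continuous_on_fst continuous_on_snd continuous_on_id)
      auto
  then have "continuous_on UNIV (\<lambda>z. mul (iv (fst z)) (snd z))"
    using continuous_on_compose2[OF mul] by fastforce
  then show ?thesis
    using assms continuous_on_compose2[of UNIV f UNIV "\<lambda>z. mul (iv (fst z)) (snd z)"]
    by (simp add: CG_def Lt_def case_prod_beta)
qed

lemma Lt_CG: assumes "f \<in> CG" shows "Lt mul iv g f \<in> CG"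
proof -
  have "continuous_on UNIV (\<lambda>h::'g. (g, h))"
    by (intro continuous_on_Pair continuous_on_const continuous_on_id)
  from continuous_on_compose2[OF Lt_cont[OF assms] this] show ?thesis by (simp add: CG_def)
qed

text \<open>Uniform equicontinuity over the compact group. The Rokhlin property accepts only finite
  sets of functions and elements, so invariance under all of \<open>G\<close> is tested on a finite
  net whose translates are added to those sets.\<close>

lemma translation_net:
  assumes fs: "finite fs" "fs \<subseteq> CG" and E: "finite E" and \<delta>: "\<delta> > 0"
  obtains \<Gamma> where "finite \<Gamma>" "\<And>g. \<exists>\<gamma>\<in>\<Gamma>. (\<forall>f\<in>fs. \<forall>h. cmod (Lt mul iv g f h - Lt mul iv \<gamma> f h) \<le> \<delta>)
    \<and> (\<forall>a\<in>E. norm (\<alpha> g a - \<alpha> \<gamma> a) \<le> \<delta>)"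
proof -
  define Q where "Q \<gamma> g \<longleftrightarrow> (\<forall>f\<in>fs. \<forall>h. cmod (Lt mul iv g f h - Lt mul iv \<gamma> f h) \<le> \<delta>)
    \<and> (\<forall>a\<in>E. norm (\<alpha> g a - \<alpha> \<gamma> a) \<le> \<delta>)" for \<gamma> g
  have "eventually (Q \<gamma>) (nhds \<gamma>)" for \<gamma>
    unfolding Q_def
  proof (intro eventually_conj eventually_ball_finite fs E ballI)
    fix f assume "f \<in> fs"
    then have "continuous_on (UNIV \<times> UNIV) (\<lambda>(g, h). Lt mul iv g f h)" using Lt_cont fs by auto
    then obtain X0 where X0: "\<gamma> \<in> X0" "open X0"
      "\<forall>x\<in>X0 \<inter> UNIV. \<forall>t\<in>UNIV. dist (case (x, t) of (g, h) \<Rightarrow> Lt mul iv g f h) (case (\<gamma>, t) of (g, h) \<Rightarrow> Lt mul iv g f h) \<le> \<delta>"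
      using continuous_on_prod_compactE[OF _ compact_group UNIV_I \<delta>] by metis
    then show "eventually (\<lambda>g. \<forall>h. cmod (Lt mul iv g f h - Lt mul iv \<gamma> f h) \<le> \<delta>) (nhds \<gamma>)"
      unfolding eventually_nhds dist_norm by auto
  next
    fix a assume "a \<in> E"
    have "open {g. norm (\<alpha> g a - \<alpha> \<gamma> a) < \<delta>}"
      by (intro open_Collect_less continuous_intros act_cont)
    then show "eventually (\<lambda>g. norm (\<alpha> g a - \<alpha> \<gamma> a) \<le> \<delta>) (nhds \<gamma>)"
      unfolding eventually_nhds using \<delta> by (intro exI[of _ "{g. norm (\<alpha> g a - \<alpha> \<gamma> a) < \<delta>}"]) auto
  qed
  then have "\<forall>\<gamma>. \<exists>X. open X \<and> \<gamma> \<in> X \<and> (\<forall>g\<in>X. Q \<gamma> g)" unfolding eventually_nhds by blast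
  then obtain X where X: "\<And>\<gamma>. open (X \<gamma>)" "\<And>\<gamma>. \<gamma> \<in> X \<gamma>" "\<And>\<gamma> g. g \<in> X \<gamma> \<Longrightarrow> Q \<gamma> g" by metis
  have "UNIV \<subseteq> (\<Union>\<gamma>\<in>UNIV. X \<gamma>)" using X(2) by blast
  then obtain \<Gamma> where \<Gamma>: "finite \<Gamma>" "UNIV \<subseteq> (\<Union>\<gamma>\<in>\<Gamma>. X \<gamma>)"
    by (rule compactE_image[OF compact_group X(1)]) (rule that)
  show ?thesis
  proof (rule that[OF \<Gamma>(1)])
    fix g
    obtain \<gamma> where "\<gamma> \<in> \<Gamma>" "g \<in> X \<gamma>" using \<Gamma>(2) by blast
    then show "\<exists>\<gamma>\<in>\<Gamma>. (\<forall>f\<in>fs. \<forall>h. cmod (Lt mul iv g f h - Lt mul iv \<gamma> f h) \<le> \<delta>)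
        \<and> (\<forall>a\<in>E. norm (\<alpha> g a - \<alpha> \<gamma> a) \<le> \<delta>)"
      using X(3) unfolding Q_def by blast
  qed
qed

end

locale rokhlin_system = cstar_system sc st mul iv e \<alpha>
  for sc :: "complex \<Rightarrow> 'a::{real_normed_algebra_1,banach} \<Rightarrow> 'a" and st :: "'a \<Rightarrow> 'a"
    and mul :: "'g::topological_space \<Rightarrow> 'g \<Rightarrow> 'g" and iv e \<alpha> +
  assumes simple: "simple_alg sc" and trace_ex: "traces UNIV \<noteq> {}"
    and rokhlin: "tracial_rokhlin_comparison sc st mul iv \<alpha>"
begin

abbreviation "A\<alpha> \<equiv> fixed_points \<alpha>"

lemma pos_star: "pos (st b * b)"
  using trace_ex pos_st_mult[OF simple] by blast

section \<open>Unital completely positive maps into a corner\<close>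

lemma ucp_positive:
  fixes f :: "'g \<Rightarrow> real"
  assumes ucp: "ucp_corner sc st p \<psi>" and f: "continuous_on UNIV f" "\<And>g. f g \<ge> (0::real)"
  shows "pos (\<psi> (\<lambda>g. complex_of_real (f g)))"
proof -
  define M :: "nat \<Rightarrow> nat \<Rightarrow> 'g \<Rightarrow> complex" where "M i j = (\<lambda>g. complex_of_real (f g))" for i j
  have "CG_matpos 1 M"
    unfolding CG_matpos_def
    by (rule exI[of _ "\<lambda>_ _ g. complex_of_real (sqrt (f g))"])
      (use f in \<open>auto simp: M_def CG_def intro!: continuous_intros simp flip: of_real_mult\<close>)
  moreover have "M i j \<in> CG" for i j using f by (auto simp: M_def CG_def intro!: continuous_intros)
  ultimately have "A_matpos st 1 (\<lambda>i j. \<psi> (M i j))" using ucp unfolding ucp_corner_def by blast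
  then obtain B :: "nat \<Rightarrow> nat \<Rightarrow> 'a" where "\<psi> (M 0 0) = st (B 0 0) * B 0 0"
    unfolding A_matpos_def by fastforce
  then show ?thesis using pos_star by (simp add: M_def)
qed

lemma ucp_diff_const:
  fixes f :: "'g \<Rightarrow> complex"
  assumes ucp: "ucp_corner sc st p \<psi>" and f: "f \<in> CG"
  shows "\<psi> (\<lambda>g. c + f g) = sc c p + \<psi> f" "\<psi> (\<lambda>g. c - f g) = sc c p - \<psi> f"
proof -
  have c: "(\<lambda>_. c) \<in> CG" "(\<lambda>_::'g. 1::complex) \<in> CG" by (auto simp: CG_def)
  have add: "\<psi> (\<lambda>g. f1 g + f2 g) = \<psi> f1 + \<psi> f2" if "f1 \<in> CG" "f2 \<in> CG" for f1 f2
    using ucp that by (auto simp: ucp_corner_def)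
  have scal: "\<psi> (\<lambda>g. c * f1 g) = sc c (\<psi> f1)" if "f1 \<in> CG" for f1 c
    using ucp that by (auto simp: ucp_corner_def)
  have pc: "\<psi> (\<lambda>_. c) = sc c p" using scal[OF c(2), of c] ucp by (simp add: ucp_corner_def)
  show "\<psi> (\<lambda>g. c + f g) = sc c p + \<psi> f" using add[OF c(1) f] pc by simp
  have "(\<lambda>g. - f g) \<in> CG" using f by (auto simp: CG_def intro: continuous_intros)
  moreover have "\<psi> (\<lambda>g. - f g) = - \<psi> f" using scal[OF f, of "-1"] by (simp add: sc_minus_one)
  ultimately show "\<psi> (\<lambda>g. c - f g) = sc c p - \<psi> f" using add[OF c(1)] pc by fastforce
qed

lemma ucp_contractive:
  fixes f :: "'g \<Rightarrow> real"
  assumes ucp: "ucp_corner sc st p \<psi>" and p: "st p = p" "p * p = p"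
    and f: "continuous_on UNIV f" "\<And>g. \<bar>f g\<bar> \<le> M"
  shows "st (\<psi> (\<lambda>g. complex_of_real (f g))) = \<psi> (\<lambda>g. complex_of_real (f g))"
    "norm (\<psi> (\<lambda>g. complex_of_real (f g))) \<le> M"
proof -
  define x where "x = \<psi> (\<lambda>g. complex_of_real (f g))"
  have fc: "(\<lambda>g. complex_of_real (f g)) \<in> CG" using f by (auto simp: CG_def intro!: continuous_intros)
  have M: "M \<ge> 0" using f(2)[of undefined] by simp
  have "0 \<le> M + f g" "0 \<le> M - f g" for g using f(2)[of g] by linarith+
  then have "pos (\<psi> (\<lambda>g. complex_of_real (M + f g)))" "pos (\<psi> (\<lambda>g. complex_of_real (M - f g)))"
    by (intro ucp_positive[OF ucp] continuous_intros f(1); simp)+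
  then have pp: "pos (M *\<^sub>R p + x)" "pos (M *\<^sub>R p - x)"
    using ucp_diff_const[OF ucp fc, of "complex_of_real M"] by (simp_all add: x_def sc_of_real)
  then have "st (M *\<^sub>R p + x) = M *\<^sub>R p + x" using posD by blast
  then show sx: "st (\<psi> (\<lambda>g. complex_of_real (f g))) = \<psi> (\<lambda>g. complex_of_real (f g))"
    by (simp add: st_add st_scaleR p x_def)
  \<comment> \<open>The unit of the corner is \<open>p\<close>, so the bounds so far are relative to
    \<open>M *\<^sub>R p\<close>; adding the positive element \<open>M *\<^sub>R (1 - p)\<close>
    makes them relative to 1.\<close>
  have "1 - p = (1 - p) * (1 - p)" using p by (simp add: algebra_simps)
  then have "pos (M *\<^sub>R (1 - p))"
    using M pos_scaleR pos_square[of "1 - p"] p by (simp add: st_diff)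
  from pos_add[OF this pp(1)] pos_add[OF this pp(2)]
  have "pos (M *\<^sub>R 1 + x)" "pos (M *\<^sub>R 1 - x)" by (simp_all add: algebra_simps)
  then show "norm (\<psi> (\<lambda>g. complex_of_real (f g))) \<le> M"
    using norm_le_of_pos[of x M] sx M by (simp add: x_def)
qed

end

section \<open>The approximate homomorphism into the fixed point algebra\<close>

context rokhlin_system
begin

lemma ucp_linear:
  assumes ucp: "ucp_corner sc st p \<psi>"
  shows ucp_add: "f1 \<in> CG \<Longrightarrow> f2 \<in> CG \<Longrightarrow> \<psi> (\<lambda>g. f1 g + f2 g) = \<psi> f1 + \<psi> f2"
    and ucp_scale: "f1 \<in> CG \<Longrightarrow> \<psi> (\<lambda>g. c * f1 g) = sc c (\<psi> f1)"
    and ucp_one: "\<psi> (\<lambda>_. 1) = p"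
  using ucp by (auto simp: ucp_corner_def)

lemma ucp_zero: assumes ucp: "ucp_corner sc st p \<psi>" shows "\<psi> (\<lambda>_::'g. 0) = 0"
  using ucp_scale[OF ucp, of "\<lambda>_. 0" 0] by (simp add: CG_def)

lemma ucp_diff:
  assumes ucp: "ucp_corner sc st p \<psi>" and f: "f1 \<in> CG" "f2 \<in> CG"
  shows "\<psi> (\<lambda>g::'g. f1 g - f2 g) = \<psi> f1 - \<psi> f2"
proof -
  have "(\<lambda>g. - 1 * f2 g) \<in> CG" using f by (auto simp: CG_def intro!: continuous_intros)
  from ucp_add[OF ucp f(1) this] show ?thesis using ucp_scale[OF ucp f(2), of "-1"] by (simp add: sc_minus_one)
qed

lemma ucp_sum:
  assumes ucp: "ucp_corner sc st p \<psi>" and f: "\<And>i. i \<in> I \<Longrightarrow> f i \<in> CG" and I: "finite I"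
  shows "\<psi> (\<lambda>g::'g. \<Sum>i\<in>I. f i g) = (\<Sum>i\<in>I. \<psi> (f i))"
  using I f
proof (induction I)
  case (insert i I)
  have "(\<lambda>g. \<Sum>i\<in>I. f i g) \<in> CG" using insert by (auto simp: CG_def intro!: continuous_intros)
  with insert ucp_add[OF ucp, of "f i"] show ?case by simp
qed (simp add: ucp_zero[OF ucp])

lemma ucp_corner_unit:
  assumes ucp: "ucp_corner sc st p \<psi>" and p: "p * p = p" and f: "f \<in> CG"
  shows "p * \<psi> f = \<psi> f" "\<psi> f * p = \<psi> f"
proof -
  obtain a where "\<psi> f = p * a * p" using ucp f by (auto simp: ucp_corner_def)
  then show "p * \<psi> f = \<psi> f" "\<psi> f * p = \<psi> f" using p by (metis mult.assoc)+
qed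

text \<open>For fixed data the tolerance runs through \<open>1 / (n + 1)\<close>, so that later
  estimates become statements about limits and a single \<open>n\<close> is fixed only at the end.
  The norm-one test element is taken to be 1.\<close>

lemma rokhlin_sequence:
  assumes E: "finite E" and S: "finite S" "S \<subseteq> CG" and y: "positive_in st A\<alpha> y" "y \<noteq> 0"
  obtains p \<psi> where
    "\<And>n. projection_in st A\<alpha> (p n)" "\<And>n. ucp_corner sc st (p n) (\<psi> n)"
    "\<And>n. cuntz_below st A\<alpha> (1 - p n) y" "\<And>n. cuntz_below st A\<alpha> (1 - p n) (p n)"
    "\<And>n f1 f2. f1 \<in> S \<Longrightarrow> f2 \<in> S \<Longrightarrow> norm (\<psi> n (\<lambda>g. f1 g * f2 g) - \<psi> n f1 * \<psi> n f2) \<le> inverse (real (Suc n))"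
    "\<And>n f a. f \<in> S \<Longrightarrow> a \<in> E \<Longrightarrow> norm (\<psi> n f * a - a * \<psi> n f) \<le> inverse (real (Suc n))"
    "\<And>n f g. f \<in> S \<Longrightarrow> norm (\<psi> n (Lt mul iv g f) - \<alpha> g (\<psi> n f)) \<le> inverse (real (Suc n))"
proof -
  have one: "positive_in st UNIV 1" unfolding positive_in_def by (rule bexI[of _ 1]) auto
  define R where "R n p \<psi> \<longleftrightarrow> projection_in st A\<alpha> p \<and> ucp_corner sc st p \<psi> \<and> cuntz_below st A\<alpha> (1 - p) y
      \<and> cuntz_below st A\<alpha> (1 - p) p
      \<and> (\<forall>f1\<in>S. \<forall>f2\<in>S. norm (\<psi> (\<lambda>g. f1 g * f2 g) - \<psi> f1 * \<psi> f2) < inverse (real (Suc n)))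
      \<and> (\<forall>f\<in>S. \<forall>a\<in>E. norm (\<psi> f * a - a * \<psi> f) < inverse (real (Suc n)))
      \<and> (\<forall>f\<in>S. \<exists>\<delta><inverse (real (Suc n)). \<forall>g. norm (\<psi> (Lt mul iv g f) - \<alpha> g (\<psi> f)) \<le> \<delta>)"
    for n p \<psi>
  have "\<exists>p \<psi>. R n p \<psi>" for n
  proof -
    have "inverse (real (Suc n)) > 0" by simp
    from rokhlin[unfolded tracial_rokhlin_comparison_def, rule_format, OF this E S one norm_one y]
    show ?thesis unfolding R_def by (elim exE conjE) (intro exI conjI; assumption)
  qed
  then obtain p \<psi> where "\<And>n. R n (p n) (\<psi> n)" by metis
  note H = this[unfolded R_def]
  show ?thesis
  proof (rule that[of p \<psi>])
    fix n f g assume "f \<in> S"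
    then obtain \<delta> where "\<delta> < inverse (real (Suc n))" "\<forall>g. norm (\<psi> n (Lt mul iv g f) - \<alpha> g (\<psi> n f)) \<le> \<delta>"
      using H[of n] by blast
    then show "norm (\<psi> n (Lt mul iv g f) - \<alpha> g (\<psi> n f)) \<le> inverse (real (Suc n))"
      by (meson less_imp_le order_trans)
  qed (use H in \<open>simp_all del: of_nat_Suc add: less_imp_le\<close>)
qed

text \<open>If \<open>(u\<^sub>i\<^sup>2)\<close> is a fine partition of unity on \<open>G\<close> around points \<open>i \<in> G\<close> and \<open>x\<^sub>i = \<psi>(u\<^sub>i)\<close>, then
  \<open>\<phi>(a) = \<Sum>x\<^sub>i \<alpha>\<^sub>i(a) x\<^sub>i\<close> is almost multiplicative, because \<open>x\<^sub>i x\<^sub>j \<approx> 0\<close> unless \<open>i\<close> and \<open>j\<close> are close,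
  and almost invariant, because translating by \<open>g\<close> only changes the partition.\<close>

lemma rokhlin_approx_hom:
  assumes F: "finite F" and \<epsilon>: "\<epsilon> > 0" and y: "positive_in st A\<alpha> y" "y \<noteq> 0"
  shows "\<exists>p \<phi>. projection_in st A\<alpha> p \<and> cuntz_below st A\<alpha> (1 - p) y \<and> cuntz_below st A\<alpha> (1 - p) p \<and>
    (\<forall>x y. \<phi> (x + y) = \<phi> x + \<phi> y) \<and> (\<forall>c x. \<phi> (sc c x) = sc c (\<phi> x)) \<and> (\<forall>x. \<phi> (st x) = st (\<phi> x)) \<and>
    (\<forall>x. norm (\<phi> x) \<le> 4 * norm x) \<and> (\<forall>a\<in>F. \<forall>b\<in>F. norm (\<phi> a * \<phi> b - \<phi> (a * b)) \<le> \<epsilon>) \<and>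
    norm (\<phi> 1 - p) \<le> \<epsilon> \<and> (\<forall>a\<in>F \<inter> A\<alpha>. norm (\<phi> a - a * p) \<le> \<epsilon>) \<and>
    (\<forall>a\<in>F. \<forall>g. norm (\<alpha> g (\<phi> a) - \<phi> a) \<le> \<epsilon>)"
proof -
  define K where "K = 1 + (\<Sum>a\<in>F. norm a)"
  have K1: "K \<ge> 1" by (simp add: K_def sum_nonneg)
  have K: "norm a \<le> K" if "a \<in> F" for a
    using member_le_sum[OF that _ F, of norm] by (simp add: K_def)
  \<comment> \<open>With 40 in the denominator, the multiplicativity error
    \<open>12 * (K * \<eta>)\<close> stays below \<epsilon> and the invariance error
    \<open>12 * \<eta>\<close> below \<epsilon> / 3.\<close>
  define \<eta> where "\<eta> = \<epsilon> / (40 * K)"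
  have \<eta>: "\<eta> > 0" "K * \<eta> = \<epsilon> / 40" "\<eta> \<le> \<epsilon> / 40"
    using \<epsilon> K1 by (auto simp: \<eta>_def divide_simps mult_le_cancel_right1)
  obtain I u where I: "finite I" and u_cont: "\<And>i. continuous_on UNIV (u i)"
    and u_bd: "\<And>i g. 0 \<le> u i g" "\<And>i g. u i g \<le> 1" and u_sum: "\<And>g. (\<Sum>i\<in>I. (u i g)\<^sup>2) = (1::real)"
    and u_supp: "\<And>i g a. u i g \<noteq> 0 \<Longrightarrow> a \<in> F \<Longrightarrow> norm (\<alpha> g a - \<alpha> i a) < \<eta>"
    using orbit_partition_of_unity[OF F \<eta>(1)] by metis
  define U where "U i = (\<lambda>g. complex_of_real (u i g))" for i
  have U: "U i \<in> CG" for i using u_cont by (auto simp: U_def CG_def intro!: continuous_intros)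
  define F2 where "F2 = F \<union> (\<lambda>(a, b). a * b) ` (F \<times> F)"
  define E0 where "E0 = (\<lambda>(i, a). \<alpha> i a) ` (I \<times> F2)"
  define N where "N = real (card I) + 1"
  \<comment> \<open>Chosen so that the passage from \<open>g\<close> to the net costs at most
    \<open>N * (3 * K * \<delta>) = 3 * \<epsilon> / 8\<close> in the limit, which is below
    \<epsilon> / 2.\<close>
  define \<delta> where "\<delta> = \<epsilon> / (8 * N * K)"
  have N: "N \<ge> 1" by (simp add: N_def)
  have \<delta>: "\<delta> > 0" "N * K * \<delta> = \<epsilon> / 8" using \<epsilon> K1 N by (simp_all add: \<delta>_def)
  have fE0: "finite E0" and fU: "finite (U ` I)" using F I by (auto simp: E0_def F2_def)
  have "U ` I \<subseteq> CG" using U by blast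
  from fU this fE0 \<delta>(1) obtain \<Gamma> where \<Gamma>: "finite \<Gamma>"
    and net: "\<And>g. \<exists>\<gamma>\<in>\<Gamma>. (\<forall>f\<in>U ` I. \<forall>h. cmod (Lt mul iv g f h - Lt mul iv \<gamma> f h) \<le> \<delta>)
      \<and> (\<forall>a\<in>E0. norm (\<alpha> g a - \<alpha> \<gamma> a) \<le> \<delta>)"
    by (rule translation_net) (rule that)
  \<comment> \<open>The translates by the net enter both \<open>E\<close> and \<open>S\<close>, so
    that \<open>X\<close> almost commutes with the translated coefficients and with its own
    translates.\<close>
  define E where "E = F \<union> E0 \<union> (\<lambda>(\<gamma>, x). \<alpha> \<gamma> x) ` (\<Gamma> \<times> E0)"
  define S where "S = U ` I \<union> (\<lambda>(\<gamma>, i). Lt mul iv \<gamma> (U i)) ` (\<Gamma> \<times> I)"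
  have fE: "finite E" using F fE0 \<Gamma> by (auto simp: E_def)
  have fS: "finite S" "S \<subseteq> CG" using I \<Gamma> U Lt_CG by (auto simp: S_def)
  obtain p \<psi> where p: "\<And>n. projection_in st A\<alpha> (p n)" and ucp: "\<And>n. ucp_corner sc st (p n) (\<psi> n)"
    and cuntz: "\<And>n. cuntz_below st A\<alpha> (1 - p n) y" "\<And>n. cuntz_below st A\<alpha> (1 - p n) (p n)"
    and psi_mult: "\<And>n f1 f2. f1 \<in> S \<Longrightarrow> f2 \<in> S \<Longrightarrow> norm (\<psi> n (\<lambda>g. f1 g * f2 g) - \<psi> n f1 * \<psi> n f2) \<le> inverse (real (Suc n))"
    and psi_comm: "\<And>n f a. f \<in> S \<Longrightarrow> a \<in> E \<Longrightarrow> norm (\<psi> n f * a - a * \<psi> n f) \<le> inverse (real (Suc n))"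
    and psi_equi: "\<And>n f g. f \<in> S \<Longrightarrow> norm (\<psi> n (Lt mul iv g f) - \<alpha> g (\<psi> n f)) \<le> inverse (real (Suc n))"
    by (rule rokhlin_sequence[OF fE fS y]) (rule that; assumption)
  have pp: "st (p n) = p n" "p n * p n = p n" "p n \<in> A\<alpha>" for n using p[of n] by (auto simp: projection_in_def)
  have np: "norm (p n) \<le> 1" for n using projection_norm_le[OF pp(1,2)] .
  have act_p: "\<alpha> g (p n) = p n" for g n using pp(3) by (auto simp: fixed_points_def)
  define X where "X i n = \<psi> n (U i)" for i n
  have sX: "st (X i n) = X i n" and nX: "norm (X i n) \<le> 1" for i n
    using ucp_contractive[OF ucp pp(1,2) u_cont, of i 1] u_bd by (simp_all add: X_def U_def)
  have PX: "p n * X i n = X i n" for i n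
    using ucp_corner_unit[OF ucp pp(2) U] by (simp_all add: X_def)
  have bX: "bounded_fun (X i)" for i using nX by (rule bounded_funI)
  have S_U: "U i \<in> S" if "i \<in> I" for i using that by (auto simp: S_def)
  have S_Lt: "Lt mul iv \<gamma> (U i) \<in> S" if "i \<in> I" "\<gamma> \<in> \<Gamma>" for i \<gamma> using that by (auto simp: S_def)
  have inv0: "(\<lambda>n. inverse (real (Suc n))) \<longlonglongrightarrow> 0" by (rule LIMSEQ_inverse_real_of_nat)
  have a_mult: "asym_eq sequentially (\<lambda>n. \<psi> n f1 * \<psi> n f2) (\<lambda>n. \<psi> n (\<lambda>g. f1 g * f2 g))" if "f1 \<in> S" "f2 \<in> S" for f1 f2
    by (rule asym_eq_sym[OF asym_eq_norm_le[OF psi_mult[OF that] inv0]])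
  have a_comm: "asym_eq sequentially (\<lambda>n. \<psi> n f * a) (\<lambda>n. a * \<psi> n f)" if "f \<in> S" "a \<in> E" for f a
    by (rule asym_eq_norm_le[OF psi_comm[OF that] inv0])
  have a_equi: "asym_eq sequentially (\<lambda>n. \<alpha> g (\<psi> n f)) (\<lambda>n. \<psi> n (Lt mul iv g f))" if "f \<in> S" for g f
    by (rule asym_eq_sym[OF asym_eq_norm_le[OF psi_equi[OF that] inv0]])
  have sumX: "asym_eq sequentially (\<lambda>n. \<Sum>i\<in>I. X i n * X i n) p"
  proof -
    have "asym_eq sequentially (\<lambda>n. \<Sum>i\<in>I. X i n * X i n) (\<lambda>n. \<Sum>i\<in>I. \<psi> n (\<lambda>g. U i g * U i g))"
      unfolding X_def by (intro asym_eq_sum a_mult S_U)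
    also have "\<dots> = (\<lambda>n. \<psi> n (\<lambda>g. \<Sum>i\<in>I. U i g * U i g))"
      using U by (intro ext ucp_sum[symmetric, OF ucp _ I]) (auto simp: CG_def intro!: continuous_intros)
    also have "(\<lambda>g. \<Sum>i\<in>I. U i g * U i g) = (\<lambda>g. 1)"
    proof
      fix g
      have "(\<Sum>i\<in>I. U i g * U i g) = complex_of_real (\<Sum>i\<in>I. (u i g)\<^sup>2)" by (simp add: U_def power2_eq_square)
      then show "(\<Sum>i\<in>I. U i g * U i g) = 1" by (simp add: u_sum)
    qed
    finally show ?thesis by (simp add: ucp_one[OF ucp])
  qed
  have XX: "asym_eq sequentially (\<lambda>n. X i n * X j n) (\<lambda>n. X j n * X i n)" if "i \<in> I" "j \<in> I" for i j
  proof -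
    have "asym_eq sequentially (\<lambda>n. X i n * X j n) (\<lambda>n. \<psi> n (\<lambda>g. U i g * U j g))"
      unfolding X_def by (intro a_mult S_U that)
    also have "\<dots> = (\<lambda>n. \<psi> n (\<lambda>g. U j g * U i g))" by (simp add: mult.commute)
    also have "asym_eq sequentially \<dots> (\<lambda>n. X j n * X i n)"
      unfolding X_def by (intro asym_eq_sym[OF a_mult] S_U that)
    finally show ?thesis .
  qed
  \<comment> \<open>The translated family is again an approximate partition of \<open>p\<close>, as
    \<open>p\<close> is fixed. Equivariance identifies it asymptotically with the images of the
    translated functions, which is how it commutes with \<open>X\<close>.\<close>
  define Y where "Y \<gamma> k n = \<alpha> \<gamma> (X k n)" for \<gamma> k n
  have bY: "bounded_fun (Y \<gamma> k)" for \<gamma> k using nX by (intro bounded_funI[of _ 1]) (simp add: Y_def)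
  have Y_psi: "asym_eq sequentially (Y \<gamma> k) (\<lambda>n. \<psi> n (Lt mul iv \<gamma> (U k)))" if "k \<in> I" for \<gamma> k
    using a_equi[OF S_U[OF that]] by (simp add: Y_def[abs_def] X_def)
  have b_psi: "bounded_fun (\<lambda>n. \<psi> n (Lt mul iv \<gamma> (U k)))" for \<gamma> k
  proof (rule bounded_funI[of _ 1])
    have "continuous_on UNIV (\<lambda>h. Re (Lt mul iv \<gamma> (U k) h))"
      using Lt_CG[OF U] by (auto simp: CG_def intro!: continuous_intros)
    then show "norm (\<psi> n (Lt mul iv \<gamma> (U k))) \<le> 1" for n
      using ucp_contractive(2)[OF ucp pp(1,2), of "\<lambda>h. u k (mul (iv \<gamma>) h)" 1] u_bd by (simp add: Lt_def U_def)
  qed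
  have sumY: "asym_eq sequentially (\<lambda>n. \<Sum>k\<in>I. Y \<gamma> k n * Y \<gamma> k n) p" for \<gamma>
  proof -
    have "(\<lambda>n. \<alpha> \<gamma> ((\<Sum>i\<in>I. X i n * X i n) - p n)) \<longlonglongrightarrow> 0"
      using bounded_linear.tendsto_zero[OF bounded_linear_act] sumX unfolding asym_eq_def .
    then show ?thesis by (simp add: asym_eq_def act_diff act_sum act_mult act_p Y_def)
  qed
  have YE: "asym_eq sequentially (\<lambda>n. c * Y \<gamma> k n) (\<lambda>n. Y \<gamma> k n * c)"
    if "c \<in> E" "k \<in> I" "\<gamma> \<in> \<Gamma>" for c \<gamma> k
  proof -
    have "asym_eq sequentially (\<lambda>n. c * Y \<gamma> k n) (\<lambda>n. c * \<psi> n (Lt mul iv \<gamma> (U k)))"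
      using that by (intro asym_eq_mult asym_eq_refl Y_psi bounded_fun_const b_psi)
    also have "asym_eq sequentially \<dots> (\<lambda>n. \<psi> n (Lt mul iv \<gamma> (U k)) * c)"
      using that by (intro asym_eq_sym[OF a_comm] S_Lt)
    also have "asym_eq sequentially \<dots> (\<lambda>n. Y \<gamma> k n * c)"
      using that by (intro asym_eq_mult asym_eq_refl asym_eq_sym[OF Y_psi] bounded_fun_const b_psi)
    finally show ?thesis .
  qed
  have XY_psi: "asym_eq sequentially (\<lambda>n. X i n * Y \<gamma> k n) (\<lambda>n. \<psi> n (\<lambda>h. U i h * Lt mul iv \<gamma> (U k) h))"
    "asym_eq sequentially (\<lambda>n. Y \<gamma> k n * X i n) (\<lambda>n. \<psi> n (\<lambda>h. U i h * Lt mul iv \<gamma> (U k) h))"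
    if "i \<in> I" "k \<in> I" "\<gamma> \<in> \<Gamma>" for i \<gamma> k
  proof -
    have "asym_eq sequentially (\<lambda>n. X i n * Y \<gamma> k n) (\<lambda>n. X i n * \<psi> n (Lt mul iv \<gamma> (U k)))"
      using that by (intro asym_eq_mult asym_eq_refl Y_psi bX b_psi)
    also have "asym_eq sequentially \<dots> (\<lambda>n. \<psi> n (\<lambda>h. U i h * Lt mul iv \<gamma> (U k) h))"
      unfolding X_def using that by (intro a_mult S_U S_Lt)
    finally show "asym_eq sequentially (\<lambda>n. X i n * Y \<gamma> k n) (\<lambda>n. \<psi> n (\<lambda>h. U i h * Lt mul iv \<gamma> (U k) h))" .
    have "asym_eq sequentially (\<lambda>n. Y \<gamma> k n * X i n) (\<lambda>n. \<psi> n (Lt mul iv \<gamma> (U k)) * X i n)"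
      using that by (intro asym_eq_mult asym_eq_refl Y_psi bX bY)
    also have "asym_eq sequentially \<dots> (\<lambda>n. \<psi> n (\<lambda>h. Lt mul iv \<gamma> (U k) h * U i h))"
      unfolding X_def using that by (intro a_mult S_U S_Lt)
    finally show "asym_eq sequentially (\<lambda>n. Y \<gamma> k n * X i n) (\<lambda>n. \<psi> n (\<lambda>h. U i h * Lt mul iv \<gamma> (U k) h))"
      by (simp add: mult.commute)
  qed
  have XE: "asym_eq sequentially (\<lambda>n. c * X i n) (\<lambda>n. X i n * c)" if "c \<in> E" "i \<in> I" for c i
    unfolding X_def using that by (intro asym_eq_sym[OF a_comm] S_U)
  have E0E: "E0 \<subseteq> E" by (auto simp: E_def)
  have aE0: "\<alpha> i a \<in> E0" if "i \<in> I" "a \<in> F2" for i a using that by (auto simp: E0_def)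
  have gE: "\<alpha> \<gamma> (\<alpha> i a) \<in> E" if "i \<in> I" "a \<in> F2" "\<gamma> \<in> \<Gamma>" for i a \<gamma>
    using aE0[OF that(1,2)] that(3) by (auto simp: E_def)
  have FF2: "F \<subseteq> F2" by (auto simp: F2_def)
  define \<phi> where "\<phi> n x = (\<Sum>i\<in>I. X i n * \<alpha> i x * X i n)" for n x
  have ev_bound: "eventually (\<lambda>n. \<forall>x. norm (\<phi> n x) \<le> 4 * norm x) sequentially"
  proof -
    have "eventually (\<lambda>n. norm (\<Sum>i\<in>I. X i n * X i n) \<le> 1 + 1) sequentially"
      by (rule asym_eq_eventually_norm[OF sumX]) (auto simp: np)
    then show ?thesis
    proof eventually_elim
      case (elim n)
      show ?case
      proof
        fix x
        have "\<phi> n x = (\<Sum>i\<in>I. st (X i n) * \<alpha> i x * X i n)" by (simp add: \<phi>_def sX)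
        also have "norm \<dots> \<le> 2 * norm x * norm (\<Sum>i\<in>I. st (X i n) * X i n)"
          by (intro norm_sum_conjugates pos_star) auto
        also have "\<dots> \<le> 2 * norm x * 2" using elim by (intro mult_left_mono) (auto simp: sX)
        finally show "norm (\<phi> n x) \<le> 4 * norm x" by simp
      qed
    qed
  qed
  have ev_one: "eventually (\<lambda>n. norm (\<phi> n 1 - p n) < \<epsilon>) sequentially"
    using asym_eq_eventually[OF sumX \<epsilon>] by (simp add: \<phi>_def act_one)
  have ev_mult: "eventually (\<lambda>n. norm (\<phi> n a * \<phi> n b - \<phi> n (a * b)) \<le> \<epsilon>) sequentially"
    if ab: "a \<in> F" "b \<in> F" for a b
  proof -
    have "eventually (\<lambda>n. norm ((\<Sum>i\<in>I. X i n * \<alpha> i a * X i n) * (\<Sum>i\<in>I. X i n * \<alpha> i b * X i n)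
      - (\<Sum>i\<in>I. X i n * (\<alpha> i a * \<alpha> i b) * X i n)) \<le> 6 * (2 * (K * \<eta>))) sequentially"
    proof (rule conjugates_multiplicative[OF pos_star bX np sX PX sumX XX])
      fix i j assume ij: "i \<in> I" "j \<in> I"
      show "asym_eq sequentially (\<lambda>n. \<alpha> i a * X j n) (\<lambda>n. X j n * \<alpha> i a)"
        "asym_eq sequentially (\<lambda>n. \<alpha> i b * X j n) (\<lambda>n. X j n * \<alpha> i b)"
        using ij ab FF2 aE0 E0E by (blast intro: XE)+
      \<comment> \<open>At a common support point \<open>g\<close> of \<open>u i\<close> and
        \<open>u j\<close>, both orbit values are within \<eta> of \<open>\<alpha> g b\<close>.
        Without such a point the functions are orthogonal, and almost multiplicativity of
        \<open>\<psi> n\<close> makes \<open>X j * X i\<close> vanish in the limit.\<close>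
      show "norm (\<alpha> i a * (\<alpha> j b - \<alpha> i b)) \<le> 2 * (K * \<eta>) \<or> asym_eq sequentially (\<lambda>n. X j n * X i n) (\<lambda>_. 0)"
      proof (cases "\<exists>g. u i g \<noteq> 0 \<and> u j g \<noteq> 0")
        case True
        then obtain g where g: "u i g \<noteq> 0" "u j g \<noteq> 0" by blast
        have "\<alpha> j b - \<alpha> i b = (\<alpha> g b - \<alpha> i b) - (\<alpha> g b - \<alpha> j b)" by simp
        then have "norm (\<alpha> j b - \<alpha> i b) \<le> 2 * \<eta>"
          using norm_triangle_ineq4[of "\<alpha> g b - \<alpha> i b" "\<alpha> g b - \<alpha> j b"] u_supp[OF g(1) ab(2)] u_supp[OF g(2) ab(2)]
          by simp
        then have "norm (\<alpha> i a) * norm (\<alpha> j b - \<alpha> i b) \<le> K * (2 * \<eta>)"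
          using K[OF ab(1)] K1 by (intro mult_mono) auto
        then show ?thesis using norm_mult_ineq[of "\<alpha> i a" "\<alpha> j b - \<alpha> i b"] by (auto simp: algebra_simps)
      next
        case False
        then have "(\<lambda>g. U j g * U i g) = (\<lambda>_. 0)" by (auto simp: U_def fun_eq_iff)
        then show ?thesis
          using a_mult[OF S_U S_U, OF ij(2,1)] by (simp add: X_def ucp_zero[OF ucp])
      qed
    qed (use I K1 \<eta> \<epsilon> in auto)
    then show ?thesis
      by (rule eventually_mono) (use \<eta>(2) \<epsilon> in \<open>simp add: \<phi>_def act_mult\<close>)
  qed
  have ev_fix: "eventually (\<lambda>n. norm (\<phi> n a - a * p n) < \<epsilon>) sequentially" if a: "a \<in> F \<inter> A\<alpha>" for a
  proof -
    have "\<phi> n a = (\<Sum>i\<in>I. X i n * a * X i n)" for n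
      using a by (simp add: \<phi>_def fixed_points_def)
    moreover have "asym_eq sequentially (\<lambda>n. \<Sum>i\<in>I. X i n * a * X i n) (\<lambda>n. \<Sum>i\<in>I. a * X i n * X i n)"
      using a by (intro asym_eq_sum asym_eq_mult asym_eq_refl asym_eq_sym[OF XE] bX bounded_fun_mult bounded_fun_const) (auto simp: E_def)
    moreover have "(\<lambda>n. \<Sum>i\<in>I. a * X i n * X i n) = (\<lambda>n. a * (\<Sum>i\<in>I. X i n * X i n))"
      by (simp add: sum_distrib_left mult.assoc)
    moreover have "asym_eq sequentially (\<lambda>n. a * (\<Sum>i\<in>I. X i n * X i n)) (\<lambda>n. a * p n)"
      using np by (intro asym_eq_mult asym_eq_refl sumX bounded_fun_const bounded_funI)
    ultimately have "asym_eq sequentially (\<lambda>n. \<phi> n a) (\<lambda>n. a * p n)" using asym_eq_trans by auto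
    then show ?thesis using asym_eq_eventually \<epsilon> by blast
  qed
  have ev_inv: "eventually (\<lambda>n. norm (\<phi> n a - \<alpha> \<gamma> (\<phi> n a)) \<le> \<epsilon> / 3) sequentially"
    if a: "a \<in> F" and \<gamma>: "\<gamma> \<in> \<Gamma>" for a \<gamma>
  proof -
    have "eventually (\<lambda>n. norm ((\<Sum>i\<in>I. X i n * \<alpha> i a * X i n)
      - (\<Sum>k\<in>I. Y \<gamma> k n * \<alpha> \<gamma> (\<alpha> k a) * Y \<gamma> k n)) \<le> 6 * (2 * \<eta>)) sequentially"
    proof (rule conjugates_compare[OF pos_star bX bY np sX _ PX _ sumX sumY])
      show "st (Y \<gamma> j n) = Y \<gamma> j n" "p n * Y \<gamma> j n = Y \<gamma> j n" for j n
        using sX PX act_p by (simp_all add: Y_def flip: act_st) (metis act_mult)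
      fix i k assume ik: "i \<in> I" "k \<in> I"
      show "asym_eq sequentially (\<lambda>n. X i n * Y \<gamma> k n) (\<lambda>n. Y \<gamma> k n * X i n)"
        using asym_eq_trans[OF XY_psi(1) asym_eq_sym[OF XY_psi(2)]] ik \<gamma> by blast
      show "asym_eq sequentially (\<lambda>n. \<alpha> i a * Y \<gamma> k n) (\<lambda>n. Y \<gamma> k n * \<alpha> i a)"
        using ik a FF2 aE0 E0E \<gamma> by (blast intro: YE)
      show "asym_eq sequentially (\<lambda>n. \<alpha> \<gamma> (\<alpha> k a) * X i n) (\<lambda>n. X i n * \<alpha> \<gamma> (\<alpha> k a))"
        using ik a FF2 gE \<gamma> by (blast intro: XE)
      show "norm (\<alpha> i a - \<alpha> \<gamma> (\<alpha> k a)) \<le> 2 * \<eta> \<or> asym_eq sequentially (\<lambda>n. Y \<gamma> k n * X i n) (\<lambda>_. 0)"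
      proof (cases "\<exists>g. u i g \<noteq> 0 \<and> u k (mul (iv \<gamma>) g) \<noteq> 0")
        case True
        then obtain g where g: "u i g \<noteq> 0" "u k (mul (iv \<gamma>) g) \<noteq> 0" by blast
        have "\<alpha> g a - \<alpha> \<gamma> (\<alpha> k a) = \<alpha> \<gamma> (\<alpha> (mul (iv \<gamma>) g) a - \<alpha> k a)"
          by (simp add: act_diff act_mul act_iv)
        then have "norm (\<alpha> g a - \<alpha> \<gamma> (\<alpha> k a)) < \<eta>" using u_supp[OF g(2) a] by simp
        moreover have "\<alpha> i a - \<alpha> \<gamma> (\<alpha> k a) = (\<alpha> g a - \<alpha> \<gamma> (\<alpha> k a)) - (\<alpha> g a - \<alpha> i a)" by simp
        ultimately have "norm (\<alpha> i a - \<alpha> \<gamma> (\<alpha> k a)) \<le> 2 * \<eta>"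
          using norm_triangle_ineq4[of "\<alpha> g a - \<alpha> \<gamma> (\<alpha> k a)" "\<alpha> g a - \<alpha> i a"] u_supp[OF g(1) a] by simp
        then show ?thesis ..
      next
        case False
        then have "(\<lambda>h. U i h * Lt mul iv \<gamma> (U k) h) = (\<lambda>_. 0)" by (auto simp: U_def Lt_def fun_eq_iff)
        then show ?thesis using XY_psi(2)[OF ik \<gamma>] by (simp add: ucp_zero[OF ucp])
      qed
    qed (use I \<eta> in auto)
    then show ?thesis
      by (rule eventually_mono) (use \<eta>(3) \<epsilon> in \<open>simp add: \<phi>_def act_sum act_mult Y_def\<close>)
  qed
  \<comment> \<open>An arbitrary \<open>g\<close> is compared with a net point term by term. The
    triangle inequality over \<open>I\<close> is affordable here because \<delta> was chosen after
    the number of terms.\<close>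
  have net_bound: "norm (\<alpha> g (\<phi> n a) - \<alpha> \<gamma> (\<phi> n a)) \<le> N * (2 * K * (2 * inverse (real (Suc n)) + \<delta>) + \<delta>)"
    if a: "a \<in> F"
      and 1: "\<forall>f\<in>U ` I. \<forall>h. cmod (Lt mul iv g f h - Lt mul iv \<gamma> f h) \<le> \<delta>"
      and 2: "\<forall>a\<in>E0. norm (\<alpha> g a - \<alpha> \<gamma> a) \<le> \<delta>" for g \<gamma> a n
  proof -
    define d where "d = 2 * inverse (real (Suc n)) + \<delta>"
    have summand: "norm (\<alpha> g (X i n * \<alpha> i a * X i n) - \<alpha> \<gamma> (X i n * \<alpha> i a * X i n)) \<le> 2 * K * d + \<delta>"
      if i: "i \<in> I" for i
    proof -
      define P P' Q Q' where "P = \<alpha> g (X i n)" and "P' = \<alpha> \<gamma> (X i n)"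
        and "Q = \<alpha> g (\<alpha> i a)" and "Q' = \<alpha> \<gamma> (\<alpha> i a)"
      define f where "f h = u i (mul (iv g) h) - u i (mul (iv \<gamma>) h)" for h
      have fe: "(\<lambda>h. complex_of_real (f h)) = (\<lambda>h. Lt mul iv g (U i) h - Lt mul iv \<gamma> (U i) h)"
        by (simp add: f_def Lt_def U_def)
      have "continuous_on UNIV (\<lambda>h. Re (Lt mul iv g (U i) h - Lt mul iv \<gamma> (U i) h))"
        using Lt_CG[OF U] by (auto simp: CG_def intro!: continuous_intros)
      then have "continuous_on UNIV f" by (simp add: f_def Lt_def U_def)
      moreover have "\<bar>f h\<bar> \<le> \<delta>" for h
        using 1 i fe norm_of_real[of "f h", where 'a = complex] by (metis (no_types, lifting) imageI)
      ultimately have "norm (\<psi> n (\<lambda>h. complex_of_real (f h))) \<le> \<delta>"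
        by (intro ucp_contractive(2)[OF ucp pp(1,2)])
      then have "norm (\<psi> n (Lt mul iv g (U i)) - \<psi> n (Lt mul iv \<gamma> (U i))) \<le> \<delta>"
        unfolding fe by (simp add: ucp_diff[OF ucp Lt_CG[OF U] Lt_CG[OF U]])
      moreover have "norm (\<psi> n (Lt mul iv g (U i)) - P) \<le> inverse (real (Suc n))"
        "norm (\<psi> n (Lt mul iv \<gamma> (U i)) - P') \<le> inverse (real (Suc n))"
        unfolding P_def P'_def X_def by (rule psi_equi[OF S_U[OF i]])+
      ultimately have PP: "norm (P - P') \<le> d"
        unfolding d_def by norm
      have QQ: "norm (Q - Q') \<le> \<delta>" unfolding Q_def Q'_def using 2 aE0 i a FF2 by blast
      have n1: "norm P \<le> 1" "norm P' \<le> 1" "norm Q \<le> K" "norm Q' \<le> K"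
        using nX K[OF a] by (simp_all add: P_def P'_def Q_def Q'_def)
      have "P * Q * P - P' * Q' * P' = (P - P') * Q * P + P' * (Q - Q') * P + P' * Q' * (P - P')"
        by (simp add: algebra_simps)
      also have "norm \<dots> \<le> d * K * 1 + 1 * \<delta> * 1 + 1 * K * d"
        using n1 PP QQ K1 \<delta>(1) order_trans[OF norm_ge_zero PP]
        by (intro norm_triangle_le add_mono order_trans[OF norm_mult_ineq] mult_mono)
          (auto intro: order_trans[OF norm_ge_zero])
      finally show ?thesis by (simp add: P_def P'_def Q_def Q'_def act_mult algebra_simps)
    qed
    have "\<alpha> g (\<phi> n a) - \<alpha> \<gamma> (\<phi> n a) = (\<Sum>i\<in>I. \<alpha> g (X i n * \<alpha> i a * X i n) - \<alpha> \<gamma> (X i n * \<alpha> i a * X i n))"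
      by (simp add: \<phi>_def act_sum sum_subtractf)
    also have "norm \<dots> \<le> real (card I) * (2 * K * d + \<delta>)"
      by (rule sum_norm_bound) (rule summand)
    also have "\<dots> \<le> N * (2 * K * d + \<delta>)"
      using K1 \<delta> by (intro mult_right_mono) (auto simp: N_def d_def)
    finally show ?thesis by (simp add: d_def)
  qed
  have "(\<lambda>n. N * (2 * K * (2 * inverse (real (Suc n)) + \<delta>) + \<delta>)) \<longlonglongrightarrow> N * (2 * K * (2 * 0 + \<delta>) + \<delta>)"
    by (intro tendsto_intros inv0)
  moreover have "N * (2 * K * (2 * 0 + \<delta>) + \<delta>) < \<epsilon> / 2"
  proof -
    have "N * \<delta> \<le> N * (K * \<delta>)" using N K1 \<delta> by (intro mult_left_mono) (auto simp: mult_le_cancel_right1)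
    then show ?thesis using \<delta>(2) \<epsilon> by (simp add: algebra_simps)
  qed
  ultimately have ev_net: "eventually (\<lambda>n. N * (2 * K * (2 * inverse (real (Suc n)) + \<delta>) + \<delta>) < \<epsilon> / 2) sequentially"
    by (rule order_tendstoD)
  have "eventually (\<lambda>n. (\<forall>x. norm (\<phi> n x) \<le> 4 * norm x) \<and> norm (\<phi> n 1 - p n) < \<epsilon>
      \<and> (\<forall>a\<in>F. \<forall>b\<in>F. norm (\<phi> n a * \<phi> n b - \<phi> n (a * b)) \<le> \<epsilon>)
      \<and> (\<forall>a\<in>F \<inter> A\<alpha>. norm (\<phi> n a - a * p n) < \<epsilon>)
      \<and> (\<forall>a\<in>F. \<forall>\<gamma>\<in>\<Gamma>. norm (\<phi> n a - \<alpha> \<gamma> (\<phi> n a)) \<le> \<epsilon> / 3)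
      \<and> N * (2 * K * (2 * inverse (real (Suc n)) + \<delta>) + \<delta>) < \<epsilon> / 2) sequentially"
    using F \<Gamma> by (intro eventually_conj eventually_ball_finite ballI ev_bound ev_one ev_mult ev_fix ev_inv ev_net) auto
  then obtain n where n: "\<forall>x. norm (\<phi> n x) \<le> 4 * norm x" "norm (\<phi> n 1 - p n) < \<epsilon>"
    "\<forall>a\<in>F. \<forall>b\<in>F. norm (\<phi> n a * \<phi> n b - \<phi> n (a * b)) \<le> \<epsilon>"
    "\<forall>a\<in>F \<inter> A\<alpha>. norm (\<phi> n a - a * p n) < \<epsilon>"
    "\<forall>a\<in>F. \<forall>\<gamma>\<in>\<Gamma>. norm (\<phi> n a - \<alpha> \<gamma> (\<phi> n a)) \<le> \<epsilon> / 3"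
    "N * (2 * K * (2 * inverse (real (Suc n)) + \<delta>) + \<delta>) < \<epsilon> / 2"
    using eventually_happens'[OF sequentially_bot] by blast
  have inv: "norm (\<alpha> g (\<phi> n a) - \<phi> n a) \<le> \<epsilon>" if a: "a \<in> F" for a g
  proof -
    obtain \<gamma> where \<gamma>: "\<gamma> \<in> \<Gamma>" "\<forall>f\<in>U ` I. \<forall>h. cmod (Lt mul iv g f h - Lt mul iv \<gamma> f h) \<le> \<delta>"
      "\<forall>a\<in>E0. norm (\<alpha> g a - \<alpha> \<gamma> a) \<le> \<delta>" using net by blast
    have "norm (\<alpha> g (\<phi> n a) - \<alpha> \<gamma> (\<phi> n a)) \<le> \<epsilon> / 2"
      using net_bound[OF a \<gamma>(2,3), of n] n(6) by linarith
    moreover have "norm (\<phi> n a - \<alpha> \<gamma> (\<phi> n a)) \<le> \<epsilon> / 3" using n(5) a \<gamma>(1) by blast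
    ultimately show ?thesis
      using norm_triangle_ineq4[of "\<alpha> g (\<phi> n a) - \<alpha> \<gamma> (\<phi> n a)" "\<phi> n a - \<alpha> \<gamma> (\<phi> n a)"] \<epsilon> by simp
  qed
  have "\<phi> n (x + y) = \<phi> n x + \<phi> n y" for x y
    by (simp add: \<phi>_def act_add algebra_simps sum.distrib)
  moreover have "\<phi> n (sc c x) = sc c (\<phi> n x)" for c x
  proof -
    have "sc c (\<Sum>i\<in>I. f i) = (\<Sum>i\<in>I. sc c (f i))" for f
      by (induction I rule: infinite_finite_induct) (auto simp: sc_add_right)
    then show ?thesis by (simp add: \<phi>_def act_sc sc_mult_left sc_mult_right)
  qed
  moreover have "\<phi> n (st x) = st (\<phi> n x)" for x
    by (simp add: \<phi>_def st_sum st_mult sX act_st mult.assoc)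
  ultimately show ?thesis
    using p[of n] cuntz[of n] n(1-4) inv by (intro exI[of _ "p n"] exI[of _ "\<phi> n"]) (auto intro: less_imp_le)
qed

end

section \<open>Transfer of traces\<close>

text \<open>An index is a finite set of elements to be treated and a number \<open>n\<close> giving
  the accuracy \<open>1 / (n + 1)\<close>. Finite subsets of the whole algebra make the limit
  relations hold for every element, so that the limit of the functionals is defined on all of
  \<open>A\<close>.\<close>

definition approx_filter :: "('a set \<times> nat) filter" where
  "approx_filter = finite_subsets_at_top UNIV \<times>\<^sub>F sequentially"

lemma approx_filter_neq_bot [simp]: "approx_filter \<noteq> bot"
  by (simp add: approx_filter_def prod_filter_eq_bot finite_subsets_at_top_neq_bot)

lemma eventually_approx_filter:
  "eventually (\<lambda>i. finite (fst i) \<and> x \<in> fst i) approx_filter"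
proof -
  have "eventually (\<lambda>F. finite F \<and> x \<in> F) (finite_subsets_at_top UNIV)"
    unfolding eventually_finite_subsets_at_top by (rule exI[of _ "{x}"]) auto
  moreover have "filterlim fst (finite_subsets_at_top UNIV) (approx_filter :: ('a set \<times> nat) filter)"
    unfolding approx_filter_def by (rule filterlim_fst)
  ultimately show ?thesis by (rule eventually_compose_filterlim)
qed

lemma approx_filter_error: "((\<lambda>i. inverse (real (Suc (snd i)))) \<longlongrightarrow> 0) approx_filter"
  unfolding approx_filter_def
  by (rule filterlim_compose[OF LIMSEQ_inverse_real_of_nat filterlim_snd])

context rokhlin_system
begin

text \<open>An asymptotic homomorphism into the fixed point algebra with asymptotic unit
  \<open>P\<close>. Even linearity is only asymptotic, because the values are obtained by choosing
  nearby fixed points separately; boundedness is kept at every index for the sake of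
  compactness.\<close>

definition approx_net :: "'i filter \<Rightarrow> ('i \<Rightarrow> 'a) \<Rightarrow> ('i \<Rightarrow> 'a \<Rightarrow> 'a) \<Rightarrow> bool" where
  "approx_net \<F> P \<Phi> \<longleftrightarrow> (\<forall>i. projection_in st A\<alpha> (P i)) \<and> (\<forall>i x. \<Phi> i x \<in> A\<alpha> \<and> norm (\<Phi> i x) \<le> 4 * norm x + 1)
     \<and> (\<forall>x y. asym_eq \<F> (\<lambda>i. \<Phi> i (x + y)) (\<lambda>i. \<Phi> i x + \<Phi> i y))
     \<and> (\<forall>c x. asym_eq \<F> (\<lambda>i. \<Phi> i (sc c x)) (\<lambda>i. sc c (\<Phi> i x)))
     \<and> (\<forall>x. asym_eq \<F> (\<lambda>i. \<Phi> i (st x)) (\<lambda>i. st (\<Phi> i x)))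
     \<and> (\<forall>x y. asym_eq \<F> (\<lambda>i. \<Phi> i (x * y)) (\<lambda>i. \<Phi> i x * \<Phi> i y))
     \<and> asym_eq \<F> (\<lambda>i. \<Phi> i 1) P
     \<and> (\<forall>a\<in>A\<alpha>. asym_eq \<F> (\<lambda>i. \<Phi> i a) (\<lambda>i. a * P i))"

lemma approx_netD:
  assumes "approx_net \<F> P \<Phi>"
  shows "projection_in st A\<alpha> (P i)" "\<Phi> i x \<in> A\<alpha>" "norm (\<Phi> i x) \<le> 4 * norm x + 1"
    and approx_net_add: "asym_eq \<F> (\<lambda>i. \<Phi> i (x + y)) (\<lambda>i. \<Phi> i x + \<Phi> i y)"
    and approx_net_sc: "asym_eq \<F> (\<lambda>i. \<Phi> i (sc c x)) (\<lambda>i. sc c (\<Phi> i x))"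
    and approx_net_st: "asym_eq \<F> (\<lambda>i. \<Phi> i (st x)) (\<lambda>i. st (\<Phi> i x))"
    and approx_net_mult: "asym_eq \<F> (\<lambda>i. \<Phi> i (x * y)) (\<lambda>i. \<Phi> i x * \<Phi> i y)"
    and approx_net_one: "asym_eq \<F> (\<lambda>i. \<Phi> i 1) P"
    and approx_net_fixed: "a \<in> A\<alpha> \<Longrightarrow> asym_eq \<F> (\<lambda>i. \<Phi> i a) (\<lambda>i. a * P i)"
  using assms unfolding approx_net_def by blast+

lemma approx_net_exists:
  assumes y: "positive_in st A\<alpha> y" "y \<noteq> 0"
  obtains P \<Phi> where "approx_net (approx_filter :: ('a set \<times> nat) filter) P \<Phi>" "\<And>i. cuntz_below st A\<alpha> (1 - P i) y" "\<And>i. cuntz_below st A\<alpha> (1 - P i) (P i)"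
proof -
  define R where "R F \<epsilon> p \<phi> \<longleftrightarrow> projection_in st A\<alpha> p \<and> cuntz_below st A\<alpha> (1 - p) y \<and> cuntz_below st A\<alpha> (1 - p) p \<and>
    (\<forall>x y. \<phi> (x + y) = \<phi> x + \<phi> y) \<and> (\<forall>c x. \<phi> (sc c x) = sc c (\<phi> x)) \<and> (\<forall>x. \<phi> (st x) = st (\<phi> x)) \<and>
    (\<forall>x. norm (\<phi> x) \<le> 4 * norm x) \<and> (\<forall>a\<in>F. \<forall>b\<in>F. norm (\<phi> a * \<phi> b - \<phi> (a * b)) \<le> \<epsilon>) \<and>
    norm (\<phi> 1 - p) \<le> \<epsilon> \<and> (\<forall>a\<in>F \<inter> A\<alpha>. norm (\<phi> a - a * p) \<le> \<epsilon>) \<and>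
    (\<forall>a\<in>F. \<forall>g. norm (\<alpha> g (\<phi> a) - \<phi> a) \<le> \<epsilon>)" for F \<epsilon> p \<phi>
  \<comment> \<open>The index type also contains infinite sets; the empty set stands in for them,
    and eventually the first component is finite.\<close>
  define F where "F i = (if finite (fst i) then fst i else {})" for i :: "'a set \<times> nat"
  define err where "err i = inverse (real (Suc (snd i)))" for i :: "'a set \<times> nat"
  have err: "err i > 0" "err i \<le> 1" for i by (simp_all add: err_def divide_simps)
  have "\<exists>p \<phi>. R (F i) (err i) p \<phi>" for i
    unfolding R_def by (rule rokhlin_approx_hom[OF _ err(1) y]) (simp add: F_def)
  then obtain P \<phi> where "\<And>i. R (F i) (err i) (P i) (\<phi> i)" by metis
  note H = this[unfolded R_def]
  define close where "close i x z \<longleftrightarrow> z \<in> A\<alpha> \<and> norm (z - \<phi> i x) \<le> err i" for i x z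
  \<comment> \<open>\<open>\<phi> i x\<close> is almost invariant only for \<open>x\<close> in
    \<open>F i\<close>, and there \<open>fixed_point_near\<close> supplies a fixed point close to
    it. The default 0 keeps the norm bound, and the summand 1 in that bound comes from
    \<open>err i \<le> 1\<close>.\<close>
  define \<Phi> where "\<Phi> i x = (if \<exists>z. close i x z then SOME z. close i x z else 0)" for i x
  have \<Phi>_close: "close i x (\<Phi> i x)" if "\<exists>z. close i x z" for i x
    using someI_ex[OF that] that by (simp add: \<Phi>_def)
  have \<Phi>_in: "\<Phi> i x \<in> A\<alpha>" for i x
    using \<Phi>_close[of i x] csub_zero[OF csub_fixed_points] by (cases "\<exists>z. close i x z") (auto simp: close_def \<Phi>_def)
  have \<Phi>_bd: "norm (\<Phi> i x) \<le> 4 * norm x + 1" for i x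
  proof (cases "\<exists>z. close i x z")
    case True
    have "norm (\<Phi> i x) \<le> norm (\<phi> i x) + err i"
      using \<Phi>_close[OF True] norm_triangle_sub[of "\<Phi> i x" "\<phi> i x"] by (simp add: close_def)
    moreover have "norm (\<phi> i x) \<le> 4 * norm x" using H[of i] by blast
    ultimately show ?thesis using err(2)[of i] by linarith
  qed (simp add: \<Phi>_def)
  have lim0: "(err \<longlongrightarrow> 0) approx_filter" unfolding err_def by (rule approx_filter_error)
  have ev_norm: "asym_eq approx_filter X Z"
    if "eventually (\<lambda>i. norm (X i - Z i) \<le> err i) approx_filter" for X Z
    unfolding asym_eq_def using Lim_null_comparison[OF that lim0] .
  have evF: "eventually (\<lambda>i. x \<in> F i) approx_filter" for x
    using eventually_approx_filter[of x] by eventually_elim (simp add: F_def)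
  have \<Phi>\<phi>: "asym_eq approx_filter (\<lambda>i. \<Phi> i x) (\<lambda>i. \<phi> i x)" for x
  proof (rule ev_norm)
    show "eventually (\<lambda>i. norm (\<Phi> i x - \<phi> i x) \<le> err i) approx_filter"
      using evF[of x]
    proof eventually_elim
      case (elim i)
      obtain \<tau> where \<tau>: "\<tau> \<in> traces UNIV" using trace_ex by blast
      have "\<And>g. norm (\<alpha> g (\<phi> i x) - \<phi> i x) \<le> err i" using H[of i] elim by blast
      then have "\<exists>z. close i x z"
        using fixed_point_near[OF simple \<tau>] unfolding close_def by blast
      then show ?case using \<Phi>_close by (simp add: close_def)
    qed
  qed
  have bounded_fun\<phi>: "bounded_fun (\<lambda>i. \<phi> i x)" for x
    by (rule bounded_funI[of _ "4 * norm x"]) (use H in blast)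
  have bounded_fun\<Phi>: "bounded_fun (\<lambda>i. \<Phi> i x)" for x
    by (rule bounded_funI[OF \<Phi>_bd])
  have lin: "\<phi> i (x + y) = \<phi> i x + \<phi> i y" "\<phi> i (sc c x) = sc c (\<phi> i x)" "\<phi> i (st x) = st (\<phi> i x)" for i x y c
    using H[of i] by blast+
  have "approx_net (approx_filter :: ('a set \<times> nat) filter) P \<Phi>"
    unfolding approx_net_def
  proof (intro conjI allI ballI)
    show "projection_in st A\<alpha> (P i)" for i using H by blast
    show "\<Phi> i x \<in> A\<alpha>" "norm (\<Phi> i x) \<le> 4 * norm x + 1" for i x by (rule \<Phi>_in \<Phi>_bd)+
    fix x y
    show "asym_eq approx_filter (\<lambda>i. \<Phi> i (x + y)) (\<lambda>i. \<Phi> i x + \<Phi> i y)"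
      using asym_eq_trans[OF \<Phi>\<phi>[of "x + y", unfolded lin] asym_eq_sym[OF asym_eq_add[OF \<Phi>\<phi>[of x] \<Phi>\<phi>[of y]]]] .
    show "asym_eq approx_filter (\<lambda>i. \<Phi> i (sc c x)) (\<lambda>i. sc c (\<Phi> i x))" for c
      using asym_eq_trans[OF \<Phi>\<phi>[of "sc c x", unfolded lin] asym_eq_sym[OF asym_eq_sc[OF \<Phi>\<phi>[of x]]]] .
    show "asym_eq approx_filter (\<lambda>i. \<Phi> i (st x)) (\<lambda>i. st (\<Phi> i x))"
      using asym_eq_trans[OF \<Phi>\<phi>[of "st x", unfolded lin] asym_eq_sym[OF asym_eq_st[OF \<Phi>\<phi>[of x]]]] .
    have "asym_eq approx_filter (\<lambda>i. \<phi> i x * \<phi> i y) (\<lambda>i. \<phi> i (x * y))"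
    proof (rule ev_norm)
      show "eventually (\<lambda>i. norm (\<phi> i x * \<phi> i y - \<phi> i (x * y)) \<le> err i) approx_filter"
        using evF[of x] evF[of y] by eventually_elim (use H in blast)
    qed
    then show "asym_eq approx_filter (\<lambda>i. \<Phi> i (x * y)) (\<lambda>i. \<Phi> i x * \<Phi> i y)"
      using asym_eq_trans[OF \<Phi>\<phi>[of "x * y"]] asym_eq_mult[OF asym_eq_sym[OF \<Phi>\<phi>[of x]] asym_eq_sym[OF \<Phi>\<phi>[of y]] bounded_fun\<phi> bounded_fun\<Phi>]
        asym_eq_trans asym_eq_sym by blast
  next
    have "asym_eq approx_filter (\<lambda>i. \<phi> i 1) P"
      by (rule ev_norm) (use H in \<open>simp add: always_eventually\<close>)
    then show "asym_eq approx_filter (\<lambda>i. \<Phi> i 1) P" by (rule asym_eq_trans[OF \<Phi>\<phi>])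
  next
    fix a assume a: "a \<in> A\<alpha>"
    have "asym_eq approx_filter (\<lambda>i. \<phi> i a) (\<lambda>i. a * P i)"
    proof (rule ev_norm)
      show "eventually (\<lambda>i. norm (\<phi> i a - a * P i) \<le> err i) approx_filter"
        using evF[of a] by eventually_elim (use H a in blast)
    qed
    then show "asym_eq approx_filter (\<lambda>i. \<Phi> i a) (\<lambda>i. a * P i)" by (rule asym_eq_trans[OF \<Phi>\<phi>])
  qed
  then show ?thesis using that[of P \<Phi>] H by blast
qed

text \<open>Pulling back traces of \<open>A\<^sup>\<alpha>\<close> along the net yields, in the limit, traces of \<open>A\<close>.\<close>

lemma trace_transfer:
  assumes nb: "\<F> \<noteq> bot" and net: "approx_net \<F> P \<Phi>"
    and half: "\<And>i \<sigma>. \<sigma> \<in> traces A\<alpha> \<Longrightarrow> Re (\<sigma> (P i)) \<ge> 1/2"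
    and z: "\<And>\<tau>. \<tau> \<in> traces UNIV \<Longrightarrow> cmod (\<tau> z) < \<epsilon>"
  shows "eventually (\<lambda>i. \<forall>\<sigma>\<in>traces A\<alpha>. cmod (\<sigma> (\<Phi> i z)) < \<epsilon>) \<F>"
proof (rule ccontr)
  assume contra: "\<not> ?thesis"
  note B = csub_fixed_points
  have P: "P i \<in> A\<alpha>" "st (P i) = P i" "P i * P i = P i" for i
    using net by (auto simp: approx_net_def projection_in_def)
  have \<Phi>: "\<Phi> i x \<in> A\<alpha>" "norm (\<Phi> i x) \<le> 4 * norm x + 1" for i x
    using net by (auto simp: approx_net_def)
  define bad where "bad = {i. \<exists>\<sigma>\<in>traces A\<alpha>. cmod (\<sigma> (\<Phi> i z)) \<ge> \<epsilon>}"
  \<comment> \<open>Concentrate the filter on the indices where some trace violates the estimate; a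
    limit of these traces will be a trace of \<open>A\<close> that contradicts the assumption on
    \<open>z\<close>.\<close>
  define F' where "F' = inf \<F> (principal bad)"
  have F': "F' \<noteq> bot"
  proof
    assume "F' = bot"
    then have "eventually (\<lambda>i. i \<notin> bad) \<F>"
      unfolding F'_def trivial_limit_def eventually_inf_principal by simp
    then show False using contra by (auto simp: bad_def not_le elim: eventually_mono)
  qed
  have "\<forall>i\<in>bad. \<exists>\<sigma>\<in>traces A\<alpha>. cmod (\<sigma> (\<Phi> i z)) \<ge> \<epsilon>" by (simp add: bad_def)
  then obtain s where s: "\<And>i. i \<in> bad \<Longrightarrow> s i \<in> traces A\<alpha>" "\<And>i. i \<in> bad \<Longrightarrow> cmod (s i (\<Phi> i z)) \<ge> \<epsilon>"
    by metis
  \<comment> \<open>The division makes the functional take the value 1 at the asymptotic unit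
    \<open>P i\<close>; the lower bound 1/2 keeps the quotients bounded. Zero outside
    \<open>bad\<close> makes that bound hold for every index.\<close>
  define r where "r i w = (if i \<in> bad then s i w / s i (P i) else 0)" for i w
  have sP: "cmod (s i (P i)) \<ge> 1/2" "cmod (s i (P i)) \<le> 1" "s i (P i) = of_real (Re (s i (P i)))" "Re (s i (P i)) > 0"
    if "i \<in> bad" for i
  proof -
    show "cmod (s i (P i)) \<ge> 1/2" using half[OF s(1)[OF that], of i] complex_Re_le_cmod[of "s i (P i)"] by linarith
    show "cmod (s i (P i)) \<le> 1" using tr_norm_le[OF B s(1)[OF that] P(1)] projection_norm_le[OF P(2,3)] order_trans by blast
    show "s i (P i) = of_real (Re (s i (P i)))"
      using tr_Im[OF B s(1)[OF that] P(1), of i] P by (simp add: complex_eq_iff)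
    show "Re (s i (P i)) > 0" using half[OF s(1)[OF that], of i] by simp
  qed
  have r_add: "r i (v + w) = r i v + r i w" and r_comm: "r i (v * w) = r i (w * v)" and r_diff: "r i (v - w) = r i v - r i w"
    and r_sc: "r i (sc c v) = c * r i v"
    if "v \<in> A\<alpha>" "w \<in> A\<alpha>" for i v w c
  proof -
    have "r i (v + w) = r i v + r i w \<and> r i (v * w) = r i (w * v) \<and> r i (v - w) = r i v - r i w \<and> r i (sc c v) = c * r i v"
    proof (cases "i \<in> bad")
      case True
      note t = B s(1)[OF True]
      show ?thesis
        using True that by (simp add: r_def tr_add[OF t] tr_comm[OF t that] tr_sc[OF t] tr_diff[OF t]
            add_divide_distrib diff_divide_distrib)
    qed (simp add: r_def)
    then show "r i (v + w) = r i v + r i w" "r i (v * w) = r i (w * v)" "r i (v - w) = r i v - r i w"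
      "r i (sc c v) = c * r i v" by blast+
  qed
  have r_bd: "cmod (r i w) \<le> 2 * norm w" if "w \<in> A\<alpha>" for i w
  proof (cases "i \<in> bad")
    case True
    have "cmod (s i w) / cmod (s i (P i)) \<le> norm w / (1/2)"
      using tr_norm_le[OF B s(1)[OF True] that] sP(1)[OF True] by (intro frac_le) auto
    then show ?thesis using True by (simp add: r_def norm_divide)
  qed (simp add: r_def)
  have r_pos: "Im (r i (st w * w)) = 0 \<and> Re (r i (st w * w)) \<ge> 0" if "w \<in> A\<alpha>" for i w
  proof (cases "i \<in> bad")
    case True
    then show ?thesis
      using tr_Im[OF B s(1)[OF True] that] tr_Re[OF B s(1)[OF True] that] sP(4)[OF True]
      unfolding r_def by (subst (1 2) sP(3)[OF True]) simp
  qed (simp add: r_def)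
  have rb: "cmod (r i (\<Phi> i x)) \<le> 2 * (4 * norm x + 1)" for i x
    by (rule order_trans[OF r_bd[OF \<Phi>(1)] mult_left_mono[OF \<Phi>(2)]]) simp
  from F' rb obtain G \<rho> where G: "G \<le> F'" "G \<noteq> bot" and \<rho>: "\<And>x. ((\<lambda>i. r i (\<Phi> i x)) \<longlongrightarrow> \<rho> x) G"
    by (rule bounded_net_cluster[of F' "\<lambda>i x. r i (\<Phi> i x)"]) (rule that)
  have GF: "G \<le> \<F>" using G(1) by (simp add: F'_def)
  have Gbad: "eventually (\<lambda>i. i \<in> bad) G"
    using G(1) unfolding F'_def le_inf_iff le_principal by blast
  have r_asym: "((\<lambda>i. r i (W i) - r i (V i)) \<longlongrightarrow> 0) G"
    if W: "asym_eq \<F> W V" "\<And>i. W i \<in> A\<alpha>" "\<And>i. V i \<in> A\<alpha>" for W V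
  proof (rule Lim_null_comparison)
    show "eventually (\<lambda>i. norm (r i (W i) - r i (V i)) \<le> 2 * norm (W i - V i)) G"
      using r_bd[OF csub_diff[OF B W(2,3)]] r_diff[OF W(2,3)] by (simp add: always_eventually)
    show "((\<lambda>i. 2 * norm (W i - V i)) \<longlongrightarrow> 0) G"
      using tendsto_mono[OF GF W(1)[unfolded asym_eq_def]] by (intro tendsto_mult_right_zero tendsto_norm_zero)
  qed
  note BI = csub_intros[OF B] \<Phi>(1) P(1)
  have lim_unique: "\<rho> x = l" if "asym_eq \<F> (\<lambda>i. \<Phi> i x) V" "\<And>i. V i \<in> A\<alpha>" "((\<lambda>i. r i (V i)) \<longlongrightarrow> l) G" for x V l
  proof -
    have "((\<lambda>i. r i (\<Phi> i x)) \<longlongrightarrow> 0 + l) G"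
      using tendsto_add[OF r_asym[OF that(1) \<Phi>(1) that(2)] that(3)] by simp
    then show ?thesis using tendsto_unique[OF G(2) \<rho>] by simp
  qed
  have \<rho>_mult: "((\<lambda>i. r i (\<Phi> i x * \<Phi> i y)) \<longlongrightarrow> \<rho> (x * y)) G" for x y
  proof -
    have "asym_eq \<F> (\<lambda>i. \<Phi> i x * \<Phi> i y) (\<lambda>i. \<Phi> i (x * y))"
      by (rule asym_eq_sym[OF approx_net_mult[OF net]])
    from tendsto_add[OF r_asym[OF this] \<rho>[of "x * y"]] show ?thesis by (simp add: BI)
  qed
  have "\<rho> \<in> traces UNIV"
    unfolding tracial_states_def
  proof (intro CollectI conjI ballI allI)
    fix x y c
    show "\<rho> (x + y) = \<rho> x + \<rho> y"
    proof (rule lim_unique)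
      show "asym_eq \<F> (\<lambda>i. \<Phi> i (x + y)) (\<lambda>i. \<Phi> i x + \<Phi> i y)" by (rule approx_net_add[OF net])
      show "((\<lambda>i. r i (\<Phi> i x + \<Phi> i y)) \<longlongrightarrow> \<rho> x + \<rho> y) G"
        using tendsto_add[OF \<rho> \<rho>] by (simp add: r_add BI)
    qed (intro BI)
    show "\<rho> (sc c x) = c * \<rho> x"
    proof (rule lim_unique)
      show "asym_eq \<F> (\<lambda>i. \<Phi> i (sc c x)) (\<lambda>i. sc c (\<Phi> i x))" by (rule approx_net_sc[OF net])
      show "((\<lambda>i. r i (sc c (\<Phi> i x))) \<longlongrightarrow> c * \<rho> x) G"
        using tendsto_mult_left[OF \<rho>] by (simp add: r_sc[OF \<Phi>(1) \<Phi>(1)])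
    qed (intro BI)
    show "\<rho> (x * y) = \<rho> (y * x)"
      using tendsto_unique[OF G(2) \<rho>_mult[of x y]] \<rho>_mult[of y x] by (simp add: r_comm[OF \<Phi>(1) \<Phi>(1)])
    have lim: "((\<lambda>i. r i (st (\<Phi> i x) * \<Phi> i x)) \<longlongrightarrow> \<rho> (st x * x)) G"
    proof -
      have "asym_eq \<F> (\<lambda>i. st (\<Phi> i x) * \<Phi> i x) (\<lambda>i. \<Phi> i (st x) * \<Phi> i x)"
        by (intro asym_eq_mult asym_eq_refl bounded_fun_st bounded_funI[OF \<Phi>(2)] asym_eq_sym[OF approx_net_st[OF net]])
      from tendsto_add[OF r_asym[OF this] \<rho>_mult[of "st x" x]] show ?thesis by (simp add: BI)
    qed
    have "((\<lambda>i. 0) \<longlongrightarrow> Im (\<rho> (st x * x))) G"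
      using tendsto_Im[OF lim] r_pos[OF \<Phi>(1)] by simp
    then show "Im (\<rho> (st x * x)) = 0" using tendsto_unique[OF G(2)] tendsto_const by metis
    show "Re (\<rho> (st x * x)) \<ge> 0"
      by (rule tendsto_lowerbound[OF tendsto_Re[OF lim] _ G(2)]) (use r_pos[OF \<Phi>(1)] in \<open>simp add: always_eventually\<close>)
  next
    show "\<rho> 1 = 1"
    proof (rule lim_unique)
      show "asym_eq \<F> (\<lambda>i. \<Phi> i 1) P" by (rule approx_net_one[OF net])
      show "((\<lambda>i. r i (P i)) \<longlongrightarrow> 1) G"
        by (rule tendsto_eventually) (use Gbad in eventually_elim, use sP(1) in \<open>force simp: r_def\<close>)
    qed (rule P(1))
  qed
  from z[OF this] have "cmod (\<rho> z) < \<epsilon>" .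
  moreover have "cmod (\<rho> z) \<ge> \<epsilon>"
  proof (rule tendsto_lowerbound[OF tendsto_norm[OF \<rho>] _ G(2)])
    show "eventually (\<lambda>i. \<epsilon> \<le> cmod (r i (\<Phi> i z))) G"
      using Gbad
    proof eventually_elim
      case (elim i)
      \<comment> \<open>\<open>s i (P i)\<close> has modulus at most 1, so normalising can only
        enlarge the violation, and it survives in the limit.\<close>
      have "cmod (s i (\<Phi> i z)) * 1 \<le> cmod (s i (\<Phi> i z)) / cmod (s i (P i))"
        using sP(1,2)[OF elim] by (auto simp: divide_simps mult_le_cancel_left1 intro!: mult_left_le)
      then show ?case using s(2)[OF elim] elim by (simp add: r_def norm_divide)
    qed
  qed
  ultimately show False by simp
qed

end

section \<open>Uniform property Gamma and trace estimates\<close>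

context cstar_algebra
begin

text \<open>For \<open>c\<close> supported where \<open>d\<^sup>* d \<ge> t\<close>, this is \<open>t \<tau>(q) \<le> t d\<^sub>\<tau>(c\<^sup>2) \<le> \<tau>(d\<^sup>* d)\<close>, avoiding the dimension function \<open>d\<^sub>\<tau>\<close>.\<close>

lemma trace_of_cuntz:
  assumes B: "csub B" and \<tau>: "\<tau> \<in> traces B"
    and q: "projection_in st B q" and cz: "cuntz_below st B q (c * c)"
    and c: "c \<in> B" "st c = c" and d: "d \<in> B" and z: "z \<in> B"
    and eq: "c * (st d * d) * c - t *\<^sub>R (c * c) = st z * z"
  shows "t * Re (\<tau> q) \<le> Re (\<tau> (st d * d))"
proof -
  note T = B \<tau>
  obtain r where r: "\<And>n. r n \<in> B" and lim: "(\<lambda>n. norm (st (r n) * (c * c) * r n - q)) \<longlonglongrightarrow> 0"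
    using cz by (auto simp: cuntz_below_def)
  \<comment> \<open>Then \<open>st (w n) * w n\<close> converges to \<open>q\<close>, while
    compressing \<open>eq\<close> by \<open>r n\<close> bounds \<open>t\<close> times its trace by
    that of \<open>st (d * w n) * (d * w n)\<close>.\<close>
  define w where "w n = c * r n" for n
  define W where "W n = st (w n) * w n" for n
  have wB: "w n \<in> B" for n unfolding w_def by (intro csub_intros[OF B] c r)
  have WB: "W n \<in> B" for n unfolding W_def by (intro csub_intros[OF B] wB)
  have qB: "q \<in> B" using q by (simp add: projection_in_def)
  have "W = (\<lambda>n. st (r n) * (c * c) * r n)" by (simp add: fun_eq_iff W_def w_def st_mult c mult.assoc)
  then have Wlim: "W \<longlonglongrightarrow> q" using lim by (simp add: LIM_zero_iff tendsto_norm_zero_iff)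
  have tlim: "(\<lambda>n. \<tau> (W n)) \<longlonglongrightarrow> \<tau> q"
  proof (rule LIM_zero_cancel, rule Lim_null_comparison)
    show "eventually (\<lambda>n. norm (\<tau> (W n) - \<tau> q) \<le> norm (W n - q)) sequentially"
      using tr_norm_le[OF T csub_diff[OF B WB qB]] tr_diff[OF T WB qB] by simp
    show "(\<lambda>n. norm (W n - q)) \<longlonglongrightarrow> 0"
      using Wlim by (simp add: LIM_zero_iff tendsto_norm_zero_iff)
  qed
  have "t * Re (\<tau> (W n)) \<le> norm (W n) * Re (\<tau> (st d * d))" for n
  proof -
    have "st (z * r n) * (z * r n) = st (r n) * (c * (st d * d) * c - t *\<^sub>R (c * c)) * r n"
      unfolding eq by (simp add: st_mult mult.assoc)
    also have "\<dots> = st (d * w n) * (d * w n) - t *\<^sub>R W n"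
      by (simp add: W_def w_def st_mult c algebra_simps)
    finally have "0 \<le> Re (\<tau> (st (d * w n) * (d * w n) - t *\<^sub>R W n))"
      using tr_Re[OF T, of "z * r n"] by (simp add: csub_intros[OF B] z r)
    then have "t * Re (\<tau> (W n)) \<le> Re (\<tau> (st (d * w n) * (d * w n)))"
      by (simp add: tr_diff[OF T] tr_scaleR[OF T] csub_intros[OF B] d wB WB)
    \<comment> \<open>The trace property puts \<open>w n * st (w n)\<close> in the middle, where its
      norm can be split off. That norm is the norm of \<open>W n\<close>, which tends to
      \<open>norm q \<le> 1\<close>.\<close>
    also have "\<tau> (st (d * w n) * (d * w n)) = \<tau> ((d * w n) * st (d * w n))"
      by (rule tr_comm[OF T]) (intro csub_intros[OF B] d wB)+
    also have "(d * w n) * st (d * w n) = st (st d) * (st (st (w n)) * st (w n)) * st d"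
      by (simp add: st_mult mult.assoc)
    also have "Re (\<tau> \<dots>) \<le> (norm (w n))\<^sup>2 * Re (\<tau> (st (st d) * st d))"
      by (rule tr_contraction[OF T]) (auto intro!: csub_intros[OF B] d wB)
    also have "\<tau> (st (st d) * st d) = \<tau> (st d * d)"
      using tr_comm[OF T d csub_st[OF B d]] by simp
    finally show ?thesis by (simp add: W_def norm_st_mult)
  qed
  then have "t * Re (\<tau> q) \<le> norm q * Re (\<tau> (st d * d))"
    by (intro LIMSEQ_le[of "\<lambda>n. t * Re (\<tau> (W n))" _ "\<lambda>n. norm (W n) * Re (\<tau> (st d * d))"] tendsto_intros tlim Wlim) auto
  also have "\<dots> \<le> 1 * Re (\<tau> (st d * d))"
    using q projection_norm_le[of q] tr_Re[OF T d] by (intro mult_right_mono) (auto simp: projection_in_def)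
  finally show ?thesis by simp
qed

text \<open>Convergence to zero in the trace 2-norm, uniformly over all traces. This is membership
  in the trace kernel without limit traces, the form in which finitely many conditions can be met at
  a single index \<open>k\<close>.\<close>

definition tsmall :: "nat filter \<Rightarrow> (nat \<Rightarrow> 'a) \<Rightarrow> bool" where
  "tsmall F x \<longleftrightarrow> (\<forall>\<epsilon>>0. eventually (\<lambda>k. \<forall>\<tau>\<in>traces UNIV. Re (\<tau> (st (x k) * x k)) < \<epsilon>) F)"

lemma tsmall_add: assumes "tsmall F x" "tsmall F y" shows "tsmall F (\<lambda>k. x k + y k)"
  unfolding tsmall_def
proof (intro allI impI)
  fix \<epsilon> :: real assume "\<epsilon> > 0"
  then have "\<epsilon> / 4 > 0" by simp
  then have "eventually (\<lambda>k. \<forall>\<tau>\<in>traces UNIV. Re (\<tau> (st (x k) * x k)) < \<epsilon> / 4) F"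
    "eventually (\<lambda>k. \<forall>\<tau>\<in>traces UNIV. Re (\<tau> (st (y k) * y k)) < \<epsilon> / 4) F"
    using assms unfolding tsmall_def by blast+
  then show "eventually (\<lambda>k. \<forall>\<tau>\<in>traces UNIV. Re (\<tau> (st (x k + y k) * (x k + y k))) < \<epsilon>) F"
  proof eventually_elim
    case (elim k)
    show ?case
    proof
      fix \<tau> assume \<tau>: "\<tau> \<in> traces UNIV"
      have "Re (\<tau> (st (x k) * x k)) < \<epsilon> / 4" "Re (\<tau> (st (y k) * y k)) < \<epsilon> / 4" using elim \<tau> by blast+
      then show "Re (\<tau> (st (x k + y k) * (x k + y k))) < \<epsilon>"
        using tr_st_add_le[OF csub_UNIV \<tau>, of "x k" "y k"] by simp
    qed
  qed
qed

lemma tsmall_st: assumes "tsmall F x" shows "tsmall F (\<lambda>k. st (x k))"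
proof -
  have "(\<forall>\<tau>\<in>traces UNIV. Re (\<tau> (st (st a) * st a)) < \<epsilon>)
      \<longleftrightarrow> (\<forall>\<tau>\<in>traces UNIV. Re (\<tau> (st a * a)) < \<epsilon>)" for a \<epsilon>
    using tr_comm[OF csub_UNIV _ UNIV_I UNIV_I, of _ a "st a"] by (intro ball_cong refl) (metis st_st)
  then show ?thesis using assms unfolding tsmall_def by simp
qed

lemma tsmall_mult_left:
  assumes x: "tsmall F x" and a: "bounded_fun a" shows "tsmall F (\<lambda>k. a k * x k)"
proof -
  obtain K where K: "\<And>k. norm (a k) \<le> K" using a by (auto simp: bounded_fun_def)
  have "K \<ge> 0" using order_trans[OF norm_ge_zero K[of 0]] .
  show ?thesis
    unfolding tsmall_def
  proof (intro allI impI)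
    fix \<epsilon> :: real assume "\<epsilon> > 0"
    then have "\<epsilon> / (K\<^sup>2 + 1) > 0" by (simp add: add_nonneg_pos)
    then have "eventually (\<lambda>k. \<forall>\<tau>\<in>traces UNIV. Re (\<tau> (st (x k) * x k)) < \<epsilon> / (K\<^sup>2 + 1)) F"
      using x unfolding tsmall_def by blast
    then show "eventually (\<lambda>k. \<forall>\<tau>\<in>traces UNIV. Re (\<tau> (st (a k * x k) * (a k * x k))) < \<epsilon>) F"
    proof eventually_elim
      case (elim k)
      show ?case
      proof
        fix \<tau> assume \<tau>: "\<tau> \<in> traces UNIV"
        have "st (a k * x k) * (a k * x k) = st (x k) * (st (a k) * a k) * x k" by (simp add: st_mult mult.assoc)
        then have "Re (\<tau> (st (a k * x k) * (a k * x k))) \<le> K\<^sup>2 * Re (\<tau> (st (x k) * x k))"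
          using tr_contraction[OF csub_UNIV \<tau> UNIV_I K[of k] UNIV_I, of "x k"] by simp
        also have "\<dots> \<le> K\<^sup>2 * (\<epsilon> / (K\<^sup>2 + 1))" using elim \<tau> by (intro mult_left_mono) (auto intro: less_imp_le)
        also have "\<dots> < \<epsilon>" using \<open>\<epsilon> > 0\<close> add_nonneg_pos[of "K\<^sup>2" 1] by (simp add: field_simps)
        finally show "Re (\<tau> (st (a k * x k) * (a k * x k))) < \<epsilon>" .
      qed
    qed
  qed
qed

lemma tsmall_mult_right:
  assumes "tsmall F x" "bounded_fun a" shows "tsmall F (\<lambda>k. x k * a k)"
  using tsmall_st[OF tsmall_mult_left[OF tsmall_st[OF assms(1)] bounded_fun_st[OF assms(2)]]] by (simp add: st_mult)

lemma tsmall_trace: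
  assumes x: "tsmall F x" and \<epsilon>: "\<epsilon> > 0"
  shows "eventually (\<lambda>k. \<forall>\<tau>\<in>traces UNIV. cmod (\<tau> (x k)) < \<epsilon>) F"
proof -
  have "\<epsilon>\<^sup>2 > 0" using \<epsilon> by simp
  then have "eventually (\<lambda>k. \<forall>\<tau>\<in>traces UNIV. Re (\<tau> (st (x k) * x k)) < \<epsilon>\<^sup>2) F"
    using x unfolding tsmall_def by blast
  then show ?thesis
  proof eventually_elim
    case (elim k)
    show ?case
    proof
      fix \<tau> assume \<tau>: "\<tau> \<in> traces UNIV"
      have "(cmod (\<tau> (x k)))\<^sup>2 \<le> Re (\<tau> (st (x k) * x k))"
        using tr_Cauchy_Schwarz[OF csub_UNIV \<tau>, of "x k" 1] tr_one[OF csub_UNIV \<tau>] by simp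
      also have "\<dots> < \<epsilon>\<^sup>2" using elim \<tau> by blast
      finally show "cmod (\<tau> (x k)) < \<epsilon>" by (rule power2_less_imp_less) (use \<epsilon> in simp)
    qed
  qed
qed

text \<open>If uniformity failed, the ultrafilter would contain the set of bad indices; choosing a
  violating trace at each of them gives a sequence of traces whose limit is not 0.\<close>

lemma uniform_of_lim:
  assumes \<omega>: "free_ultrafilter \<omega>" and T: "T \<noteq> {}"
    and bounded_fun: "\<And>k \<tau>. \<tau> \<in> T \<Longrightarrow> cmod (f k \<tau>) \<le> K"
    and lim: "\<And>\<tau>s. (\<forall>n. \<tau>s n \<in> T) \<Longrightarrow> Lim \<omega> (\<lambda>k. f k (\<tau>s k)) = 0" and \<epsilon>: "\<epsilon> > 0"
  shows "eventually (\<lambda>k. \<forall>\<tau>\<in>T. cmod (f k \<tau>) < \<epsilon>) \<omega>"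
proof (rule ccontr)
  assume "\<not> ?thesis"
  then have ev: "eventually (\<lambda>k. \<not> (\<forall>\<tau>\<in>T. cmod (f k \<tau>) < \<epsilon>)) \<omega>"
    using \<omega> by (auto simp: free_ultrafilter_def)
  have "\<exists>\<tau>. \<tau> \<in> T \<and> ((\<not> (\<forall>\<tau>\<in>T. cmod (f k \<tau>) < \<epsilon>)) \<longrightarrow> \<not> cmod (f k \<tau>) < \<epsilon>)" for k
    using T by blast
  then obtain \<tau>s where \<tau>s: "\<And>k. \<tau>s k \<in> T" "\<And>k. (\<not> (\<forall>\<tau>\<in>T. cmod (f k \<tau>) < \<epsilon>)) \<Longrightarrow> \<not> cmod (f k (\<tau>s k)) < \<epsilon>"
    by metis
  have "((\<lambda>k. f k (\<tau>s k)) \<longlongrightarrow> 0) \<omega>"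
    using ultrafilter_bounded_convergent[OF \<omega>, of "\<lambda>k. f k (\<tau>s k)" K] bounded_fun lim[of \<tau>s] \<tau>s(1) by simp
  then have "eventually (\<lambda>k. cmod (f k (\<tau>s k)) < \<epsilon>) \<omega>" using \<epsilon> by (auto simp: tendsto_iff dist_norm)
  with ev have "eventually (\<lambda>_. False) \<omega>" by eventually_elim (use \<tau>s(2) in blast)
  then show False using \<omega> by (simp add: free_ultrafilter_def trivial_limit_def)
qed

lemma bseq_in_bounded_fun: "bseq_in B x \<Longrightarrow> bounded_fun x"
  by (auto simp: bseq_in_def bounded_iff bounded_fun_def)

lemma eq_tu_tsmall:
  assumes \<omega>: "free_ultrafilter \<omega>" and T: "traces UNIV \<noteq> {}" and eq: "eq_tu \<omega> sc st UNIV x y"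
  shows "tsmall \<omega> (\<lambda>k. x k - y k)"
  unfolding tsmall_def
proof (intro allI impI)
  fix \<epsilon> :: real assume \<epsilon>: "\<epsilon> > 0"
  define z where "z k = x k - y k" for k
  have z: "bounded_fun z" "\<And>\<tau>s. (\<forall>n. \<tau>s n \<in> traces UNIV) \<Longrightarrow> Lim \<omega> (\<lambda>k. \<tau>s k (st (z k) * z k)) = 0"
    using eq bseq_in_bounded_fun unfolding eq_tu_def trace_kernel_def lim_trace_def z_def by blast+
  obtain K where K: "\<And>k. norm (z k) \<le> K" using z(1) by (auto simp: bounded_fun_def)
  have bounded_fun: "cmod (\<tau> (st (z k) * z k)) \<le> K\<^sup>2" if "\<tau> \<in> traces UNIV" for k \<tau>
    using order_trans[OF tr_norm_le[OF csub_UNIV that UNIV_I]] norm_st_mult power_mono[OF K norm_ge_zero] by metis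
  have "eventually (\<lambda>k. \<forall>\<tau>\<in>traces UNIV. cmod (\<tau> (st (z k) * z k)) < \<epsilon>) \<omega>"
    by (rule uniform_of_lim[OF \<omega> T bounded_fun z(2) \<epsilon>])
  then have "eventually (\<lambda>k. \<forall>\<tau>\<in>traces UNIV. Re (\<tau> (st (z k) * z k)) < \<epsilon>) \<omega>"
    by eventually_elim (meson complex_Re_le_cmod le_less_trans)
  then show "eventually (\<lambda>k. \<forall>\<tau>\<in>traces UNIV. Re (\<tau> (st (x k - y k) * (x k - y k))) < \<epsilon>) \<omega>"
    by (simp add: z_def)
qed

lemma gamma_sequences:
  assumes \<omega>: "free_ultrafilter \<omega>" and gamma: "uniform_gamma \<omega> sc st UNIV" and m: "m \<ge> 1"
  obtains p :: "nat \<Rightarrow> nat \<Rightarrow> 'a" where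
    "\<And>i. i < m \<Longrightarrow> bounded_fun (p i)"
    "\<And>i. i < m \<Longrightarrow> tsmall \<omega> (\<lambda>k. st (p i k) - p i k)"
    "\<And>i. i < m \<Longrightarrow> tsmall \<omega> (\<lambda>k. p i k * p i k - p i k)"
    "\<And>i a. i < m \<Longrightarrow> tsmall \<omega> (\<lambda>k. p i k * a - a * p i k)"
    "tsmall \<omega> (\<lambda>k. (\<Sum>i<m. p i k) - 1)"
    "\<And>i a \<epsilon>. i < m \<Longrightarrow> \<epsilon> > 0 \<Longrightarrow>
      eventually (\<lambda>k. \<forall>\<tau>\<in>traces UNIV. cmod (\<tau> (a * p i k) - \<tau> a / of_nat m) < \<epsilon>) \<omega>"
proof -
  have T: "traces UNIV \<noteq> {}"
    using gamma by (auto simp: uniform_gamma_def trace_space_def)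
  have nb: "\<omega> \<noteq> bot" using \<omega> by (simp add: free_ultrafilter_def)
  obtain p :: "nat \<Rightarrow> nat \<Rightarrow> 'a" where p:
    "\<forall>i<m. bseq_in UNIV (p i)"
    "\<forall>i<m. eq_tu \<omega> sc st UNIV (\<lambda>k. st (p i k)) (p i)"
    "\<forall>i<m. eq_tu \<omega> sc st UNIV (\<lambda>k. p i k * p i k) (p i)"
    "\<forall>i<m. \<forall>a\<in>UNIV. eq_tu \<omega> sc st UNIV (\<lambda>k. p i k * a) (\<lambda>k. a * p i k)"
    "eq_tu \<omega> sc st UNIV (\<lambda>k. \<Sum>i<m. p i k) (\<lambda>k. 1)"
    "\<forall>i<m. \<forall>a\<in>UNIV. \<forall>\<tau>s. (\<forall>n. \<tau>s n \<in> traces UNIV) \<longrightarrow>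
            lim_trace \<omega> \<tau>s (\<lambda>k. a * p i k) = lim_trace \<omega> \<tau>s (\<lambda>k. a) / of_nat m"
    using gamma[unfolded uniform_gamma_def, THEN conjunct2, THEN conjunct2, THEN spec, THEN mp, OF m]
    by (elim exE conjE) (rule that; assumption)
  have 6: "eventually (\<lambda>k. \<forall>\<tau>\<in>traces UNIV. cmod (\<tau> (a * p i k) - \<tau> a / of_nat m) < \<epsilon>) \<omega>"
    if i: "i < m" and \<epsilon>: "\<epsilon> > 0" for i a and \<epsilon> :: real
  proof -
    have "bseq_in UNIV (p i)" using p(1) i by blast
    then have "bounded_fun (p i)" by (rule bseq_in_bounded_fun)
    then obtain K where K: "\<And>k. norm (p i k) \<le> K" unfolding bounded_fun_def by blast
    have b1: "cmod (\<tau> (a * p i k)) \<le> norm a * K" if "\<tau> \<in> traces UNIV" for \<tau> k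
    proof -
      have "cmod (\<tau> (a * p i k)) \<le> norm (a * p i k)" by (rule tr_norm_le[OF csub_UNIV that UNIV_I])
      also have "\<dots> \<le> norm a * norm (p i k)" by (rule norm_mult_ineq)
      also have "\<dots> \<le> norm a * K" by (intro mult_left_mono K) simp
      finally show ?thesis .
    qed
    have b2: "cmod (\<tau> a) \<le> norm a" if "\<tau> \<in> traces UNIV" for \<tau>
      by (rule tr_norm_le[OF csub_UNIV that UNIV_I])
    show ?thesis
    proof (rule uniform_of_lim[OF \<omega> T _ _ \<epsilon>])
      show "cmod (\<tau> (a * p i k) - \<tau> a / of_nat m) \<le> norm a * K + norm a"
        if "\<tau> \<in> traces UNIV" for k \<tau>
      proof -
        have "cmod (\<tau> a / of_nat m) \<le> norm a"
        proof -
          have "cmod (\<tau> a / of_nat m) = cmod (\<tau> a) / real m" by (simp add: norm_divide)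
          also have "\<dots> \<le> cmod (\<tau> a) / 1" using m by (intro divide_left_mono) auto
          finally show ?thesis using b2[OF that] by simp
        qed
        then show ?thesis using b1[OF that, of k] by (intro norm_triangle_le_diff add_mono)
      qed
      fix \<tau>s :: "nat \<Rightarrow> 'a \<Rightarrow> complex" assume \<tau>s: "\<forall>n. \<tau>s n \<in> traces UNIV"
      have "((\<lambda>k. \<tau>s k (a * p i k)) \<longlongrightarrow> Lim \<omega> (\<lambda>k. \<tau>s k (a * p i k))) \<omega>"
        by (rule ultrafilter_bounded_convergent[OF \<omega>]) (rule b1, use \<tau>s in blast)
      moreover have "((\<lambda>k. \<tau>s k a) \<longlongrightarrow> Lim \<omega> (\<lambda>k. \<tau>s k a)) \<omega>"
        by (rule ultrafilter_bounded_convergent[OF \<omega>]) (rule b2, use \<tau>s in blast)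
      ultimately have "((\<lambda>k. \<tau>s k (a * p i k) - \<tau>s k a / of_nat m) \<longlongrightarrow>
          Lim \<omega> (\<lambda>k. \<tau>s k (a * p i k)) - Lim \<omega> (\<lambda>k. \<tau>s k a) / of_nat m) \<omega>"
        using m by (intro tendsto_intros) auto
      moreover have "Lim \<omega> (\<lambda>k. \<tau>s k (a * p i k)) = Lim \<omega> (\<lambda>k. \<tau>s k a) / of_nat m"
        using p(6) i \<tau>s by (simp add: lim_trace_def)
      ultimately show "Lim \<omega> (\<lambda>k. \<tau>s k (a * p i k) - \<tau>s k a / of_nat m) = 0"
        using tendsto_Lim[OF nb] by simp
    qed
  qed
  show ?thesis
    by (rule that[of p]) (use p(1-5) bseq_in_bounded_fun eq_tu_tsmall[OF \<omega> T] 6 in blast)+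
qed

end

section \<open>Images of elements of \<open>A\<close> under an asymptotic homomorphism\<close>

context rokhlin_system
begin

text \<open>\<open>X\<close> may be any bounded representative in \<open>A\<alpha>\<close> of the
  asymptotic image of \<open>x\<close>. This freedom lets \<open>a * \<Phi> i q\<close> represent
  the image of \<open>a * q\<close>, although the image of a fixed \<open>a\<close> is
  \<open>a * P i\<close>.\<close>

definition tracks :: "'i filter \<Rightarrow> ('i \<Rightarrow> 'a \<Rightarrow> 'a) \<Rightarrow> 'a \<Rightarrow> ('i \<Rightarrow> 'a) \<Rightarrow> bool" where
  "tracks \<F> \<Phi> x X \<longleftrightarrow> asym_eq \<F> (\<lambda>i. \<Phi> i x) X \<and> bounded_fun X \<and> (\<forall>i. X i \<in> A\<alpha>)"

context
  fixes \<F> :: "'i filter" and P \<Phi>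
  assumes net: "approx_net \<F> P \<Phi>"
begin

lemma net_P: "P i \<in> A\<alpha>" "st (P i) = P i" "P i * P i = P i" "norm (P i) \<le> 1" "bounded_fun P"
proof -
  show *: "P i \<in> A\<alpha>" "st (P i) = P i" "P i * P i = P i" for i
    using approx_netD(1)[OF net, of i] by (auto simp: projection_in_def)
  show **: "norm (P i) \<le> 1" for i by (rule projection_norm_le[OF *(2,3)])
  show "bounded_fun P" by (rule bounded_funI[OF **])
qed

lemma tracks_self: "tracks \<F> \<Phi> x (\<lambda>i. \<Phi> i x)"
  unfolding tracks_def using approx_netD[OF net] bounded_funI[OF approx_netD(3)[OF net]] by auto

lemma tracks_bounded_fun: "tracks \<F> \<Phi> x X \<Longrightarrow> bounded_fun X"
  by (simp add: tracks_def)

lemma tracks_cong: "tracks \<F> \<Phi> x X \<Longrightarrow> asym_eq \<F> X Y \<Longrightarrow> bounded_fun Y \<Longrightarrow> (\<And>i. Y i \<in> A\<alpha>) \<Longrightarrow> tracks \<F> \<Phi> x Y"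
  unfolding tracks_def using asym_eq_trans by blast

lemma tracks_add: "tracks \<F> \<Phi> x X \<Longrightarrow> tracks \<F> \<Phi> y Y \<Longrightarrow> tracks \<F> \<Phi> (x + y) (\<lambda>i. X i + Y i)"
  unfolding tracks_def
  by (intro conjI allI bounded_fun_add csub_add[OF csub_fixed_points] asym_eq_trans[OF approx_net_add[OF net]] asym_eq_add; blast)

lemma tracks_mult: "tracks \<F> \<Phi> x X \<Longrightarrow> tracks \<F> \<Phi> y Y \<Longrightarrow> tracks \<F> \<Phi> (x * y) (\<lambda>i. X i * Y i)"
  unfolding tracks_def
  by (intro conjI allI bounded_fun_mult csub_mult[OF csub_fixed_points] asym_eq_trans[OF approx_net_mult[OF net]] asym_eq_mult
      bounded_funI[OF approx_netD(3)[OF net]]; blast)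

lemma tracks_sc: "tracks \<F> \<Phi> x X \<Longrightarrow> tracks \<F> \<Phi> (sc c x) (\<lambda>i. sc c (X i))"
proof -
  have "bounded_fun X \<Longrightarrow> bounded_fun (\<lambda>i. sc c (X i))"
    unfolding bounded_fun_def by (metis mult_left_mono norm_ge_zero norm_sc)
  then show "tracks \<F> \<Phi> x X \<Longrightarrow> tracks \<F> \<Phi> (sc c x) (\<lambda>i. sc c (X i))"
    unfolding tracks_def
    using csub_sc[OF csub_fixed_points] asym_eq_trans[OF approx_net_sc[OF net]] asym_eq_sc by blast
qed

lemma tracks_st: "tracks \<F> \<Phi> x X \<Longrightarrow> tracks \<F> \<Phi> (st x) (\<lambda>i. st (X i))"
  unfolding tracks_def
  using csub_st[OF csub_fixed_points] asym_eq_trans[OF approx_net_st[OF net]] asym_eq_st bounded_fun_st by blast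

lemma tracks_scaleR: "tracks \<F> \<Phi> x X \<Longrightarrow> tracks \<F> \<Phi> (r *\<^sub>R x) (\<lambda>i. r *\<^sub>R X i)"
  using tracks_sc[of x X "of_real r"] by (simp add: sc_of_real)

lemma tracks_diff: "tracks \<F> \<Phi> x X \<Longrightarrow> tracks \<F> \<Phi> y Y \<Longrightarrow> tracks \<F> \<Phi> (x - y) (\<lambda>i. X i - Y i)"
  using tracks_add[of x X "(-1) *\<^sub>R y" "\<lambda>i. (-1) *\<^sub>R Y i"] tracks_scaleR[of y Y "-1"] by simp

lemma tracks_one: "tracks \<F> \<Phi> 1 P"
  unfolding tracks_def using approx_net_one[OF net] net_P by blast

lemma tracks_zero: "tracks \<F> \<Phi> 0 (\<lambda>_. 0)"
  using tracks_sc[OF tracks_one, of 0] by simp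

lemma tracks_sum: "(\<And>j. j \<in> J \<Longrightarrow> tracks \<F> \<Phi> (x j) (X j)) \<Longrightarrow> tracks \<F> \<Phi> (\<Sum>j\<in>J. x j) (\<lambda>i. \<Sum>j\<in>J. X j i)"
  by (induction J rule: infinite_finite_induct) (auto intro: tracks_zero tracks_add)

lemma tracks_fixed: assumes "a \<in> A\<alpha>" shows "tracks \<F> \<Phi> a (\<lambda>i. a * P i)" "tracks \<F> \<Phi> a (\<lambda>i. P i * a)"
proof -
  have *: "tracks \<F> \<Phi> a (\<lambda>i. a * P i)" if "a \<in> A\<alpha>" for a
    unfolding tracks_def
    by (intro conjI allI approx_net_fixed[OF net that] bounded_fun_mult bounded_fun_const csub_mult[OF csub_fixed_points that] net_P)
  show "tracks \<F> \<Phi> a (\<lambda>i. a * P i)" by (rule *[OF assms])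
  have "tracks \<F> \<Phi> (st (st a)) (\<lambda>i. st (st a * P i))"
    by (rule tracks_st[OF *[OF csub_st[OF csub_fixed_points assms]]])
  then show "tracks \<F> \<Phi> a (\<lambda>i. P i * a)" by (simp add: st_mult net_P)
qed

lemma tracks_trace:
  assumes nb: "\<F> \<noteq> bot" and x: "tracks \<F> \<Phi> x X"
    and half: "\<And>i \<sigma>. \<sigma> \<in> traces A\<alpha> \<Longrightarrow> Re (\<sigma> (P i)) \<ge> 1/2"
    and z: "\<And>\<tau>. \<tau> \<in> traces UNIV \<Longrightarrow> cmod (\<tau> x) < \<epsilon>" and \<epsilon>: "\<epsilon> > 0"
  shows "eventually (\<lambda>i. \<forall>\<sigma>\<in>traces A\<alpha>. cmod (\<sigma> (X i)) < 2 * \<epsilon>) \<F>"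
proof -
  note B = csub_fixed_points
  have "asym_eq \<F> (\<lambda>i. \<Phi> i x) X" and XB: "\<And>i. X i \<in> A\<alpha>" using x by (auto simp: tracks_def)
  note tr = this(1)
  have "eventually (\<lambda>i. \<forall>\<sigma>\<in>traces A\<alpha>. cmod (\<sigma> (\<Phi> i x)) < \<epsilon>) \<F>"
    by (rule trace_transfer[OF nb net]) (rule half z; assumption)+
  from this asym_eq_eventually[OF asym_eq_sym[OF tr] \<epsilon>] show ?thesis
  proof eventually_elim
    case (elim i)
    show ?case
    proof
      fix \<sigma> assume \<sigma>: "\<sigma> \<in> traces A\<alpha>"
      note \<Phi>B = approx_netD(2)[OF net, of i x]
      have "cmod (\<sigma> (X i) - \<sigma> (\<Phi> i x)) \<le> norm (X i - \<Phi> i x)"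
        using tr_norm_le[OF B \<sigma> csub_diff[OF B XB \<Phi>B]] tr_diff[OF B \<sigma> XB \<Phi>B] by simp
      moreover have "cmod (\<sigma> (\<Phi> i x)) < \<epsilon>" using elim(1) \<sigma> by blast
      ultimately show "cmod (\<sigma> (X i)) < 2 * \<epsilon>"
        using elim(2) norm_triangle_sub[of "\<sigma> (X i)" "\<sigma> (\<Phi> i x)"] by linarith
    qed
  qed
qed

end

text \<open>Since \<open>p = p * p\<close>, comparison gives \<sigma>(1 - p) \<le> \<sigma>(p): in
  \<open>trace_of_cuntz\<close> take \<open>c = d = p\<close> and \<open>t = 1\<close>, where the
  required identity holds with \<open>z = 0\<close>.\<close>

lemma trace_half:
  assumes P: "projection_in st A\<alpha> p" and cz: "cuntz_below st A\<alpha> (1 - p) p"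
    and \<sigma>: "\<sigma> \<in> traces A\<alpha>"
  shows "Re (\<sigma> p) \<ge> 1/2"
proof -
  note B = csub_fixed_points
  have p: "p \<in> A\<alpha>" "st p = p" "p * p = p" using P by (auto simp: projection_in_def)
  have "1 - p \<in> A\<alpha>" using p by (intro csub_intros[OF B])
  then have "projection_in st A\<alpha> (1 - p)"
    using p by (auto simp: projection_in_def st_diff algebra_simps)
  then have "1 * Re (\<sigma> (1 - p)) \<le> Re (\<sigma> (st p * p))"
    using cz p by (intro trace_of_cuntz[OF B \<sigma>, where c = p and z = 0]) (auto simp: csub_zero[OF B])
  then show ?thesis using p by (simp add: tr_diff[OF B \<sigma>] tr_one[OF B \<sigma>] csub_one[OF B])
qed

end

section \<open>Projections in the fixed point algebra\<close>

context cstar_algebra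
begin

lemma tr_cmod_st_mult:
  assumes "csub B" "\<tau> \<in> traces B" "x \<in> B"
  shows "cmod (\<tau> (st x * x)) = Re (\<tau> (st x * x))"
  using tr_Im[OF assms] tr_Re[OF assms] by (simp add: cmod_def)

lemma trace_restrict: "\<tau> \<in> traces UNIV \<Longrightarrow> \<tau> \<in> traces B"
  by (auto simp: tracial_states_def)

end

context rokhlin_system
begin

lemma tracks_square_small:
  assumes net: "approx_net \<F> P \<Phi>" and nb: "\<F> \<noteq> bot" and x: "tracks \<F> \<Phi> x X"
    and half: "\<And>i \<sigma>. \<sigma> \<in> traces A\<alpha> \<Longrightarrow> Re (\<sigma> (P i)) \<ge> 1/2"
    and small: "\<And>\<tau>. \<tau> \<in> traces UNIV \<Longrightarrow> Re (\<tau> (st x * x)) < \<epsilon>" and \<epsilon>: "\<epsilon> > 0"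
  shows "eventually (\<lambda>i. \<forall>\<sigma>\<in>traces A\<alpha>. Re (\<sigma> (st (X i) * X i)) < 2 * \<epsilon>) \<F>"
proof -
  have "eventually (\<lambda>i. \<forall>\<sigma>\<in>traces A\<alpha>. cmod (\<sigma> (st (X i) * X i)) < 2 * \<epsilon>) \<F>"
  proof (rule tracks_trace[OF net nb tracks_mult[OF net tracks_st[OF net x] x] _ _ \<epsilon>])
    show "cmod (\<tau> (st x * x)) < \<epsilon>" if "\<tau> \<in> traces UNIV" for \<tau>
      using tr_cmod_st_mult[OF csub_UNIV that UNIV_I, of x] small[OF that] by simp
  qed (rule half)
  then show ?thesis by eventually_elim (meson complex_Re_le_cmod le_less_trans)
qed

text \<open>The pushed-forward \<open>b \<approx> \<phi>(q)\<close> of one of the projections of property \<open>\<Gamma>\<close> has trace about \<open>1 / m\<close>, and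
  \<open>b\<^sup>2\<close> has about the same trace as \<open>b\<close>; hence \<open>(b - 1/2)\<^sub>+\<close> is nonzero but uniformly small in trace.
  This takes the place of simplicity of \<open>A\<^sup>\<alpha>\<close>.\<close>

lemma small_fixed_element:
  assumes \<omega>: "free_ultrafilter \<omega>" and gamma: "uniform_gamma \<omega> sc st UNIV" and \<delta>: "\<delta> > 0"
  shows "\<exists>y. positive_in st A\<alpha> y \<and> y \<noteq> 0 \<and> (\<forall>\<sigma>\<in>traces A\<alpha>. \<forall>q. projection_in st A\<alpha> q \<longrightarrow>
    cuntz_below st A\<alpha> q y \<longrightarrow> Re (\<sigma> q) \<le> \<delta>)"
proof -
  note B = csub_fixed_points
  obtain m :: nat where m: "m \<ge> 1" "4 / real m \<le> \<delta>"
  proof -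
    obtain m :: nat where "real m > max 1 (4 / \<delta>)" using reals_Archimedean2 by blast
    then show ?thesis using that[of m] \<delta> by (simp add: field_simps)
  qed
  \<comment> \<open>Two requirements fix \<open>e\<close>: the case \<open>c = 0\<close> below would
    give \<sigma>(P) \<le> 6 e m = 3/8, which is less than 1/2, and the final bound requires
    \<open>1 / m + 2 * e \<le> 2 / m\<close>.\<close>
  define e where "e = 1 / (16 * real m)"
  have e: "e > 0" "e * real m = 1 / 16" using m by (simp_all add: e_def)
  obtain p :: "nat \<Rightarrow> nat \<Rightarrow> 'a" where ps:
    "\<And>i. i < m \<Longrightarrow> bounded_fun (p i)"
    "\<And>i. i < m \<Longrightarrow> tsmall \<omega> (\<lambda>k. st (p i k) - p i k)"
    "\<And>i. i < m \<Longrightarrow> tsmall \<omega> (\<lambda>k. p i k * p i k - p i k)"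
    "\<And>i a. i < m \<Longrightarrow> tsmall \<omega> (\<lambda>k. p i k * a - a * p i k)"
    "tsmall \<omega> (\<lambda>k. (\<Sum>i<m. p i k) - 1)"
    "\<And>i a \<epsilon>. i < m \<Longrightarrow> \<epsilon> > 0 \<Longrightarrow>
      eventually (\<lambda>k. \<forall>\<tau>\<in>traces UNIV. cmod (\<tau> (a * p i k) - \<tau> a / of_nat m) < \<epsilon>) \<omega>"
    by (rule gamma_sequences[OF \<omega> gamma m(1)]) (rule that; assumption)
  have "0 < m" using m by simp
  note p = ps(1)[OF this] ps(2)[OF this] ps(3)[OF this] ps(6)[OF this]
  define q where "q = p 0"
  \<comment> \<open>\<open>q k\<close> is only close to a projection in trace. \<open>h k\<close> is
    exactly of the form \<open>st x * x\<close>, a form the image can keep, and is still close to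
    \<open>q k\<close> and to its own square.\<close>
  define h where "h k = st (q k) * q k" for k
  have "bounded_fun q" using p(1) by (simp add: q_def)
  moreover from this have "bounded_fun h" unfolding h_def by (intro bounded_fun_mult bounded_fun_st)
  ultimately have bq: "bounded_fun q" "bounded_fun h" .
  have "tsmall \<omega> (\<lambda>k. (st (q k) - q k) * q k + (q k * q k - q k))"
    using p bq by (intro tsmall_add tsmall_mult_right) (simp_all add: q_def)
  then have h1: "tsmall \<omega> (\<lambda>k. h k - q k)" by (simp add: h_def algebra_simps)
  have "tsmall \<omega> (\<lambda>k. h k * (h k - q k) + st (q k) * (q k * q k - q k))"
    using p bq h1 bounded_fun_st[OF bq(1)] by (intro tsmall_add tsmall_mult_left) (simp_all add: q_def)
  then have h2: "tsmall \<omega> (\<lambda>k. h k * h k - h k)" by (simp add: h_def algebra_simps)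
  have e3: "e / 3 > 0" using e by simp
  have "eventually (\<lambda>k. (\<forall>\<tau>\<in>traces UNIV. cmod (\<tau> (h k - q k)) < e / 3) \<and>
    (\<forall>\<tau>\<in>traces UNIV. cmod (\<tau> (h k * h k - h k)) < e / 3) \<and>
    (\<forall>\<tau>\<in>traces UNIV. cmod (\<tau> (1 * q k) - \<tau> 1 / of_nat m) < e / 3)) \<omega>"
    unfolding q_def by (intro eventually_conj tsmall_trace[OF h1[unfolded q_def] e3] tsmall_trace[OF h2 e3] p(4) e3)
  moreover have "\<omega> \<noteq> bot" using \<omega> by (simp add: free_ultrafilter_def)
  ultimately obtain k where k: "\<forall>\<tau>\<in>traces UNIV. cmod (\<tau> (h k - q k)) < e / 3"
    "\<forall>\<tau>\<in>traces UNIV. cmod (\<tau> (h k * h k - h k)) < e / 3"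
    "\<forall>\<tau>\<in>traces UNIV. cmod (\<tau> (1 * q k) - \<tau> 1 / of_nat m) < e / 3"
    using eventually_happens' by blast
  have z: "cmod (\<tau> (h k - (1 / m) *\<^sub>R 1)) < e \<and> cmod (\<tau> (h k * h k - (1 / m) *\<^sub>R 1)) < e"
    if \<tau>: "\<tau> \<in> traces UNIV" for \<tau>
  proof -
    note U = csub_UNIV \<tau>
    have "\<tau> (h k) - \<tau> (q k) = \<tau> (h k - q k)" "\<tau> (h k * h k) - \<tau> (h k) = \<tau> (h k * h k - h k)"
      by (simp_all add: tr_diff[OF U])
    then have "cmod (\<tau> (h k) - \<tau> (q k)) < e / 3" "cmod (\<tau> (h k * h k) - \<tau> (h k)) < e / 3"
      "cmod (\<tau> (q k) - 1 / of_nat m) < e / 3"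
      using k \<tau> tr_one[OF U] by auto
    then have "cmod (\<tau> (h k) - 1 / of_nat m) < e" "cmod (\<tau> (h k * h k) - 1 / of_nat m) < e"
      by (norm)+
    then show ?thesis by (simp add: tr_diff[OF U] tr_scaleR[OF U] tr_one[OF U])
  qed
  have one: "positive_in st A\<alpha> 1"
    unfolding positive_in_def by (rule bexI[of _ 1]) (auto simp: csub_one[OF B])
  obtain P \<Phi> where net: "approx_net (approx_filter :: ('a set \<times> nat) filter) P \<Phi>"
    and cz: "\<And>i. cuntz_below st A\<alpha> (1 - P i) (P i)"
    by (rule approx_net_exists[OF one one_neq_zero]) (rule that)
  have half: "Re (\<sigma> (P i)) \<ge> 1/2" if "\<sigma> \<in> traces A\<alpha>" for i \<sigma>
    using trace_half[OF approx_netD(1)[OF net] cz that] .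
  note t = tracks_self[OF net, of "q k"]
  define b where "b i = st (\<Phi> i (q k)) * \<Phi> i (q k)" for i
  have tb: "tracks approx_filter \<Phi> (h k) b"
    unfolding h_def b_def by (intro tracks_mult[OF net] tracks_st[OF net] t)
  have ev: "eventually (\<lambda>i. \<forall>\<sigma>\<in>traces A\<alpha>. cmod (\<sigma> (X i)) < 2 * e) approx_filter"
    if "tracks approx_filter \<Phi> x X" "\<And>\<tau>. \<tau> \<in> traces UNIV \<Longrightarrow> cmod (\<tau> x) < e" for x X
    by (rule tracks_trace[OF net approx_filter_neq_bot that(1) _ _ e(1)]) (rule half that(2); assumption)+
  have "eventually (\<lambda>i. (\<forall>\<sigma>\<in>traces A\<alpha>. cmod (\<sigma> (b i - (1 / m) *\<^sub>R P i)) < 2 * e) \<and>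
      (\<forall>\<sigma>\<in>traces A\<alpha>. cmod (\<sigma> (b i * b i - (1 / m) *\<^sub>R P i)) < 2 * e)) approx_filter"
  proof (rule eventually_conj)
    show "eventually (\<lambda>i. \<forall>\<sigma>\<in>traces A\<alpha>. cmod (\<sigma> (b i - (1 / m) *\<^sub>R P i)) < 2 * e) approx_filter"
      by (rule ev[OF tracks_diff[OF net tb tracks_scaleR[OF net tracks_one[OF net]]]]) (use z in blast)
    show "eventually (\<lambda>i. \<forall>\<sigma>\<in>traces A\<alpha>. cmod (\<sigma> (b i * b i - (1 / m) *\<^sub>R P i)) < 2 * e) approx_filter"
      by (rule ev[OF tracks_diff[OF net tracks_mult[OF net tb tb] tracks_scaleR[OF net tracks_one[OF net]]]]) (use z in blast)
  qed
  then obtain i where i: "\<forall>\<sigma>\<in>traces A\<alpha>. cmod (\<sigma> (b i - (1 / m) *\<^sub>R P i)) < 2 * e"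
    "\<forall>\<sigma>\<in>traces A\<alpha>. cmod (\<sigma> (b i * b i - (1 / m) *\<^sub>R P i)) < 2 * e"
    using eventually_happens'[OF approx_filter_neq_bot] by blast
  define Q where "Q = \<Phi> i (q k)"
  define b0 where "b0 = b i"
  have Q: "Q \<in> A\<alpha>" "b0 = st Q * Q" using approx_netD(2)[OF net] by (simp_all add: Q_def b0_def b_def)
  have b0: "b0 \<in> A\<alpha>" "st b0 = b0" using Q by (auto simp: st_mult intro!: csub_intros[OF B])
  have PB: "P i \<in> A\<alpha>" "norm (P i) \<le> 1" using net_P[OF net] by auto
  have est: "Re (\<sigma> b0) \<le> Re (\<sigma> (P i)) / m + 2 * e" "Re (\<sigma> (b0 * b0)) \<ge> Re (\<sigma> (P i)) / m - 2 * e"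
    "Re (\<sigma> (P i)) \<le> 1"
    if \<sigma>: "\<sigma> \<in> traces A\<alpha>" for \<sigma>
  proof -
    note U = B \<sigma>
    have "b0 * b0 \<in> A\<alpha>" "(1 / m) *\<^sub>R P i \<in> A\<alpha>" by (intro csub_intros[OF B] b0 PB)+
    then have "\<sigma> (b0 - (1 / m) *\<^sub>R P i) = \<sigma> b0 - of_real (1 / m) * \<sigma> (P i)"
      "\<sigma> (b0 * b0 - (1 / m) *\<^sub>R P i) = \<sigma> (b0 * b0) - of_real (1 / m) * \<sigma> (P i)"
      using b0 PB tr_diff[OF U] tr_scaleR[OF U] by metis+
    then have "cmod (\<sigma> b0 - of_real (1 / m) * \<sigma> (P i)) < 2 * e" "cmod (\<sigma> (b0 * b0) - of_real (1 / m) * \<sigma> (P i)) < 2 * e"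
      using i \<sigma> by (auto simp: b0_def)
    then have "\<bar>Re (\<sigma> b0 - of_real (1 / m) * \<sigma> (P i))\<bar> < 2 * e" "\<bar>Re (\<sigma> (b0 * b0) - of_real (1 / m) * \<sigma> (P i))\<bar> < 2 * e"
      using abs_Re_le_cmod le_less_trans by blast+
    then show "Re (\<sigma> b0) \<le> Re (\<sigma> (P i)) / m + 2 * e" "Re (\<sigma> (b0 * b0)) \<ge> Re (\<sigma> (P i)) / m - 2 * e" by auto
    show "Re (\<sigma> (P i)) \<le> 1"
      using tr_norm_le[OF U PB(1)] PB(2) complex_Re_le_cmod[of "\<sigma> (P i)"] by linarith
  qed
  have h0: "b0 - (1/2) *\<^sub>R 1 \<in> A\<alpha>" "st (b0 - (1/2) *\<^sub>R 1) = b0 - (1/2) *\<^sub>R 1"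
    using b0 by (auto simp: st_diff st_scaleR intro!: csub_intros[OF B])
  obtain c v s where c: "c \<in> A\<alpha>" "s \<in> A\<alpha>" "st c = c" "st s = s"
    "b0 - (1/2) *\<^sub>R 1 = c - v" "c * v = 0" "v * c = 0" "c + v = s * s"
    "\<And>z. z * (b0 - (1/2) *\<^sub>R 1) = (b0 - (1/2) *\<^sub>R 1) * z \<Longrightarrow> z * c = c * z \<and> z * v = v * z \<and> z * s = s * z"
    by (rule pos_neg_parts[OF B h0]) (rule that; assumption)
  have bs: "b0 * s = s * b0"
  proof -
    have "b0 * (b0 - (1/2) *\<^sub>R 1) = (b0 - (1/2) *\<^sub>R 1) * b0" by (simp add: algebra_simps)
    then show ?thesis using c(9) by blast
  qed
  have b_eq: "b0 = c - v + (1/2) *\<^sub>R 1" using c(5) by (simp add: algebra_simps)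
  have key: "c * (st Q * Q) * c - (1/2) *\<^sub>R (c * c) = st (s * c) * (s * c)"
  proof -
    have "c * b0 * c - (1/2) *\<^sub>R (c * c) = c * c * c" unfolding b_eq using c(6,7) by (simp add: algebra_simps)
    also have "\<dots> = c * (c + v) * c" using c(6,7) by (simp add: algebra_simps)
    also have "\<dots> = st (s * c) * (s * c)" unfolding c(8) by (simp add: st_mult c(3,4) mult.assoc)
    finally show ?thesis using Q(2) by simp
  qed
  obtain \<sigma>0 where \<sigma>0: "\<sigma>0 \<in> traces A\<alpha>" using trace_ex trace_restrict by blast
  have "c * c \<noteq> 0"
  proof
    assume "c * c = 0"
    then have "c = 0" using norm_sa_square[OF c(3)] by simp
    \<comment> \<open>Without spectrum above 1/2 one has \<open>b0 * b0\<close> below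
      \<open>b0 / 2\<close>, whereas the trace of \<open>b0 * b0\<close> nearly equals that of
      \<open>b0\<close>, both being about \<sigma>(P) / m.\<close>
    then have b': "b0 = (1/2) *\<^sub>R 1 - s * s" using b_eq c(8) by simp
    have "b0 * b0 = (1/2) *\<^sub>R b0 - b0 * (s * s)" by (subst (2) b') (simp add: algebra_simps)
    also have "b0 * (s * s) = s * b0 * s" by (metis bs mult.assoc)
    also have "s * b0 * s = st (Q * s) * (Q * s)" by (simp add: Q st_mult c(4) mult.assoc)
    finally have "b0 * b0 = (1/2) *\<^sub>R b0 - st (Q * s) * (Q * s)" .
    moreover have "\<sigma>0 ((1/2) *\<^sub>R b0 - st (Q * s) * (Q * s)) = of_real (1/2) * \<sigma>0 b0 - \<sigma>0 (st (Q * s) * (Q * s))"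
      using Q c(2) b0(1) by (simp only: tr_diff[OF B \<sigma>0] tr_scaleR[OF B \<sigma>0] csub_intros[OF B])
    moreover have "0 \<le> Re (\<sigma>0 (st (Q * s) * (Q * s)))" using tr_Re[OF B \<sigma>0] csub_mult[OF B Q(1) c(2)] by blast
    ultimately have "Re (\<sigma>0 (b0 * b0)) \<le> Re (\<sigma>0 b0) / 2" by simp
    then have "Re (\<sigma>0 (P i)) / m \<le> 6 * e" using est[OF \<sigma>0] by simp
    then have "Re (\<sigma>0 (P i)) \<le> 6 * (e * m)" using m by (simp add: divide_le_eq)
    then show False using half[OF \<sigma>0, of i] e(2) by simp
  qed
  moreover have "positive_in st A\<alpha> (c * c)" unfolding positive_in_def by (rule bexI[of _ c]) (simp_all add: c(1,3))
  moreover have "Re (\<sigma> q') \<le> \<delta>"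
    if \<sigma>: "\<sigma> \<in> traces A\<alpha>" and q': "projection_in st A\<alpha> q'" "cuntz_below st A\<alpha> q' (c * c)" for \<sigma> q'
  proof -
    have "(1/2) * Re (\<sigma> q') \<le> Re (\<sigma> (st Q * Q))"
      by (rule trace_of_cuntz[OF B \<sigma> q' c(1,3) Q(1) csub_mult[OF B c(2,1)] key])
    also have "\<dots> \<le> 1 / m + 2 * e"
      using est(1,3)[OF \<sigma>] m Q(2) divide_right_mono[OF est(3)[OF \<sigma>], of "real m"] by simp
    also have "\<dots> \<le> 2 / m" using m by (simp add: e_def field_simps)
    finally show ?thesis using m(2) by simp
  qed
  ultimately show ?thesis by blast
qed

text \<open>A local form of property \<Gamma> with exact elements of \<open>A\<alpha>\<close>. The
  norm bound \<open>C\<close> is a separate parameter because it must not depend on \<open>E\<close>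
  and \<epsilon>: choices for growing \<open>E\<close> are later joined into one bounded
  sequence.\<close>

definition gamma_approx :: "nat \<Rightarrow> real \<Rightarrow> 'a set \<Rightarrow> real \<Rightarrow> (nat \<Rightarrow> 'a) \<Rightarrow> bool" where
  "gamma_approx m C E \<epsilon> Q \<longleftrightarrow> (\<forall>i<m. Q i \<in> A\<alpha> \<and> norm (Q i) \<le> C) \<and> (\<forall>\<sigma>\<in>traces A\<alpha>.
      (\<forall>i<m. Re (\<sigma> (st (st (Q i) - Q i) * (st (Q i) - Q i))) < \<epsilon> \<and>
        Re (\<sigma> (st (Q i * Q i - Q i) * (Q i * Q i - Q i))) < \<epsilon> \<and>
        (\<forall>a\<in>E. Re (\<sigma> (st (Q i * a - a * Q i) * (Q i * a - a * Q i))) < \<epsilon> \<and>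
          cmod (\<sigma> (a * Q i) - \<sigma> a / of_nat m) < \<epsilon>)) \<and>
      Re (\<sigma> (st ((\<Sum>i<m. Q i) - 1) * ((\<Sum>i<m. Q i) - 1))) < \<epsilon>)"

text \<open>The images of the \<Gamma>-elements of \<open>A\<close> satisfy the relations with
  \<open>P\<close> in place of 1. The net is chosen for a \<open>y\<close> that forces \<sigma>(1 -
  P) \<le> \<delta> for all \<sigma>, so passing from \<open>P\<close> to 1 costs little in trace.
  \<open>C\<close> depends only on the bounded sequences chosen for \<open>m\<close>.\<close>

lemma fixed_gamma_local:
  assumes \<omega>: "free_ultrafilter \<omega>" and gamma: "uniform_gamma \<omega> sc st UNIV" and m: "m \<ge> 1"
  shows "\<exists>C. \<forall>E \<epsilon>. finite E \<longrightarrow> E \<subseteq> A\<alpha> \<longrightarrow> \<epsilon> > 0 \<longrightarrow> (\<exists>Q. gamma_approx m C E \<epsilon> Q)"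
proof -
  note B = csub_fixed_points
  let ?T = "traces UNIV" and ?S = "traces A\<alpha>"
  obtain p :: "nat \<Rightarrow> nat \<Rightarrow> 'a" where p:
    "\<And>i. i < m \<Longrightarrow> bounded_fun (p i)"
    "\<And>i. i < m \<Longrightarrow> tsmall \<omega> (\<lambda>k. st (p i k) - p i k)"
    "\<And>i. i < m \<Longrightarrow> tsmall \<omega> (\<lambda>k. p i k * p i k - p i k)"
    "\<And>i a. i < m \<Longrightarrow> tsmall \<omega> (\<lambda>k. p i k * a - a * p i k)"
    "tsmall \<omega> (\<lambda>k. (\<Sum>i<m. p i k) - 1)"
    "\<And>i a \<epsilon>. i < m \<Longrightarrow> \<epsilon> > 0 \<Longrightarrow>
      eventually (\<lambda>k. \<forall>\<tau>\<in>traces UNIV. cmod (\<tau> (a * p i k) - \<tau> a / of_nat m) < \<epsilon>) \<omega>"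
    by (rule gamma_sequences[OF \<omega> gamma m]) (rule that; assumption)
  have "\<exists>K. \<forall>k. norm (p i k) \<le> K" if "i < m" for i using p(1)[OF that] by (simp add: bounded_fun_def)
  then obtain K where K: "\<And>i k. i < m \<Longrightarrow> norm (p i k) \<le> K i" by metis
  define C where "C = 4 * (\<Sum>i<m. \<bar>K i\<bar>) + 1"
  have C: "4 * norm (p i k) + 1 \<le> C" if "i < m" for i k
  proof -
    have "\<bar>K i\<bar> \<le> (\<Sum>i<m. \<bar>K i\<bar>)" using that by (intro member_le_sum) auto
    then show ?thesis using K[OF that, of k] by (simp add: C_def)
  qed
  show ?thesis
  proof (intro exI[of _ C] allI impI)
    fix E and \<epsilon> :: real assume E: "finite E" "E \<subseteq> A\<alpha>" and \<epsilon>: "\<epsilon> > 0"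
    define e where "e = \<epsilon> / 8"
    have e: "e > 0" using \<epsilon> by (simp add: e_def)
    define L where "L = 1 + (\<Sum>a\<in>E. norm a)"
    have L0: "L > 0" using sum_nonneg[of E norm] by (simp add: L_def add_pos_nonneg)
    have L: "norm a \<le> L" if "a \<in> E" for a
      using member_le_sum[OF that _ E(1), of norm] by (simp add: L_def)
    \<comment> \<open>The first bound serves the sum to 1, where the error is below
      \<open>4 * e + 2 * \<delta> \<le> 6 * e\<close>. The second serves the traces of
      \<open>a * (1 - P)\<close>, since by Cauchy-Schwarz they are at most
      \<open>sqrt \<delta> * L \<le> \<epsilon> / 4\<close>.\<close>
    define \<delta> where "\<delta> = min e ((\<epsilon> / (4 * L))\<^sup>2)"
    have \<delta>: "\<delta> > 0" "\<delta> \<le> e" "\<delta> * L\<^sup>2 \<le> (\<epsilon> / 4)\<^sup>2"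
    proof -
      show "\<delta> > 0" "\<delta> \<le> e" using e \<epsilon> L0 by (auto simp: \<delta>_def)
      have "\<delta> * L\<^sup>2 \<le> (\<epsilon> / (4 * L))\<^sup>2 * L\<^sup>2" by (intro mult_right_mono) (auto simp: \<delta>_def)
      also have "\<dots> = (\<epsilon> / 4)\<^sup>2" using L0 by (simp add: power_divide power_mult_distrib)
      finally show "\<delta> * L\<^sup>2 \<le> (\<epsilon> / 4)\<^sup>2" .
    qed
    obtain y where y: "positive_in st A\<alpha> y" "y \<noteq> 0"
      "\<And>\<sigma> q. \<sigma> \<in> ?S \<Longrightarrow> projection_in st A\<alpha> q \<Longrightarrow> cuntz_below st A\<alpha> q y \<Longrightarrow> Re (\<sigma> q) \<le> \<delta>"
      using small_fixed_element[OF \<omega> gamma \<delta>(1)] by blast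
    obtain P \<Phi> where net: "approx_net (approx_filter :: ('a set \<times> nat) filter) P \<Phi>"
      and czy: "\<And>i. cuntz_below st A\<alpha> (1 - P i) y" and cz: "\<And>i. cuntz_below st A\<alpha> (1 - P i) (P i)"
      by (rule approx_net_exists[OF y(1,2)]) (rule that; assumption)
    have half: "Re (\<sigma> (P j)) \<ge> 1/2" if "\<sigma> \<in> ?S" for j \<sigma>
      using trace_half[OF approx_netD(1)[OF net] cz that] .
    note PB = net_P[OF net]
    have P': "projection_in st A\<alpha> (1 - P j)" "st (1 - P j) * (1 - P j) = 1 - P j" "1 - P j \<in> A\<alpha>" for j
    proof -
      show 1: "1 - P j \<in> A\<alpha>" by (intro csub_intros[OF B] PB)
      show 2: "st (1 - P j) * (1 - P j) = 1 - P j" by (simp add: st_diff PB algebra_simps)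
      show "projection_in st A\<alpha> (1 - P j)" using 1 2 PB by (simp add: projection_in_def st_diff)
    qed
    define ok where "ok x \<longleftrightarrow> (\<forall>\<tau>\<in>?T. Re (\<tau> (st x * x)) < e)" for x
    have okI: "eventually (\<lambda>k. ok (x k)) \<omega>" if "tsmall \<omega> x" for x
      using that e unfolding tsmall_def ok_def by blast
    have "eventually (\<lambda>k. (\<forall>i\<in>{..<m}. ok (st (p i k) - p i k) \<and> ok (p i k * p i k - p i k) \<and>
        (\<forall>a\<in>E. ok (p i k * a - a * p i k) \<and> (\<forall>\<tau>\<in>?T. cmod (\<tau> (a * p i k) - \<tau> a / of_nat m) < e)))
        \<and> ok ((\<Sum>i<m. p i k) - 1)) \<omega>"
      using e by (intro eventually_conj eventually_ball_finite ballI E okI p finite_lessThan) auto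
    moreover have "\<omega> \<noteq> bot" using \<omega> by (simp add: free_ultrafilter_def)
    ultimately obtain k where k: "(\<forall>i\<in>{..<m}. ok (st (p i k) - p i k) \<and> ok (p i k * p i k - p i k) \<and>
        (\<forall>a\<in>E. ok (p i k * a - a * p i k) \<and> (\<forall>\<tau>\<in>?T. cmod (\<tau> (a * p i k) - \<tau> a / of_nat m) < e)))
        \<and> ok ((\<Sum>i<m. p i k) - 1)"
      using eventually_happens' by blast
    define q where "q i = p i k" for i
    define R where "R i j = \<Phi> j (q i)" for i j
    have t: "tracks approx_filter \<Phi> (q i) (R i)" for i
      unfolding R_def by (rule tracks_self[OF net])
    have RB: "R i j \<in> A\<alpha>" for i j unfolding R_def by (rule approx_netD(2)[OF net])
    have bR: "bounded_fun (R i)" for i by (rule tracks_bounded_fun[OF net t])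
    \<comment> \<open>\<open>q i * 1\<close> and \<open>1 * q i\<close> are tracked by the products
      with \<open>P\<close>, so \<open>R i\<close> lies asymptotically in the corner of
      \<open>P\<close>.\<close>
    have RP: "asym_eq approx_filter (\<lambda>j. R i j * P j) (R i)" "asym_eq approx_filter (\<lambda>j. P j * R i j) (R i)" for i
    proof -
      have "tracks approx_filter \<Phi> (q i * 1) (\<lambda>j. R i j * P j)" "tracks approx_filter \<Phi> (1 * q i) (\<lambda>j. P j * R i j)"
        by (intro tracks_mult[OF net] t tracks_one[OF net])+
      then have 1: "asym_eq approx_filter (\<lambda>j. \<Phi> j (q i)) (\<lambda>j. R i j * P j)"
        "asym_eq approx_filter (\<lambda>j. \<Phi> j (q i)) (\<lambda>j. P j * R i j)" by (simp_all add: tracks_def)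
      have 2: "asym_eq approx_filter (\<lambda>j. \<Phi> j (q i)) (R i)" using t[of i] by (simp add: tracks_def)
      show "asym_eq approx_filter (\<lambda>j. R i j * P j) (R i)" "asym_eq approx_filter (\<lambda>j. P j * R i j) (R i)"
        by (rule asym_eq_trans[OF asym_eq_sym[OF 1(1)] 2] asym_eq_trans[OF asym_eq_sym[OF 1(2)] 2])+
    qed
    \<comment> \<open>For fixed \<open>a\<close> the factor \<open>P\<close> in the image of
      \<open>a\<close> is absorbed by \<open>R i\<close>. This carries commutation with elements of
      \<open>A\<alpha>\<close> through the map.\<close>
    have ta: "tracks approx_filter \<Phi> (q i * a) (\<lambda>j. R i j * a)" "tracks approx_filter \<Phi> (a * q i) (\<lambda>j. a * R i j)"
      if "a \<in> E" for i a
    proof -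
      have a: "a \<in> A\<alpha>" using that E by blast
      have "tracks approx_filter \<Phi> (q i * a) (\<lambda>j. R i j * (P j * a))"
        by (intro tracks_mult[OF net] t tracks_fixed[OF net] a)
      moreover have "asym_eq approx_filter (\<lambda>j. R i j * (P j * a)) (\<lambda>j. R i j * a)"
        using asym_eq_mult[OF RP(1) asym_eq_refl bounded_fun_mult[OF bR PB(5)] bounded_fun_const, of i a] by (simp add: mult.assoc)
      ultimately show "tracks approx_filter \<Phi> (q i * a) (\<lambda>j. R i j * a)"
        by (rule tracks_cong[OF net]) (intro bounded_fun_mult bR bounded_fun_const csub_mult[OF B] RB a)+
      have "tracks approx_filter \<Phi> (a * q i) (\<lambda>j. (a * P j) * R i j)"
        by (intro tracks_mult[OF net] t tracks_fixed[OF net] a)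
      moreover have "asym_eq approx_filter (\<lambda>j. (a * P j) * R i j) (\<lambda>j. a * R i j)"
        using asym_eq_mult[OF asym_eq_refl RP(2) bounded_fun_const bR, of a i] by (simp add: mult.assoc)
      ultimately show "tracks approx_filter \<Phi> (a * q i) (\<lambda>j. a * R i j)"
        by (rule tracks_cong[OF net]) (intro bounded_fun_mult bR bounded_fun_const csub_mult[OF B] RB a)+
    qed
    have small: "eventually (\<lambda>j. \<forall>\<sigma>\<in>?S. Re (\<sigma> (st (X j) * X j)) < 2 * e) approx_filter"
      if "tracks approx_filter \<Phi> x X" "ok x" for x X
    proof (rule tracks_square_small[OF net approx_filter_neq_bot that(1) _ _ e])
      show "Re (\<tau> (st x * x)) < e" if "\<tau> \<in> ?T" for \<tau> using \<open>ok x\<close> that by (simp add: ok_def)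
    qed (rule half)
    have small5: "eventually (\<lambda>j. \<forall>\<sigma>\<in>?S. cmod (\<sigma> (a * R i j - (1 / m) *\<^sub>R (a * P j))) < 2 * e) approx_filter"
      if "i < m" "a \<in> E" for i a
    proof (rule tracks_trace[OF net approx_filter_neq_bot _ _ _ e])
      show "tracks approx_filter \<Phi> (a * q i - (1 / m) *\<^sub>R a) (\<lambda>j. a * R i j - (1 / m) *\<^sub>R (a * P j))"
        using that E by (intro tracks_diff[OF net] tracks_scaleR[OF net] ta tracks_fixed[OF net]) auto
      show "cmod (\<tau> (a * q i - (1 / m) *\<^sub>R a)) < e" if \<tau>: "\<tau> \<in> ?T" for \<tau>
        using k \<open>i < m\<close> \<open>a \<in> E\<close> \<tau> by (simp add: tr_diff[OF csub_UNIV \<tau>] tr_scaleR[OF csub_UNIV \<tau>] q_def)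
    qed (rule half)
    have ok': "ok (st (q i) - q i)" "ok (q i * q i - q i)" "a \<in> E \<Longrightarrow> ok (q i * a - a * q i)" if "i < m" for i a
      using k that by (auto simp: q_def)
    have "eventually (\<lambda>j. (\<forall>i\<in>{..<m}. (\<forall>\<sigma>\<in>?S. Re (\<sigma> (st (st (R i j) - R i j) * (st (R i j) - R i j))) < 2 * e) \<and>
        (\<forall>\<sigma>\<in>?S. Re (\<sigma> (st (R i j * R i j - R i j) * (R i j * R i j - R i j))) < 2 * e) \<and>
        (\<forall>a\<in>E. (\<forall>\<sigma>\<in>?S. Re (\<sigma> (st (R i j * a - a * R i j) * (R i j * a - a * R i j))) < 2 * e) \<and>
          (\<forall>\<sigma>\<in>?S. cmod (\<sigma> (a * R i j - (1 / m) *\<^sub>R (a * P j))) < 2 * e)))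
        \<and> (\<forall>\<sigma>\<in>?S. Re (\<sigma> (st ((\<Sum>i<m. R i j) - P j) * ((\<Sum>i<m. R i j) - P j))) < 2 * e)) approx_filter"
    proof (rule eventually_conj)
      show "eventually (\<lambda>j. \<forall>i\<in>{..<m}. (\<forall>\<sigma>\<in>?S. Re (\<sigma> (st (st (R i j) - R i j) * (st (R i j) - R i j))) < 2 * e) \<and>
        (\<forall>\<sigma>\<in>?S. Re (\<sigma> (st (R i j * R i j - R i j) * (R i j * R i j - R i j))) < 2 * e) \<and>
        (\<forall>a\<in>E. (\<forall>\<sigma>\<in>?S. Re (\<sigma> (st (R i j * a - a * R i j) * (R i j * a - a * R i j))) < 2 * e) \<and>
          (\<forall>\<sigma>\<in>?S. cmod (\<sigma> (a * R i j - (1 / m) *\<^sub>R (a * P j))) < 2 * e))) approx_filter"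
      proof (rule eventually_ball_finite[OF finite_lessThan ballI])
        fix i assume "i \<in> {..<m}"
        then have i: "i < m" by simp
        note 1 = small[OF tracks_diff[OF net tracks_st[OF net t] t] ok'(1)[OF i]]
        note 2 = small[OF tracks_diff[OF net tracks_mult[OF net t t] t] ok'(2)[OF i]]
        note 3 = small[OF tracks_diff[OF net ta] ok'(3)[OF i]]
        note 4 = eventually_ball_finite[OF E(1) ballI, OF eventually_conj[OF 3 small5[OF i]]]
        show "eventually (\<lambda>j. (\<forall>\<sigma>\<in>?S. Re (\<sigma> (st (st (R i j) - R i j) * (st (R i j) - R i j))) < 2 * e) \<and>
          (\<forall>\<sigma>\<in>?S. Re (\<sigma> (st (R i j * R i j - R i j) * (R i j * R i j - R i j))) < 2 * e) \<and>
          (\<forall>a\<in>E. (\<forall>\<sigma>\<in>?S. Re (\<sigma> (st (R i j * a - a * R i j) * (R i j * a - a * R i j))) < 2 * e) \<and>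
            (\<forall>\<sigma>\<in>?S. cmod (\<sigma> (a * R i j - (1 / m) *\<^sub>R (a * P j))) < 2 * e))) approx_filter"
          by (rule eventually_conj[OF 1 eventually_conj[OF 2 4]])
      qed
      have "tracks approx_filter \<Phi> ((\<Sum>i<m. q i) - 1) (\<lambda>j. (\<Sum>i<m. R i j) - P j)"
        by (intro tracks_diff[OF net] tracks_sum[OF net] t tracks_one[OF net])
      moreover have "ok ((\<Sum>i<m. q i) - 1)" using k by (simp add: q_def)
      ultimately show "eventually (\<lambda>j. \<forall>\<sigma>\<in>?S. Re (\<sigma> (st ((\<Sum>i<m. R i j) - P j) * ((\<Sum>i<m. R i j) - P j))) < 2 * e) approx_filter"
        by (rule small)
    qed
    from eventually_happens'[OF approx_filter_neq_bot this] obtain j where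
      j: "(\<forall>i\<in>{..<m}. (\<forall>\<sigma>\<in>?S. Re (\<sigma> (st (st (R i j) - R i j) * (st (R i j) - R i j))) < 2 * e) \<and>
        (\<forall>\<sigma>\<in>?S. Re (\<sigma> (st (R i j * R i j - R i j) * (R i j * R i j - R i j))) < 2 * e) \<and>
        (\<forall>a\<in>E. (\<forall>\<sigma>\<in>?S. Re (\<sigma> (st (R i j * a - a * R i j) * (R i j * a - a * R i j))) < 2 * e) \<and>
          (\<forall>\<sigma>\<in>?S. cmod (\<sigma> (a * R i j - (1 / m) *\<^sub>R (a * P j))) < 2 * e)))"
      "\<forall>\<sigma>\<in>?S. Re (\<sigma> (st ((\<Sum>i<m. R i j) - P j) * ((\<Sum>i<m. R i j) - P j))) < 2 * e"
      by blast
    have 2: "2 * e < \<epsilon>" using \<epsilon> by (simp add: e_def)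
    have sum_est: "Re (\<sigma> (st ((\<Sum>i<m. R i j) - 1) * ((\<Sum>i<m. R i j) - 1))) < \<epsilon>" if \<sigma>: "\<sigma> \<in> ?S" for \<sigma>
    proof -
      define V where "V = (\<Sum>i<m. R i j) - P j"
      have V: "V \<in> A\<alpha>" unfolding V_def by (intro csub_intros[OF B] RB PB)
      have eq: "(\<Sum>i<m. R i j) - 1 = V + - (1 - P j)" by (simp add: V_def)
      have "Re (\<sigma> (st (V + - (1 - P j)) * (V + - (1 - P j))))
          \<le> 2 * Re (\<sigma> (st V * V)) + 2 * Re (\<sigma> (st (- (1 - P j)) * - (1 - P j)))"
        by (intro tr_st_add_le[OF B \<sigma>] V csub_minus[OF B] P')
      also have "st (- (1 - P j)) * - (1 - P j) = 1 - P j" by (simp only: st_minus minus_mult_minus P'(2))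
      also have "Re (\<sigma> (1 - P j)) \<le> \<delta>" by (rule y(3)[OF \<sigma> P'(1) czy])
      finally have "Re (\<sigma> (st (V + - (1 - P j)) * (V + - (1 - P j)))) \<le> 2 * Re (\<sigma> (st V * V)) + 2 * \<delta>" by simp
      moreover have "Re (\<sigma> (st V * V)) < 2 * e" using j(2) \<sigma> by (simp add: V_def)
      ultimately show ?thesis unfolding eq using \<delta>(2) \<epsilon> by (simp add: e_def)
    qed
    have tr_est: "cmod (\<sigma> (a * R i j) - \<sigma> a / of_nat m) < \<epsilon>" if \<sigma>: "\<sigma> \<in> ?S" and i: "i < m" and a: "a \<in> E" for \<sigma> i a
    proof -
      note U = B \<sigma>
      have aB: "a \<in> A\<alpha>" using a E by blast
      have s: "cmod (\<sigma> (a * R i j - (1 / m) *\<^sub>R (a * P j))) < 2 * e" using j(1) i a \<sigma> by blast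
      \<comment> \<open>So far the trace of \<open>a * R i j\<close> is compared with that of
        \<open>a * P j\<close>; this estimate replaces the latter by \<open>a\<close>.\<close>
      have "(cmod (\<sigma> (st (st a) * (1 - P j))))\<^sup>2
          \<le> Re (\<sigma> (st (1 - P j) * (1 - P j))) * Re (\<sigma> (st (st a) * st a))"
        by (intro tr_Cauchy_Schwarz[OF U] P' csub_st[OF B] aB)
      also have "\<dots> \<le> \<delta> * L\<^sup>2"
      proof (intro mult_mono)
        show "Re (\<sigma> (st (1 - P j) * (1 - P j))) \<le> \<delta>" unfolding P'(2) by (rule y(3)[OF \<sigma> P'(1) czy])
        show "Re (\<sigma> (st (st a) * st a)) \<le> L\<^sup>2"
          by (rule tr_st_mult_le[OF U csub_st[OF B aB]]) (simp add: L[OF a])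
        show "0 \<le> Re (\<sigma> (st (st a) * st a))" by (rule tr_Re[OF U csub_st[OF B aB]])
      qed (use \<delta> in simp)
      finally have "(cmod (\<sigma> (a * (1 - P j))))\<^sup>2 \<le> (\<epsilon> / 4)\<^sup>2" using \<delta>(3) by simp
      then have c: "cmod (\<sigma> (a * (1 - P j))) \<le> \<epsilon> / 4" by (rule power2_le_imp_le) (use \<epsilon> in simp)
      have "cmod (\<sigma> (a * (1 - P j)) / of_nat m) = cmod (\<sigma> (a * (1 - P j))) / real m" by (simp add: norm_divide)
      also have "\<dots> \<le> cmod (\<sigma> (a * (1 - P j))) / 1" using m by (intro divide_left_mono) auto
      finally have c': "cmod (\<sigma> (a * (1 - P j)) / of_nat m) \<le> \<epsilon> / 4" using c by simp
      have mem: "a * R i j \<in> A\<alpha>" "a * P j \<in> A\<alpha>" "(1 / m) *\<^sub>R (a * P j) \<in> A\<alpha>"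
        by (intro csub_intros[OF B] aB RB PB)+
      have "a * (1 - P j) = a - a * P j" by (simp add: algebra_simps)
      then have "\<sigma> (a * R i j) - \<sigma> a / of_nat m
          = \<sigma> (a * R i j - (1 / m) *\<^sub>R (a * P j)) - \<sigma> (a * (1 - P j)) / of_nat m"
        using m by (simp add: tr_diff[OF U] tr_scaleR[OF U] mem aB diff_divide_distrib)
      also have "cmod \<dots> < 2 * e + \<epsilon> / 4"
        using norm_triangle_ineq4[of "\<sigma> (a * R i j - (1 / m) *\<^sub>R (a * P j))" "\<sigma> (a * (1 - P j)) / of_nat m"] s c'
        by linarith
      finally show ?thesis using \<epsilon> by (simp add: e_def)
    qed
    show "\<exists>Q. gamma_approx m C E \<epsilon> Q"
      unfolding gamma_approx_def
    proof (intro exI[of _ "\<lambda>i. R i j"] conjI allI impI ballI)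
      fix i assume i: "i < m"
      show "R i j \<in> A\<alpha>" by (rule RB)
      show "norm (R i j) \<le> C"
        using order_trans[OF approx_netD(3)[OF net] C[OF i]] unfolding R_def q_def .
      fix \<sigma> assume \<sigma>: "\<sigma> \<in> ?S"
      note ji = bspec[OF j(1), of i, simplified lessThan_iff, OF i]
      show "Re (\<sigma> (st (st (R i j) - R i j) * (st (R i j) - R i j))) < \<epsilon>"
        "Re (\<sigma> (st (R i j * R i j - R i j) * (R i j * R i j - R i j))) < \<epsilon>"
        using ji \<sigma> by (auto intro: less_trans[OF _ 2])
      fix a assume a: "a \<in> E"
      show "Re (\<sigma> (st (R i j * a - a * R i j) * (R i j * a - a * R i j))) < \<epsilon>"
        using ji \<sigma> a by (auto intro: less_trans[OF _ 2])
      show "cmod (\<sigma> (a * R i j) - \<sigma> a / of_nat m) < \<epsilon>" by (rule tr_est[OF \<sigma> i a])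
    qed (rule sum_est)
  qed
qed

end

section \<open>Representing sequences along the ultrafilter\<close>

text \<open>A countable dense set of the whole space may miss \<open>B\<close>, so for each of its
  points \<open>d\<close> and each \<open>n\<close> a point of \<open>B\<close> within
  \<open>1 / (n + 1)\<close> of \<open>d\<close> is chosen if there is one, and \<open>b0\<close>
  otherwise.\<close>

lemma separable_subset:
  fixes B :: "'a::metric_space set"
  assumes sep: "separable_alg (UNIV :: 'a set)" and ne: "B \<noteq> {}"
  obtains a :: "nat \<Rightarrow> 'a" where "range a \<subseteq> B" "\<And>x \<epsilon>. x \<in> B \<Longrightarrow> \<epsilon> > 0 \<Longrightarrow> \<exists>l. dist (a l) x < \<epsilon>"
proof -
  obtain D :: "'a set" where D: "countable D" "UNIV \<subseteq> closure D" using sep by (auto simp: separable_alg_def)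
  obtain b0 where b0: "b0 \<in> B" using ne by blast
  define near where "near d n b \<longleftrightarrow> b \<in> B \<and> dist b d < inverse (real (Suc n))" for d n b
  define f where "f z = (if \<exists>b. near (fst z) (snd z) b then SOME b. near (fst z) (snd z) b else b0)" for z
  have f: "near d n (f (d, n))" if "\<exists>b. near d n b" for d n
    using someI_ex[OF that] that by (simp add: f_def)
  have fB: "f z \<in> B" for z
  proof (cases "\<exists>b. near (fst z) (snd z) b")
    case True
    from f[OF this] show ?thesis by (simp add: near_def)
  qed (simp add: f_def b0)
  define S where "S = f ` (D \<times> UNIV)"
  have S: "countable S" "S \<noteq> {}" using D by (auto simp: S_def)
  show ?thesis
  proof (rule that[of "from_nat_into S"])
    have "S \<subseteq> B" unfolding S_def using fB by blast
    then show "range (from_nat_into S) \<subseteq> B" using from_nat_into[OF S(2)] by blast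
    fix x and \<epsilon> :: real assume x: "x \<in> B" "\<epsilon> > 0"
    then obtain n where n: "inverse (real (Suc n)) < \<epsilon> / 2" using reals_Archimedean[of "\<epsilon> / 2"] by auto
    have "x \<in> closure D" using D(2) by blast
    moreover have "inverse (real (Suc n)) > 0" by simp
    ultimately obtain d where d: "d \<in> D" "dist d x < inverse (real (Suc n))"
      using closure_approachable by blast
    then have "near d n x" using x by (simp add: near_def dist_commute)
    then have "near d n (f (d, n))" using f by blast
    then have "dist (f (d, n)) x < \<epsilon>"
      using d(2) n dist_triangle[of "f (d, n)" x d] by (simp add: near_def)
    moreover have "f (d, n) \<in> S" using d(1) by (auto simp: S_def)
    then obtain l where "from_nat_into S l = f (d, n)" using from_nat_into_surj[OF S(1)] by blast
    ultimately show "\<exists>l. dist (from_nat_into S l) x < \<epsilon>" by metis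
  qed
qed

context cstar_algebra
begin

lemma trace_kernelI:
  assumes B: "csub B" and \<omega>: "free_ultrafilter \<omega>" and x: "bseq_in B x"
    and small: "\<And>\<epsilon>. \<epsilon> > 0 \<Longrightarrow> eventually (\<lambda>k. \<forall>\<sigma>\<in>traces B. Re (\<sigma> (st (x k) * x k)) < \<epsilon>) \<omega>"
  shows "x \<in> trace_kernel \<omega> sc st B"
proof -
  have "Lim \<omega> (\<lambda>k. \<tau>s k (st (x k) * x k)) = 0" if \<tau>s: "\<forall>n. \<tau>s n \<in> traces B" for \<tau>s
  proof (rule tendsto_Lim)
    show "\<omega> \<noteq> bot" using \<omega> by (simp add: free_ultrafilter_def)
    show "((\<lambda>k. \<tau>s k (st (x k) * x k)) \<longlongrightarrow> 0) \<omega>"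
    proof (rule tendstoI)
      fix \<epsilon> :: real assume "\<epsilon> > 0"
      from small[OF this] show "eventually (\<lambda>k. dist (\<tau>s k (st (x k) * x k)) 0 < \<epsilon>) \<omega>"
      proof eventually_elim
        case (elim k)
        have "x k \<in> B" using x by (simp add: bseq_in_def)
        then show ?case using elim \<tau>s tr_cmod_st_mult[OF B] by (simp add: dist_norm)
      qed
    qed
  qed
  then show ?thesis using x by (simp add: trace_kernel_def lim_trace_def)
qed

end

lemma free_ultrafilter_eventually:
  assumes "free_ultrafilter \<omega>" "eventually P sequentially" shows "eventually P \<omega>"
  using assms filter_leD by (auto simp: free_ultrafilter_def cofinite_eq_sequentially)

context rokhlin_system
begin

lemma bseq_inI: "(\<And>k. x k \<in> B) \<Longrightarrow> bounded_fun x \<Longrightarrow> bseq_in B x"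
  by (auto simp: bseq_in_def bounded_fun_def bounded_iff)

text \<open>A diagonal choice: the \<open>k\<close>-th elements treat the points \<open>a 0\<close>,
  ..., \<open>a k\<close> of a dense sequence with accuracy \<open>1 / (k + 1)\<close>. The common
  norm bound \<open>C\<close> extends the relations from the dense sequence to all of
  \<open>A\<alpha>\<close>.\<close>

lemma fixed_points_uniform_gamma:
  assumes \<omega>: "free_ultrafilter \<omega>" and gamma: "uniform_gamma \<omega> sc st UNIV"
    and sep: "separable_alg (UNIV :: 'a set)"
  shows "uniform_gamma \<omega> sc st A\<alpha>"
  unfolding uniform_gamma_def
proof (intro conjI allI impI)
  note B = csub_fixed_points
  let ?S = "traces A\<alpha>"
  show "trace_space sc st A\<alpha> \<noteq> {}" using trace_ex trace_restrict by (fastforce simp: trace_space_def)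
  show "compact (trace_space sc st A\<alpha>)" by (rule compact_trace_space[OF B])
  fix m :: nat assume m: "1 \<le> m"
  obtain a :: "nat \<Rightarrow> 'a" where a: "range a \<subseteq> A\<alpha>" "\<And>x \<epsilon>. x \<in> A\<alpha> \<Longrightarrow> \<epsilon> > 0 \<Longrightarrow> \<exists>l. dist (a l) x < \<epsilon>"
    using separable_subset[OF sep, of A\<alpha>] csub_one[OF B] by blast
  have aB: "a l \<in> A\<alpha>" for l using a(1) by blast
  define \<epsilon>k where "\<epsilon>k k = inverse (real (Suc k))" for k
  have \<epsilon>k: "\<epsilon>k k > 0" for k by (simp add: \<epsilon>k_def)
  obtain C where C: "\<forall>E \<epsilon>. finite E \<longrightarrow> E \<subseteq> A\<alpha> \<longrightarrow> \<epsilon> > 0 \<longrightarrow> (\<exists>Q. gamma_approx m C E \<epsilon> Q)"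
    using fixed_gamma_local[OF \<omega> gamma m] by blast
  have "\<exists>Q. gamma_approx m C (a ` {..k}) (\<epsilon>k k) Q" for k
    using C \<epsilon>k aB by (meson finite_atMost finite_imageI image_subsetI)
  then obtain Q where "\<And>k. gamma_approx m C (a ` {..k}) (\<epsilon>k k) (Q k)" by metis
  note Q = this[unfolded gamma_approx_def]
  \<comment> \<open>\<open>gamma_approx\<close> says nothing about indices from \<open>m\<close> on;
    zero there makes membership and the bound hold for every \<open>i\<close>.\<close>
  define p where "p i k = (if i < m then Q k i else 0)" for i k
  have pB: "p i k \<in> A\<alpha>" for i k using Q[of k] csub_zero[OF B] by (auto simp: p_def)
  have C0: "C \<ge> 0" using Q[of 0] m order_trans[OF norm_ge_zero] by (metis One_nat_def Suc_le_lessD)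
  have pC: "norm (p i k) \<le> C" for i k using Q[of k] C0 by (auto simp: p_def)
  have bp: "bounded_fun (p i)" for i by (rule bounded_funI[OF pC])
  have p1: "Re (\<sigma> (st (st (p i k) - p i k) * (st (p i k) - p i k))) < \<epsilon>k k"
    and p2: "Re (\<sigma> (st (p i k * p i k - p i k) * (p i k * p i k - p i k))) < \<epsilon>k k"
    if "\<sigma> \<in> ?S" "i < m" for \<sigma> i k
    using Q[of k] that by (auto simp: p_def)
  have p3: "Re (\<sigma> (st (p i k * a l - a l * p i k) * (p i k * a l - a l * p i k))) < \<epsilon>k k"
    and p4: "cmod (\<sigma> (a l * p i k) - \<sigma> (a l) / of_nat m) < \<epsilon>k k"
    if "\<sigma> \<in> ?S" "i < m" "l \<le> k" for \<sigma> i k l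
    using Q[of k] that by (auto simp: p_def)
  have p5: "Re (\<sigma> (st ((\<Sum>i<m. p i k) - 1) * ((\<Sum>i<m. p i k) - 1))) < \<epsilon>k k" if "\<sigma> \<in> ?S" for \<sigma> k
  proof -
    have "(\<Sum>i<m. p i k) = (\<Sum>i<m. Q k i)" by (intro sum.cong) (auto simp: p_def)
    then show ?thesis using Q[of k] that by simp
  qed
  have ev\<epsilon>: "eventually (\<lambda>k. \<epsilon>k k < \<epsilon>) \<omega>" if "\<epsilon> > 0" for \<epsilon>
    using free_ultrafilter_eventually[OF \<omega>] order_tendstoD(2)[OF LIMSEQ_inverse_real_of_nat that]
    by (simp add: \<epsilon>k_def)
  have evl: "eventually (\<lambda>k. l \<le> k) \<omega>" for l
    by (rule free_ultrafilter_eventually[OF \<omega> eventually_ge_at_top])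
  have kernel: "eq_tu \<omega> sc st A\<alpha> x y"
    if "\<And>k. x k \<in> A\<alpha>" "\<And>k. y k \<in> A\<alpha>" "bounded_fun x" "bounded_fun y"
      "\<And>\<sigma> k. \<sigma> \<in> ?S \<Longrightarrow> Re (\<sigma> (st (x k - y k) * (x k - y k))) < \<epsilon>k k" for x y
    unfolding eq_tu_def
  proof (rule trace_kernelI[OF B \<omega>])
    show "bseq_in A\<alpha> (\<lambda>k. x k - y k)"
      by (intro bseq_inI csub_diff[OF B] bounded_fun_diff that)
    show "eventually (\<lambda>k. \<forall>\<sigma>\<in>?S. Re (\<sigma> (st (x k - y k) * (x k - y k))) < \<epsilon>) \<omega>" if "\<epsilon> > 0" for \<epsilon>
      using ev\<epsilon>[OF that] by eventually_elim (meson less_trans \<open>\<And>\<sigma> k. \<sigma> \<in> ?S \<Longrightarrow> Re (\<sigma> (st (x k - y k) * (x k - y k))) < \<epsilon>k k\<close>)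
  qed
  have comm: "eq_tu \<omega> sc st A\<alpha> (\<lambda>k. p i k * x) (\<lambda>k. x * p i k)" if i: "i < m" and x: "x \<in> A\<alpha>" for i x
    unfolding eq_tu_def
  proof (rule trace_kernelI[OF B \<omega>])
    show "bseq_in A\<alpha> (\<lambda>k. p i k * x - x * p i k)"
      by (intro bseq_inI csub_diff[OF B] csub_mult[OF B] pB x bounded_fun_diff bounded_fun_mult bp bounded_fun_const)
    fix \<epsilon> :: real assume \<epsilon>: "\<epsilon> > 0"
    \<comment> \<open>Replacing \<open>x\<close> by a dense point changes the commutator by at most
      \<open>2 * C * r\<close>, hence its 2-norm squared is at most \<epsilon> / 4;
      \<open>tr_st_add_le\<close> doubles the two quarters. The summand 1 allows for
      \<open>C = 0\<close>.\<close>
    define r where "r = sqrt (\<epsilon> / 4) / (2 * C + 1)"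
    have r: "r > 0" "r * (2 * C + 1) = sqrt (\<epsilon> / 4)" using \<epsilon> C0 by (simp_all add: r_def add_nonneg_pos)
    obtain l where l: "dist (a l) x < r" using a(2)[OF x r(1)] by blast
    have "eventually (\<lambda>k. \<epsilon>k k < \<epsilon> / 4) \<omega>" using ev\<epsilon>[of "\<epsilon> / 4"] \<epsilon> by simp
    with evl[of l] show "eventually (\<lambda>k. \<forall>\<sigma>\<in>?S. Re (\<sigma> (st (p i k * x - x * p i k) * (p i k * x - x * p i k))) < \<epsilon>) \<omega>"
    proof eventually_elim
      case (elim k)
      show ?case
      proof
        fix \<sigma> assume \<sigma>: "\<sigma> \<in> ?S"
        define u v where "u = p i k * a l - a l * p i k" and "v = p i k * (x - a l) - (x - a l) * p i k"
        have uv: "p i k * x - x * p i k = u + v" by (simp add: u_def v_def algebra_simps)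
        have mem: "u \<in> A\<alpha>" "v \<in> A\<alpha>" unfolding u_def v_def by (intro csub_intros[OF B] pB aB x)+
        have xr: "norm (x - a l) \<le> r" using l by (simp add: dist_norm norm_minus_commute)
        have "norm v \<le> norm (p i k) * norm (x - a l) + norm (x - a l) * norm (p i k)"
          unfolding v_def by (intro norm_triangle_le_diff add_mono norm_mult_ineq)
        also have "\<dots> \<le> C * r + r * C"
          using pC[of i k] xr C0 r by (intro add_mono mult_mono) auto
        also have "\<dots> \<le> sqrt (\<epsilon> / 4)" using r by (simp add: algebra_simps)
        finally have "Re (\<sigma> (st v * v)) \<le> (sqrt (\<epsilon> / 4))\<^sup>2" by (rule tr_st_mult_le[OF B \<sigma> mem(2)])
        then have "Re (\<sigma> (st v * v)) \<le> \<epsilon> / 4" using \<epsilon> by simp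
        moreover have "Re (\<sigma> (st u * u)) < \<epsilon> / 4" using p3[OF \<sigma> i elim(1)] elim(2) by (simp add: u_def)
        ultimately show "Re (\<sigma> (st (p i k * x - x * p i k) * (p i k * x - x * p i k))) < \<epsilon>"
          unfolding uv using tr_st_add_le[OF B \<sigma> mem] by simp
      qed
    qed
  qed
  have tr: "lim_trace \<omega> \<tau>s (\<lambda>k. x * p i k) = lim_trace \<omega> \<tau>s (\<lambda>k. x) / of_nat m"
    if i: "i < m" and x: "x \<in> A\<alpha>" and \<tau>s: "\<forall>n. \<tau>s n \<in> ?S" for i x \<tau>s
  proof -
    have nb: "\<omega> \<noteq> bot" using \<omega> by (simp add: free_ultrafilter_def)
    have \<tau>: "\<tau>s n \<in> ?S" for n using \<tau>s by blast
    have "((\<lambda>k. \<tau>s k (x * p i k)) \<longlongrightarrow> Lim \<omega> (\<lambda>k. \<tau>s k (x * p i k))) \<omega>"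
    proof (rule ultrafilter_bounded_convergent[OF \<omega>])
      fix k
      have "cmod (\<tau>s k (x * p i k)) \<le> norm (x * p i k)" by (intro tr_norm_le[OF B \<tau>] csub_mult[OF B] x pB)
      also have "\<dots> \<le> norm x * norm (p i k)" by (rule norm_mult_ineq)
      also have "\<dots> \<le> norm x * C" by (intro mult_left_mono pC) simp
      finally show "cmod (\<tau>s k (x * p i k)) \<le> norm x * C" .
    qed
    moreover have "((\<lambda>k. \<tau>s k x) \<longlongrightarrow> Lim \<omega> (\<lambda>k. \<tau>s k x)) \<omega>"
      by (rule ultrafilter_bounded_convergent[OF \<omega>]) (rule tr_norm_le[OF B \<tau> x])
    ultimately have 1: "((\<lambda>k. \<tau>s k (x * p i k) - \<tau>s k x / of_nat m) \<longlongrightarrow>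
        Lim \<omega> (\<lambda>k. \<tau>s k (x * p i k)) - Lim \<omega> (\<lambda>k. \<tau>s k x) / of_nat m) \<omega>"
      using m by (intro tendsto_intros) auto
    have 2: "((\<lambda>k. \<tau>s k (x * p i k) - \<tau>s k x / of_nat m) \<longlongrightarrow> 0) \<omega>"
    proof (rule tendstoI)
      fix \<epsilon> :: real assume \<epsilon>: "\<epsilon> > 0"
      \<comment> \<open>The replacement error is at most \<open>C * r\<close> in the trace of the
        product and \<open>r\<close> in the other term.\<close>
      define r where "r = (\<epsilon> / 2) / (C + 1)"
      have "C + 1 \<noteq> 0" using C0 by simp
      then have r: "r > 0" "r * (C + 1) = \<epsilon> / 2" using \<epsilon> C0 unfolding r_def by (intro divide_pos_pos, simp_all del: divide_divide_eq_left)
      obtain l where l: "dist (a l) x < r" using a(2)[OF x r(1)] by blast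
      have "eventually (\<lambda>k. \<epsilon>k k < \<epsilon> / 2) \<omega>" using ev\<epsilon>[of "\<epsilon> / 2"] \<epsilon> by simp
      with evl[of l] show "eventually (\<lambda>k. dist (\<tau>s k (x * p i k) - \<tau>s k x / of_nat m) 0 < \<epsilon>) \<omega>"
      proof eventually_elim
        case (elim k)
        note U = B \<tau>[of k]
        define w where "w = x - a l"
        have w: "w \<in> A\<alpha>" unfolding w_def by (intro csub_diff[OF B] x aB)
        have nw: "norm w \<le> r" using l by (simp add: w_def dist_norm norm_minus_commute)
        have mem: "a l * p i k \<in> A\<alpha>" "w * p i k \<in> A\<alpha>" by (intro csub_mult[OF B] aB w pB)+
        have "x * p i k = a l * p i k + w * p i k" by (simp add: w_def algebra_simps)
        moreover have "\<tau>s k x = \<tau>s k (a l) + \<tau>s k w"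
          using tr_add[OF U aB w, of l] by (simp add: w_def)
        ultimately have eq: "\<tau>s k (x * p i k) - \<tau>s k x / of_nat m
            = (\<tau>s k (a l * p i k) - \<tau>s k (a l) / of_nat m) + (\<tau>s k (w * p i k) - \<tau>s k w / of_nat m)"
          by (simp add: tr_add[OF U mem] add_divide_distrib)
        have "cmod (\<tau>s k (w * p i k)) \<le> norm (w * p i k)" by (rule tr_norm_le[OF U mem(2)])
        also have "\<dots> \<le> norm w * norm (p i k)" by (rule norm_mult_ineq)
        also have "\<dots> \<le> r * C" using nw pC[of i k] r C0 by (intro mult_mono) auto
        finally have a1: "cmod (\<tau>s k (w * p i k)) \<le> r * C" .
        have "cmod (\<tau>s k w / of_nat m) = cmod (\<tau>s k w) / real m" by (simp add: norm_divide)
        also have "\<dots> \<le> cmod (\<tau>s k w) / 1" using m by (intro divide_left_mono) auto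
        also have "\<dots> \<le> r" using tr_norm_le[OF U w] nw by simp
        finally have a2: "cmod (\<tau>s k w / of_nat m) \<le> r" .
        have "cmod (\<tau>s k (w * p i k) - \<tau>s k w / of_nat m) \<le> r * C + r"
          by (intro norm_triangle_le_diff add_mono a1 a2)
        then have "cmod (\<tau>s k (w * p i k) - \<tau>s k w / of_nat m) \<le> \<epsilon> / 2" using r(2) by (simp add: algebra_simps)
        moreover have "cmod (\<tau>s k (a l * p i k) - \<tau>s k (a l) / of_nat m) < \<epsilon> / 2"
          using p4[OF \<tau> i elim(1)] elim(2) by (meson less_trans)
        ultimately show ?case unfolding eq dist_norm diff_0_right
          by (intro le_less_trans[OF norm_triangle_ineq]) linarith
      qed
    qed
    from tendsto_unique[OF nb 1 2] show ?thesis by (simp add: lim_trace_def)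
  qed
  show "\<exists>p :: nat \<Rightarrow> nat \<Rightarrow> 'a.
        (\<forall>i<m. bseq_in A\<alpha> (p i)) \<and>
        (\<forall>i<m. eq_tu \<omega> sc st A\<alpha> (\<lambda>k. st (p i k)) (p i)) \<and>
        (\<forall>i<m. eq_tu \<omega> sc st A\<alpha> (\<lambda>k. p i k * p i k) (p i)) \<and>
        (\<forall>i<m. \<forall>a\<in>A\<alpha>. eq_tu \<omega> sc st A\<alpha> (\<lambda>k. p i k * a) (\<lambda>k. a * p i k)) \<and>
        eq_tu \<omega> sc st A\<alpha> (\<lambda>k. \<Sum>i<m. p i k) (\<lambda>k. 1) \<and>
        (\<forall>i<m. \<forall>a\<in>A\<alpha>. \<forall>\<tau>s. (\<forall>n. \<tau>s n \<in> traces A\<alpha>) \<longrightarrow>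
            lim_trace \<omega> \<tau>s (\<lambda>k. a * p i k) = lim_trace \<omega> \<tau>s (\<lambda>k. a) / of_nat m)"
  proof (intro exI[of _ p] conjI allI impI ballI)
    show "bseq_in A\<alpha> (p i)" for i by (rule bseq_inI[OF pB bp])
    show "eq_tu \<omega> sc st A\<alpha> (\<lambda>k. st (p i k)) (p i)" if "i < m" for i
      by (intro kernel csub_st[OF B] pB bounded_fun_st bp p1 that)
    show "eq_tu \<omega> sc st A\<alpha> (\<lambda>k. p i k * p i k) (p i)" if "i < m" for i
      by (intro kernel csub_mult[OF B] pB bounded_fun_mult bp p2 that)
    show "eq_tu \<omega> sc st A\<alpha> (\<lambda>k. \<Sum>i<m. p i k) (\<lambda>k. 1)"
      by (intro kernel csub_sum[OF B] csub_one[OF B] pB bounded_fun_sum bp bounded_fun_const p5)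
  qed (rule comm tr; assumption)+
qed

end

theorem theorem3p5:
  fixes sc :: "complex \<Rightarrow> 'a::{real_normed_algebra_1,banach} \<Rightarrow> 'a"
    and st :: "'a \<Rightarrow> 'a"
    and mul :: "'g::{second_countable_topology,t2_space} \<Rightarrow> 'g \<Rightarrow> 'g"
    and iv :: "'g \<Rightarrow> 'g" and e :: 'g
    and \<alpha> :: "'g \<Rightarrow> 'a \<Rightarrow> 'a"
    and \<omega> :: "nat filter"
  assumes "free_ultrafilter \<omega>"
    and "cstar_alg sc st"
    and "separable_alg (UNIV :: 'a set)"
    and "simple_alg sc"
    and "infinite_dim sc"
    and "uniform_gamma \<omega> sc st UNIV"
    and "top_group mul iv e"
    and "compact (UNIV :: 'g set)"
    and "cstar_action sc st mul e \<alpha>"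
    and "tracial_rokhlin_comparison sc st mul iv \<alpha>"
  shows "uniform_gamma \<omega> sc st (fixed_points \<alpha>)"
proof -
  \<comment> \<open>A trace on \<open>A\<close>, from which positivity and fixed points near almost
    invariant elements are derived, is part of property \<Gamma> for \<open>A\<close>.\<close>
  have "tracial_states sc st UNIV \<noteq> {}"
    using assms(6) by (auto simp: uniform_gamma_def trace_space_def)
  with assms interpret rokhlin_system sc st mul iv e \<alpha>
    by unfold_locales
  show ?thesis by (rule fixed_points_uniform_gamma[OF assms(1,6,3)])
qed

end
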